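(* Let $G$ be a finite solvable nontrivial group, and let $p$ be a prime divisor of $|G|$. Let $\mathcal{A}$ be either the set of nonlinear, monomial, monolithic characters in $\mathrm{Irr}(G)$ or the set of nonlinear, monomial, monolithic Brauer characters in $\mathrm{IBr}(G)$. If $\mathrm{cod}(\chi)$ is a power of $p$ for every $\chi \in \mathcal{A}$, then $G$ is $p$-closed. (That is, the implication holds for each of the two choices of $\mathcal{A}$ separately.)
   Context: All groups are finite. $\mathrm{Irr}(G)$ denotes the set of irreducible (complex) characters of $G$, and, for the fixed prime $p$, $\mathrm{IBr}(G)$ denotes the set of irreducible $p$-Brauer characters of $G$. The kernel $\ker(\chi)$ of an ordinary (respectively Brauer) character $\chi$ is the kernel of a complex representation (respectively, for $\chi \in \mathrm{IBr}(G)$, of an irreducible representation over an algebraically closed field of characteristic $p$) affording $\chi$. A character $\chi$ is nonlinear if $\chi(1) > 1$. A character (respectively Brauer character) of $G$ is monomial if it is induced from a linear (degree one) character (respectively linear Brauer character) of some subgroup of $G$. A character or Brauer character $\chi$ of $G$ is monolithic if $G/\ker(\chi)$ has a unique minimal normal subgroup. The codegree of $\chi$ is $\mathrm{cod}(\chi) = |G : \ker(\chi)|/\chi(1)$. A group is $p$-closed if it has a normal Sylow $p$-subgroup. *)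

theory Defs
  imports
    "HOL-Algebra.Solvable_Groups"
    "HOL-Algebra.Multiplicative_Group"
    "Jordan_Normal_Form.VS_Connect"
    "Jordan_Normal_Form.Char_Poly"
begin

section \<open>Matrix representations\<close>

abbreviation GL :: "'k::field itself \<Rightarrow> nat \<Rightarrow> 'k mat monoid" where
  "GL ty n \<equiv> units_of (ring_mat ty n ())"

definition representation ::
    "('a, 'b) monoid_scheme \<Rightarrow> nat \<Rightarrow> ('a \<Rightarrow> 'k::field mat) \<Rightarrow> bool" where
  "representation G n \<rho> \<longleftrightarrow> \<rho> \<in> hom G (GL TYPE('k) n)"

definition irreducible_representation ::
    "('a, 'b) monoid_scheme \<Rightarrow> nat \<Rightarrow> ('a \<Rightarrow> 'k::field mat) \<Rightarrow> bool" where
  "irreducible_representation G n \<rho> \<longleftrightarrow>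
     representation G n \<rho> \<and> n > 0 \<and>
     (\<forall>W. VectorSpace.subspace class_ring W (module_vec TYPE('k) n) \<and>
          (\<forall>g\<in>carrier G. \<forall>w\<in>W. \<rho> g *\<^sub>v w \<in> W)
          \<longrightarrow> W = {0\<^sub>v n} \<or> W = carrier_vec n)"

definition rep_kernel ::
    "('a, 'b) monoid_scheme \<Rightarrow> nat \<Rightarrow> ('a \<Rightarrow> 'k::field mat) \<Rightarrow> 'a set" where
  "rep_kernel G n \<rho> = kernel G (GL TYPE('k) n) \<rho>"

section \<open>Ordinary characters\<close>

text \<open>Characters are functions on the whole type; they are given the value 0 outside the group
  (Brauer characters: outside the set of p-regular elements of the group).\<close>

definition mat_trace :: "'k::comm_ring_1 mat \<Rightarrow> 'k" where
  "mat_trace A = (\<Sum>i<dim_row A. A $$ (i, i))"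

definition character ::
    "('a, 'b) monoid_scheme \<Rightarrow> ('a \<Rightarrow> complex mat) \<Rightarrow> 'a \<Rightarrow> complex" where
  "character G \<rho> = (\<lambda>g. if g \<in> carrier G then mat_trace (\<rho> g) else 0)"

definition Irr :: "('a, 'b) monoid_scheme \<Rightarrow> ('a \<Rightarrow> complex) set" where
  "Irr G = {character G \<rho> | n \<rho>. irreducible_representation G n \<rho>}"

text \<open>The kernel does not depend on the choice of the representation affording the character.\<close>

definition char_kernel :: "('a, 'b) monoid_scheme \<Rightarrow> ('a \<Rightarrow> complex) \<Rightarrow> 'a set" where
  "char_kernel G \<chi> =
     (SOME K. \<exists>n \<rho>. representation G n \<rho> \<and> character G \<rho> = \<chi> \<and> K = rep_kernel G n \<rho>)"

section \<open>Brauer characters\<close>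

text \<open>Brauer characters depend on an algebraically closed field \<open>'k\<close> of characteristic p and on an
  identification of the roots of unity of \<open>'k\<close> with the complex roots of unity of order prime to p.
  If \<open>'k\<close> is the quotient of the ring of algebraic integers by a maximal ideal containing p, then
  the inverse of reduction modulo that ideal is such an identification.\<close>

definition brauer_lift :: "('k::field \<Rightarrow> complex) \<Rightarrow> bool" where
  "brauer_lift \<xi> \<longleftrightarrow>
     bij_betw \<xi> {x. \<exists>n>0. x ^ n = 1} {z. \<exists>n>0. coprime n CHAR('k) \<and> z ^ n = 1} \<and>
     (\<forall>x y. (\<exists>n>0. x ^ n = 1) \<longrightarrow> (\<exists>n>0. y ^ n = 1) \<longrightarrow> \<xi> (x * y) = \<xi> x * \<xi> y)"

text \<open>\<open>proots\<close> is the multiset of roots, so eigenvalues are counted with algebraic multiplicity.\<close>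

definition brauer_character ::
    "('k::field \<Rightarrow> complex) \<Rightarrow> ('a, 'b) monoid_scheme \<Rightarrow> ('a \<Rightarrow> 'k mat) \<Rightarrow> 'a \<Rightarrow> complex" where
  "brauer_character \<xi> G \<rho> =
     (\<lambda>g. if g \<in> carrier G \<and> coprime (group.ord G g) CHAR('k)
          then \<Sum>a\<in>#proots (char_poly (\<rho> g)). \<xi> a else 0)"

definition IBr ::
    "('k::field \<Rightarrow> complex) \<Rightarrow> ('a, 'b) monoid_scheme \<Rightarrow> ('a \<Rightarrow> complex) set" where
  "IBr \<xi> G = {brauer_character \<xi> G \<rho> | n \<rho>. irreducible_representation G n \<rho>}"

text \<open>Irreducibility is essential here: reducible representations with the same Brauer character
  may have different kernels.\<close>

definition brauer_kernel ::
    "('k::field \<Rightarrow> complex) \<Rightarrow> ('a, 'b) monoid_scheme \<Rightarrow> ('a \<Rightarrow> complex) \<Rightarrow> 'a set" where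
  "brauer_kernel \<xi> G \<phi> =
     (SOME K. \<exists>n \<rho>. irreducible_representation G n \<rho> \<and> brauer_character \<xi> G \<rho> = \<phi> \<and>
                   K = rep_kernel G n \<rho>)"

section \<open>Monomial and monolithic characters, codegrees\<close>

text \<open>As \<open>\<mu>\<close> vanishes outside \<open>H\<close> (and off the p-regular elements of \<open>H\<close> if it is a Brauer
  character), the same formula gives induction of ordinary and of Brauer characters.\<close>

definition induced_character ::
    "('a, 'b) monoid_scheme \<Rightarrow> 'a set \<Rightarrow> ('a \<Rightarrow> complex) \<Rightarrow> 'a \<Rightarrow> complex" where
  "induced_character G H \<mu> =
     (\<lambda>g. if g \<in> carrier G
          then (\<Sum>x\<in>carrier G. \<mu> (x \<otimes>\<^bsub>G\<^esub> g \<otimes>\<^bsub>G\<^esub> inv\<^bsub>G\<^esub> x)) / of_nat (card H) else 0)"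

text \<open>The parameter \<open>X\<close> below is \<open>Irr\<close> or \<open>IBr \<xi>\<close>, and \<open>Ker\<close> is \<open>char_kernel\<close> or \<open>brauer_kernel \<xi>\<close>.\<close>

definition monomial_char ::
    "(('a, 'b) monoid_scheme \<Rightarrow> ('a \<Rightarrow> complex) set) \<Rightarrow>
     ('a, 'b) monoid_scheme \<Rightarrow> ('a \<Rightarrow> complex) \<Rightarrow> bool" where
  "monomial_char X G \<chi> \<longleftrightarrow>
     (\<exists>H \<mu>. subgroup H G \<and> \<mu> \<in> X (G\<lparr>carrier := H\<rparr>) \<and> \<mu> \<one>\<^bsub>G\<^esub> = 1 \<and>
            \<chi> = induced_character G H \<mu>)"

definition minimal_normal :: "'a set \<Rightarrow> ('a, 'b) monoid_scheme \<Rightarrow> bool" where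
  "minimal_normal N G \<longleftrightarrow>
     N \<lhd> G \<and> N \<noteq> {\<one>\<^bsub>G\<^esub>} \<and> (\<forall>M. M \<lhd> G \<and> M \<subseteq> N \<longrightarrow> M = {\<one>\<^bsub>G\<^esub>} \<or> M = N)"

definition monolithic_char ::
    "(('a, 'b) monoid_scheme \<Rightarrow> ('a \<Rightarrow> complex) \<Rightarrow> 'a set) \<Rightarrow>
     ('a, 'b) monoid_scheme \<Rightarrow> ('a \<Rightarrow> complex) \<Rightarrow> bool" where
  "monolithic_char Ker G \<chi> \<longleftrightarrow> (\<exists>!N. minimal_normal N (G Mod Ker G \<chi>))"

definition nonlinear_monomial_monolithic ::
    "(('a, 'b) monoid_scheme \<Rightarrow> ('a \<Rightarrow> complex) set) \<Rightarrow>
     (('a, 'b) monoid_scheme \<Rightarrow> ('a \<Rightarrow> complex) \<Rightarrow> 'a set) \<Rightarrow>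
     ('a, 'b) monoid_scheme \<Rightarrow> ('a \<Rightarrow> complex) set" where
  "nonlinear_monomial_monolithic X Ker G =
     {\<chi> \<in> X G. Re (\<chi> \<one>\<^bsub>G\<^esub>) > 1 \<and> monomial_char X G \<chi> \<and> monolithic_char Ker G \<chi>}"

definition codegree ::
    "(('a, 'b) monoid_scheme \<Rightarrow> ('a \<Rightarrow> complex) \<Rightarrow> 'a set) \<Rightarrow>
     ('a, 'b) monoid_scheme \<Rightarrow> ('a \<Rightarrow> complex) \<Rightarrow> complex" where
  "codegree Ker G \<chi> = of_nat (card (rcosets\<^bsub>G\<^esub> (Ker G \<chi>))) / \<chi> \<one>\<^bsub>G\<^esub>"

section \<open>p-closed groups\<close>

definition p_closed :: "nat \<Rightarrow> ('a, 'b) monoid_scheme \<Rightarrow> bool" where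
  "p_closed p G \<longleftrightarrow> (\<exists>P. P \<lhd> G \<and> card P = p ^ multiplicity p (Coset.order G))"

end

theory Submission
  imports Defs
    "HOL-Computational_Algebra.Fundamental_Theorem_Algebra"
    "HOL-Combinatorics.Cycles"
    "HOL-Algebra.Sylow"
    "HOL-Algebra.Group_Action"
    "HOL-Algebra.Zassenhaus"
    "Jordan_Normal_Form.Schur_Decomposition"
begin

text \<open>Pass to a quotient \<open>B\<close> of \<open>G\<close> that is not \<open>p\<close>-closed although all its proper quotients are.
  Then \<open>B\<close> has a unique minimal normal subgroup \<open>N\<close>; it is abelian of order prime to \<open>p\<close>. If \<open>P\<close> is a
  Sylow \<open>p\<close>-subgroup of \<open>B\<close>, then \<open>N P\<close> is normal in \<open>B\<close>, so a Frattini argument shows that the normalizer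
  \<open>H\<close> of \<open>P\<close> is a complement of \<open>N\<close>. A nontrivial linear character \<open>\<nu>\<close> of \<open>N\<close> over the given field extends
  trivially along \<open>H\<close> to its stabilizer \<open>T = N (T \<inter> H)\<close>. The character of \<open>B\<close> induced from \<open>T\<close> is irreducible,
  because the conjugates of \<open>\<nu>\<close> are distinct, and faithful, because its kernel does not contain \<open>N\<close>; it is
  nonlinear, because \<open>B\<close> is not abelian. Its codegree is \<open>|T|\<close>, which is divisible by \<open>|N|\<close> and hence is not
  a power of \<open>p\<close>.

  Ordinary characters are treated as the case \<open>\<xi> = id\<close> of the formula that defines Brauer characters:
  the trace is the sum of the eigenvalues.\<close>

section \<open>Polynomials of a matrix and eigenvectors\<close>

text \<open>A Brauer lift \<open>\<xi>\<close> is multiplicative but not additive, so the formula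
  for induced characters cannot be obtained from traces: the whole multiset of eigenvalues of a
  monomial matrix is needed. It is accessible because a nontrivial orbit of the underlying
  permutation contributes a multiset invariant under multiplication by some root of unity other than
  1.

  Another obstacle is that kernels of characters are defined by a choice of representation. Ordinary
  values determine the kernel. Brauer values see only the regular elements, and the rest of the
  kernel is recovered from irreducibility and solvability.

  That \<open>p\<close> does not divide the order of \<open>N\<close> does more than give the final
  contradiction: it makes the Sylow count in \<open>N P\<close> work, and it supplies nontrivial
  linear characters of \<open>N\<close> in characteristic \<open>p\<close>.\<close>

lemma smult_zero_vec: "c \<cdot>\<^sub>v 0\<^sub>v n = (0\<^sub>v n :: 'k::field vec)"
  by (rule eq_vecI) auto

lemma zero_smult_vec_add: "u \<in> carrier_vec n \<Longrightarrow> v \<in> carrier_vec n \<Longrightarrow> 0 \<cdot>\<^sub>v v + u = (u :: 'k::field vec)"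
  by (rule eq_vecI) auto

lemma mult_mat_zero_vec: "A \<in> carrier_mat m n \<Longrightarrow> A *\<^sub>v 0\<^sub>v n = (0\<^sub>v m :: 'k::field vec)"
  by (rule eq_vecI) auto

lemma pow_mat_mult_vec_Suc:
  fixes A :: "'k::field mat"
  assumes "A \<in> carrier_mat n n" "v \<in> carrier_vec n"
  shows "A ^\<^sub>m Suc k *\<^sub>v v = A *\<^sub>v (A ^\<^sub>m k *\<^sub>v v)"
  using assms
proof (induction k arbitrary: v)
  case (Suc k)
  have "A ^\<^sub>m Suc (Suc k) *\<^sub>v v = A ^\<^sub>m Suc k *\<^sub>v (A *\<^sub>v v)"
    using Suc.prems by (metis assoc_mult_mat_vec pow_carrier_mat pow_mat.simps(2))
  also have "\<dots> = A *\<^sub>v (A ^\<^sub>m k *\<^sub>v (A *\<^sub>v v))" using Suc by auto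
  also have "A ^\<^sub>m k *\<^sub>v (A *\<^sub>v v) = A ^\<^sub>m Suc k *\<^sub>v v"
    using Suc.prems by (metis assoc_mult_mat_vec pow_carrier_mat pow_mat.simps(2))
  finally show ?case .
qed auto

text \<open>The vector \<open>p(A) v\<close>, by Horner's scheme: only matrix-vector products occur,
  and no polynomial is evaluated in the matrix ring.\<close>

definition poly_act :: "'k::field mat \<Rightarrow> 'k poly \<Rightarrow> 'k vec \<Rightarrow> 'k vec" where
  "poly_act A p v = fold_coeffs (\<lambda>a u. a \<cdot>\<^sub>v v + A *\<^sub>v u) p (0\<^sub>v (dim_vec v))"

context
  fixes A :: "'k::field mat" and n :: nat
  assumes A: "A \<in> carrier_mat n n"
begin

lemma poly_act_0 [simp]: "v \<in> carrier_vec n \<Longrightarrow> poly_act A 0 v = 0\<^sub>v n"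
  by (simp add: poly_act_def)

lemma poly_act_pCons:
  assumes "v \<in> carrier_vec n"
  shows "poly_act A (pCons a p) v = a \<cdot>\<^sub>v v + A *\<^sub>v poly_act A p v"
proof (cases "a = 0 \<and> p = 0")
  case True
  then show ?thesis using A assms by (auto intro!: eq_vecI)
next
  case False
  then show ?thesis
    by (cases "p = 0") (simp_all add: poly_act_def)
qed

lemma poly_act_closed [simp]: "v \<in> carrier_vec n \<Longrightarrow> poly_act A p v \<in> carrier_vec n"
  using A by (induction p) (auto simp: poly_act_pCons)

lemma poly_act_add:
  assumes v: "v \<in> carrier_vec n"
  shows "poly_act A (p + q) v = poly_act A p v + poly_act A q v"
proof (induction p q rule: poly_induct2)
  case 0
  then show ?case using v by simp
next
  case (pCons a p b q)
  have "A *\<^sub>v (poly_act A p v + poly_act A q v) = A *\<^sub>v poly_act A p v + A *\<^sub>v poly_act A q v"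
    using A v by (intro mult_add_distrib_mat_vec) auto
  then show ?case using A v pCons
    by (auto simp: poly_act_pCons add_smult_distrib_vec algebra_simps intro!: eq_vecI)
qed

lemma poly_act_smult:
  assumes v: "v \<in> carrier_vec n"
  shows "poly_act A (smult c p) v = c \<cdot>\<^sub>v poly_act A p v"
proof (induction p)
  case 0
  then show ?case using v by (simp add: smult_zero_vec)
next
  case (pCons a p)
  have "A *\<^sub>v (c \<cdot>\<^sub>v poly_act A p v) = c \<cdot>\<^sub>v (A *\<^sub>v poly_act A p v)"
    using A v by (intro mult_mat_vec) auto
  then show ?case using A v pCons
    by (auto simp: poly_act_pCons smult_add_distrib_vec algebra_simps intro!: eq_vecI)
qed

lemma poly_act_mult:
  assumes v: "v \<in> carrier_vec n"
  shows "poly_act A (p * q) v = poly_act A p (poly_act A q v)"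
  using A v by (induction p)
    (simp_all add: poly_act_pCons poly_act_add poly_act_smult zero_smult_vec_add[of _ n])

lemma poly_act_monom:
  assumes v: "v \<in> carrier_vec n"
  shows "poly_act A (monom c m) v = c \<cdot>\<^sub>v (A ^\<^sub>m m *\<^sub>v v)"
proof (induction m)
  case 0
  then show ?case using A v by (auto simp: monom_0 poly_act_pCons mult_mat_zero_vec)
next
  case (Suc m)
  have "A ^\<^sub>m Suc m *\<^sub>v v = A *\<^sub>v (A ^\<^sub>m m *\<^sub>v v)"
    by (rule pow_mat_mult_vec_Suc[OF A v])
  moreover have "A *\<^sub>v (c \<cdot>\<^sub>v (A ^\<^sub>m m *\<^sub>v v)) = c \<cdot>\<^sub>v (A *\<^sub>v (A ^\<^sub>m m *\<^sub>v v))"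
    by (rule mult_mat_vec[OF A mult_mat_vec_carrier[OF pow_carrier_mat[OF A] v]])
  moreover have "A ^\<^sub>m m *\<^sub>v v \<in> carrier_vec n"
    using mult_mat_vec_carrier[OF pow_carrier_mat[OF A] v] .
  ultimately show ?case using A v Suc by (auto simp: monom_Suc poly_act_pCons zero_smult_vec_add[of _ n] simp del: pow_mat.simps)
qed

lemma poly_act_linear:
  assumes v: "v \<in> carrier_vec n"
  shows "poly_act A [:-a, 1:] v = A *\<^sub>v v - a \<cdot>\<^sub>v v"
  using A v by (auto simp: poly_act_pCons mult_mat_zero_vec mult_add_distrib_mat_vec intro!: eq_vecI)

end

text \<open>Split off a linear factor \<open>X - a\<close> of \<open>q\<close>: either
  \<open>w\<close> is an eigenvector for \<open>a\<close>, or \<open>A w - a w\<close> is a nonzero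
  vector of \<open>W\<close> annihilated by the cofactor, which has smaller degree. That the
  eigenvalue is a root of \<open>q\<close> allows the choice of \<open>q\<close> to restrict the
  eigenvalues that can occur.\<close>

lemma poly_act_eigenvector:
  fixes A :: "'k::alg_closed_field mat"
  assumes A: "A \<in> carrier_mat n n" and W: "W \<subseteq> carrier_vec n"
    and closed: "\<And>u a. u \<in> W \<Longrightarrow> A *\<^sub>v u - a \<cdot>\<^sub>v u \<in> W"
  shows "q \<noteq> 0 \<Longrightarrow> w \<in> W \<Longrightarrow> w \<noteq> 0\<^sub>v n \<Longrightarrow> poly_act A q w = 0\<^sub>v n \<Longrightarrow>
    \<exists>a u. poly q a = 0 \<and> u \<in> W \<and> u \<noteq> 0\<^sub>v n \<and> A *\<^sub>v u = a \<cdot>\<^sub>v u"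
proof (induction "degree q" arbitrary: q w)
  case 0
  then obtain c where c: "q = [:c:]" using degree_eq_zeroE by metis
  have w: "w \<in> carrier_vec n" using 0 W by auto
  then have "poly_act A q w = c \<cdot>\<^sub>v w" unfolding c using A by (auto simp: poly_act_pCons[OF A])
  then show ?case using 0 c w by auto (metis (no_types, lifting) carrier_vecD eq_vecI index_smult_vec(1)
        index_zero_vec(1) index_zero_vec(2) mult_eq_0_iff)
next
  case (Suc d)
  then obtain a where a: "poly q a = 0" using alg_closed_imp_poly_has_root[of q] by auto
  then obtain r where r: "q = [:-a, 1:] * r" using poly_eq_0_iff_dvd by (metis dvdE)
  have w: "w \<in> carrier_vec n" using Suc W by auto
  define u where "u = A *\<^sub>v w - a \<cdot>\<^sub>v w"
  have "poly_act A r u = poly_act A (r * [:-a, 1:]) w"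
    unfolding poly_act_mult[OF A w] poly_act_linear[OF A w] u_def ..
  also have "\<dots> = 0\<^sub>v n" using Suc r by (simp only: mult.commute)
  finally have u0: "poly_act A r u = 0\<^sub>v n" .
  show ?case
  proof (cases "u = 0\<^sub>v n")
    case True
    have "A *\<^sub>v w = a \<cdot>\<^sub>v w"
    proof (rule eq_vecI)
      fix i assume "i < dim_vec (a \<cdot>\<^sub>v w)"
      then have "i < n" using w by auto
      then have "u $ i = (A *\<^sub>v w) $ i - (a \<cdot>\<^sub>v w) $ i" unfolding u_def using w A by auto
      then show "(A *\<^sub>v w) $ i = (a \<cdot>\<^sub>v w) $ i" using True \<open>i < n\<close> by simp
    qed (use A w in auto)
    then show ?thesis using a Suc by auto
  next
    case False
    have "r \<noteq> 0" using Suc r by auto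
    then have "d = degree r" using Suc(2) unfolding r by (simp add: degree_mult_eq del: mult_pCons_left)
    from Suc(1)[OF this \<open>r \<noteq> 0\<close> _ False u0] obtain b u' where "poly r b = 0" "u' \<in> W" "u' \<noteq> 0\<^sub>v n"
      "A *\<^sub>v u' = b \<cdot>\<^sub>v u'" using closed Suc(4) unfolding u_def by blast
    then show ?thesis unfolding r by (metis mult_zero_right poly_mult)
  qed
qed

text \<open>Finite order provides the annihilating polynomial \<open>X^m - 1\<close>.\<close>

lemma finite_order_eigenvector:
  fixes A :: "'k::alg_closed_field mat"
  assumes A: "A \<in> carrier_mat n n" and W: "W \<subseteq> carrier_vec n"
    and closed: "\<And>u a. u \<in> W \<Longrightarrow> A *\<^sub>v u - a \<cdot>\<^sub>v u \<in> W"
    and w: "w \<in> W" "w \<noteq> 0\<^sub>v n" and m: "m > 0" "A ^\<^sub>m m = 1\<^sub>m n"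
  shows "\<exists>a u. u \<in> W \<and> u \<noteq> 0\<^sub>v n \<and> A *\<^sub>v u = a \<cdot>\<^sub>v u"
proof -
  define q :: "'k poly" where "q = monom 1 m + monom (-1) 0"
  have wc: "w \<in> carrier_vec n" using w W by auto
  have "coeff q m = 1" using m by (simp add: q_def)
  then have "q \<noteq> 0" by auto
  moreover have "poly_act A q w = 0\<^sub>v n"
    using wc A m by (auto simp: q_def poly_act_add[OF A] poly_act_monom[OF A] intro!: eq_vecI)
  ultimately show ?thesis using poly_act_eigenvector[OF A W closed _ w] by blast
qed

text \<open>Induction on \<open>S\<close>: \<open>W\<close> is replaced by an eigenspace of one
  matrix inside \<open>W\<close>, which the remaining matrices preserve because they commute with
  it. Starting from a prescribed eigenspace instead of the whole space is what later makes a linear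
  character nontrivial.\<close>

lemma common_eigenvector:
  fixes f :: "'s \<Rightarrow> 'k::alg_closed_field mat"
  assumes "finite S"
  shows "W \<subseteq> carrier_vec n \<Longrightarrow> (\<And>s. s \<in> S \<Longrightarrow> f s \<in> carrier_mat n n) \<Longrightarrow>
    (\<And>s. s \<in> S \<Longrightarrow> \<exists>m>0. f s ^\<^sub>m m = 1\<^sub>m n) \<Longrightarrow>
    (\<And>s t. s \<in> S \<Longrightarrow> t \<in> S \<Longrightarrow> f s * f t = f t * f s) \<Longrightarrow>
    (\<And>s u a. s \<in> S \<Longrightarrow> u \<in> W \<Longrightarrow> f s *\<^sub>v u - a \<cdot>\<^sub>v u \<in> W) \<Longrightarrow>
    \<exists>w\<in>W. w \<noteq> 0\<^sub>v n \<Longrightarrow>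
    \<exists>w\<in>W. w \<noteq> 0\<^sub>v n \<and> (\<forall>s\<in>S. \<exists>a. f s *\<^sub>v w = a \<cdot>\<^sub>v w)"
  using assms
proof (induction S arbitrary: W rule: finite_induct)
  case empty
  then show ?case by auto
next
  case (insert s S)
  note prems = insert.prems
  have As: "f s \<in> carrier_mat n n" using prems by auto
  obtain a w where w: "w \<in> W" "w \<noteq> 0\<^sub>v n" "f s *\<^sub>v w = a \<cdot>\<^sub>v w"
    using finite_order_eigenvector[OF As prems(1)] prems(3)[of s] prems(5)[of s] prems(6) by blast
  define W' where "W' = {u \<in> W. f s *\<^sub>v u = a \<cdot>\<^sub>v u}"
  have "\<exists>w\<in>W'. w \<noteq> 0\<^sub>v n \<and> (\<forall>s\<in>S. \<exists>a. f s *\<^sub>v w = a \<cdot>\<^sub>v w)"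
  proof (rule insert.IH)
    show "W' \<subseteq> carrier_vec n" using prems(1) by (auto simp: W'_def)
    show "\<exists>w\<in>W'. w \<noteq> 0\<^sub>v n" using w by (auto simp: W'_def)
    fix t u b assume t: "t \<in> S" and u: "u \<in> W'"
    have uc: "u \<in> carrier_vec n" using u prems(1) by (auto simp: W'_def)
    have At: "f t \<in> carrier_mat n n" using t prems by auto
    have "f s *\<^sub>v (f t *\<^sub>v u) = f t *\<^sub>v (f s *\<^sub>v u)"
      using prems(4)[of s t] t As At uc by (metis assoc_mult_mat_vec insertCI)
    also have "\<dots> = a \<cdot>\<^sub>v (f t *\<^sub>v u)"
      using u mult_mat_vec[OF At uc] by (auto simp: W'_def)
    finally have 1: "f s *\<^sub>v (f t *\<^sub>v u) = a \<cdot>\<^sub>v (f t *\<^sub>v u)" .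
    have "f s *\<^sub>v (f t *\<^sub>v u - b \<cdot>\<^sub>v u) = f s *\<^sub>v (f t *\<^sub>v u) - f s *\<^sub>v (b \<cdot>\<^sub>v u)"
      using As At uc by (intro mult_minus_distrib_mat_vec) auto
    also have "\<dots> = a \<cdot>\<^sub>v (f t *\<^sub>v u - b \<cdot>\<^sub>v u)"
      using 1 u mult_mat_vec[OF As uc, of b] As At uc
      by (auto simp: W'_def algebra_simps intro!: eq_vecI)
    finally show "f t *\<^sub>v u - b \<cdot>\<^sub>v u \<in> W'" using prems(5)[of t u b] t u by (auto simp: W'_def)
  qed (use prems in auto)
  then show ?case by (auto simp: W'_def)
qed

lemma mat_eq_one_iff:
  fixes A :: "'k::field mat"
  assumes "A \<in> carrier_mat n n"
  shows "A = 1\<^sub>m n \<longleftrightarrow> (\<forall>v\<in>carrier_vec n. A *\<^sub>v v = v)"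
proof safe
  assume *: "\<forall>v\<in>carrier_vec n. A *\<^sub>v v = v"
  show "A = 1\<^sub>m n"
  proof (rule eq_matI)
    fix i j assume ij: "i < dim_row (1\<^sub>m n :: 'k mat)" "j < dim_col (1\<^sub>m n :: 'k mat)"
    have "(A *\<^sub>v unit_vec n j) $ i = unit_vec n j $ i" using * by simp
    then show "A $$ (i, j) = 1\<^sub>m n $$ (i, j)" using ij assms by (auto split: if_splits)
  qed (use assms in auto)
qed auto

text \<open>If \<open>A v \<noteq> v\<close>, then \<open>1 + A + \<dots> + A^(m - 1)\<close> annihilates \<open>A v - v\<close>, which yields an eigenvalue that is a root
  of \<open>1 + X + \<dots> + X^(m - 1)\<close>; but 1 is not a root of this polynomial.\<close>

lemma finite_order_eq_one:
  fixes A :: "'k::alg_closed_field mat"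
  assumes A: "A \<in> carrier_mat n n" and m: "A ^\<^sub>m m = 1\<^sub>m n" "of_nat m \<noteq> (0::'k)"
    and eig: "\<And>a. eigenvalue A a \<Longrightarrow> a = 1"
  shows "A = 1\<^sub>m n"
  unfolding mat_eq_one_iff[OF A]
proof (rule ballI, rule ccontr)
  fix v assume v: "v \<in> carrier_vec n" and neq: "A *\<^sub>v v \<noteq> v"
  define w where "w = A *\<^sub>v v - 1 \<cdot>\<^sub>v v"
  have wc: "w \<in> carrier_vec n" using A v by (auto simp: w_def)
  have w0: "w \<noteq> 0\<^sub>v n"
  proof
    assume "w = 0\<^sub>v n"
    then have "(A *\<^sub>v v) $ i - v $ i = 0" if "i < n" for i
      using that v A unfolding w_def by (metis carrier_vecD index_minus_vec(1) index_zero_vec(1) one_smult_vec)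
    then have "A *\<^sub>v v = v" using A v by (intro eq_vecI) auto
    then show False using neq by simp
  qed
  define q :: "'k poly" where "q = (\<Sum>k<m. monom 1 k)"
  have qm: "q * [:-1, 1:] = monom 1 m + monom (-1) 0"
  proof -
    have "q * [:-1, 1:] = (\<Sum>k<m. monom 1 (Suc k) - monom 1 k)"
      unfolding q_def sum_distrib_right by (intro sum.cong) (auto simp: monom_Suc)
    also have "\<dots> = monom 1 m - monom 1 0" by (rule sum_lessThan_telescope)
    finally show ?thesis by (simp only: minus_monom[symmetric] add_uminus_conv_diff)
  qed
  have p1: "poly q 1 = of_nat m" by (simp add: q_def poly_sum poly_monom)
  then have "q \<noteq> 0" using m by auto
  have "poly_act A q w = poly_act A (q * [:-1, 1:]) v"
    unfolding poly_act_mult[OF A v] poly_act_linear[OF A v] w_def ..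
  also have "\<dots> = 0\<^sub>v n" unfolding qm
    using v A m by (auto simp: poly_act_add[OF A] poly_act_monom[OF A] intro!: eq_vecI)
  finally obtain a u where "poly q a = 0" "u \<in> carrier_vec n" "u \<noteq> 0\<^sub>v n" "A *\<^sub>v u = a \<cdot>\<^sub>v u"
    using poly_act_eigenvector[OF A subset_refl _ \<open>q \<noteq> 0\<close> wc w0] A
    by (metis minus_carrier_vec mult_mat_vec_carrier smult_carrier_vec)
  moreover from this have "a = 1" using eig[of a] A unfolding eigenvalue_def eigenvector_def by auto
  ultimately show False using p1 m by simp
qed

section \<open>Eigenvalues of monomial matrices\<close>

lemma proots_alg_closed:
  fixes p :: "'k::alg_closed_field poly"
  assumes "p \<noteq> 0"
  shows "p = Polynomial.smult (lead_coeff p) (\<Prod>x\<in>#proots p. [:-x, 1:])" "size (proots p) = degree p"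
proof -
  obtain B where B: "size B = degree p" "p = Polynomial.smult (lead_coeff p) (\<Prod>x\<in>#B. [:-x, 1:])"
    using alg_closed_imp_factorization[OF assms] by blast
  have "proots (\<Prod>x\<in>#B. [:-x, 1:]) = B"
  proof (induction B)
    case (add x B)
    have "(\<Prod>x\<in>#B. [:-x, 1:]) \<noteq> 0" by auto
    then have "proots ([:-x, 1:] * (\<Prod>x\<in>#B. [:-x, 1:])) = {#x#} + B"
      using add by (subst proots_mult) auto
    then show ?case by simp
  qed auto
  then have "proots p = B" using B(2) assms by (metis leading_coeff_0_iff proots_smult)
  then show "p = Polynomial.smult (lead_coeff p) (\<Prod>x\<in>#proots p. [:-x, 1:])" "size (proots p) = degree p"
    using B by simp_all
qed

text \<open>This can be read off the linear factors: substituting \<open>z X\<close> turns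
  \<open>X - x\<close> into \<open>z (X - x / z)\<close>, and nonzero constants do not affect
  roots.\<close>

lemma proots_pcompose_scale:
  fixes p :: "'k::alg_closed_field poly"
  assumes p: "p \<noteq> 0" and z: "z \<noteq> 0"
  shows "image_mset (\<lambda>x. z * x) (proots (p \<circ>\<^sub>p [:0, z:])) = proots p"
proof -
  have *: "image_mset (\<lambda>x. z * x) (proots ((\<Prod>x\<in>#B. [:-x, 1:]) \<circ>\<^sub>p [:0, z:])) = B" for B
  proof (induction B)
    case empty
    then show ?case by (simp add: pcompose_1)
  next
    case (add x B)
    have 1: "[:-x, 1:] \<circ>\<^sub>p [:0, z:] = Polynomial.smult z [:-(x / z), 1:]"
      using z by (simp add: pcompose_pCons)
    have 2: "(\<Prod>x\<in>#B. [:-x, 1:]) \<circ>\<^sub>p [:0, z:] \<noteq> 0"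
      using z by (subst pcompose_eq_0_iff) auto
    have "proots ((\<Prod>x\<in>#add_mset x B. [:-x, 1:]) \<circ>\<^sub>p [:0, z:])
        = {#x / z#} + proots ((\<Prod>x\<in>#B. [:-x, 1:]) \<circ>\<^sub>p [:0, z:])"
      unfolding image_mset_add_mset prod_mset.add_mset pcompose_mult 1
      using z 2 by (subst proots_mult) (auto simp del: smult_pCons)
    then show ?case using add z by simp
  qed
  have "proots (p \<circ>\<^sub>p [:0, z:]) = proots ((\<Prod>x\<in>#proots p. [:-x, 1:]) \<circ>\<^sub>p [:0, z:])"
    using p by (subst proots_alg_closed(1)[OF p]) (simp add: pcompose_smult)
  then show ?thesis using *[of "proots p"] by simp
qed

text \<open>Replacing the rows and columns outside \<open>I\<close> by those of the identity makes the factorization of a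
  determinant over the orbits of a permutation a matrix identity, without reordering the basis.\<close>

definition cut_mat :: "nat \<Rightarrow> nat set \<Rightarrow> 'a::comm_ring_1 mat \<Rightarrow> 'a mat" where
  "cut_mat n I A = mat n n (\<lambda>(i, j). if i \<in> I \<and> j \<in> I then A $$ (i, j) else if i = j then 1 else 0)"

lemma cut_mat_closed [simp]: "cut_mat n I A \<in> carrier_mat n n"
  by (simp add: cut_mat_def)

lemma cut_mat_Un:
  fixes A :: "'a::comm_ring_1 mat"
  assumes disj: "I \<inter> J = {}"
    and off: "\<And>i j. i < n \<Longrightarrow> j < n \<Longrightarrow> i \<in> I \<and> j \<in> J \<or> i \<in> J \<and> j \<in> I \<Longrightarrow> A $$ (i, j) = 0"
  shows "cut_mat n (I \<union> J) A = cut_mat n I A * cut_mat n J A"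
proof (rule eq_matI)
  fix i k assume "i < dim_row (cut_mat n I A * cut_mat n J A)" "k < dim_col (cut_mat n I A * cut_mat n J A)"
  then have ik: "i < n" "k < n" by (simp_all add: cut_mat_def)
  let ?f = "\<lambda>j. cut_mat n I A $$ (i, j) * cut_mat n J A $$ (j, k)"
  have "(cut_mat n I A * cut_mat n J A) $$ (i, k) = (\<Sum>j = 0..<n. ?f j)"
    using ik by (simp add: times_mat_def scalar_prod_def cut_mat_def)
  \<comment> \<open>If \<open>i\<close> is outside \<open>I\<close>, row \<open>i\<close> of the
    first factor is a row of the identity. If \<open>i\<close> is in \<open>I\<close>, its entries
    vanish outside the columns in \<open>I\<close>, and the rows of the second factor with these
    indices are rows of the identity, as \<open>I\<close> and \<open>J\<close> are disjoint.\<close>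
  also have "\<dots> = (\<Sum>j = 0..<n. if j = (if i \<in> I then k else i) then ?f j else 0)"
    using ik disj by (intro sum.cong) (auto simp: cut_mat_def)
  also have "\<dots> = ?f (if i \<in> I then k else i)"
    using ik by simp
  also have "\<dots> = cut_mat n (I \<union> J) A $$ (i, k)"
    using ik disj off[of i k] by (auto simp: cut_mat_def)
  finally show "cut_mat n (I \<union> J) A $$ (i, k) = (cut_mat n I A * cut_mat n J A) $$ (i, k)" by simp
qed (simp_all add: cut_mat_def)

lemma cut_mat_empty: "cut_mat n {} A = 1\<^sub>m n"
  by (rule eq_matI) (auto simp: cut_mat_def)

lemma cut_mat_all: "A \<in> carrier_mat n n \<Longrightarrow> cut_mat n {..<n} A = A"
  by (rule eq_matI) (auto simp: cut_mat_def)

lemma det_cut_mat_singleton: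
  assumes "i < n"
  shows "det (cut_mat n {i} A) = A $$ (i, i)"
proof -
  have "upper_triangular (cut_mat n {i} A)" by (auto simp: cut_mat_def)
  then have "det (cut_mat n {i} A) = prod_list (diag_mat (cut_mat n {i} A))"
    by (rule det_upper_triangular[OF _ cut_mat_closed])
  also have "\<dots> = (\<Prod>j = 0..<n. if j = i then A $$ (i, i) else 1)"
    unfolding prod_list_diag_prod by (intro prod.cong) (auto simp: cut_mat_def)
  finally show ?thesis using assms by simp
qed

definition diag :: "nat \<Rightarrow> (nat \<Rightarrow> 'a::comm_ring_1) \<Rightarrow> 'a mat" where
  "diag n d = mat n n (\<lambda>(i, j). if i = j then d i else 0)"

lemma diag_closed [simp]: "diag n d \<in> carrier_mat n n"
  by (simp add: diag_def)

lemma det_diag: "det (diag n d) = (\<Prod>i<n. d i)"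
proof -
  have "det (diag n d) = prod_list (diag_mat (diag n d))"
    by (rule det_upper_triangular[OF _ diag_closed]) (auto simp: diag_def)
  also have "\<dots> = (\<Prod>i = 0..<n. d i)"
    unfolding prod_list_diag_prod by (intro prod.cong) (auto simp: diag_def)
  finally show ?thesis by (simp add: atLeast0LessThan)
qed

lemma diag_mult_mult_diag:
  assumes "A \<in> carrier_mat n n"
  shows "diag n c * A * diag n d = mat n n (\<lambda>(i, j). c i * A $$ (i, j) * d j)"
proof (rule eq_matI)
  fix i j assume "i < dim_row (mat n n (\<lambda>(i, j). c i * A $$ (i, j) * d j))"
    "j < dim_col (mat n n (\<lambda>(i, j). c i * A $$ (i, j) * d j))"
  then have ij: "i < n" "j < n" by auto
  have 1: "(diag n c * A) $$ (i, k) = c i * A $$ (i, k)" if "k < n" for k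
  proof -
    have "(diag n c * A) $$ (i, k) = (\<Sum>l = 0..<n. (if i = l then c i else 0) * A $$ (l, k))"
      using that ij assms by (simp add: times_mat_def scalar_prod_def diag_def)
    also have "\<dots> = (\<Sum>l = 0..<n. if l = i then c i * A $$ (i, k) else 0)"
      by (intro sum.cong) auto
    finally show ?thesis using ij by simp
  qed
  have "(diag n c * A * diag n d) $$ (i, j) = (\<Sum>k = 0..<n. (diag n c * A) $$ (i, k) * (diag n d) $$ (k, j))"
    using ij assms by (simp add: times_mat_def scalar_prod_def diag_def)
  also have "\<dots> = (\<Sum>k = 0..<n. if k = j then c i * A $$ (i, j) * d j else 0)"
    using ij by (intro sum.cong) (auto simp: 1, auto simp: diag_def)
  finally show "(diag n c * A * diag n d) $$ (i, j) = mat n n (\<lambda>(i, j). c i * A $$ (i, j) * d j) $$ (i, j)"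
    using ij by simp
qed (use assms in \<open>auto simp: diag_def\<close>)

text \<open>Holds for a Brauer lift and for the identity on the complex numbers.\<close>

definition root_lift :: "('k::field \<Rightarrow> complex) \<Rightarrow> bool" where
  "root_lift \<xi> \<longleftrightarrow> inj_on \<xi> {x. \<exists>n>0. x ^ n = 1} \<and>
     (\<forall>x y. (\<exists>n>0. x ^ n = 1) \<longrightarrow> (\<exists>n>0. y ^ n = 1) \<longrightarrow> \<xi> (x * y) = \<xi> x * \<xi> y) \<and> \<xi> 1 = 1"

lemma root_lift_mult:
  "root_lift \<xi> \<Longrightarrow> x ^ m = 1 \<Longrightarrow> m > 0 \<Longrightarrow> y ^ k = 1 \<Longrightarrow> k > 0 \<Longrightarrow> \<xi> (x * y) = \<xi> x * \<xi> y"
  unfolding root_lift_def by blast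

text \<open>The witness is a root of \<open>1 + X + ... + X^(l - 1)\<close>; the value of this
  polynomial at 1 is \<open>l\<close>, which is nonzero in the field, so the root is not 1.\<close>

lemma exists_root_of_unity:
  assumes l: "l > 1" "of_nat l \<noteq> (0::'k::alg_closed_field)"
  shows "\<exists>z::'k. z \<noteq> 1 \<and> z ^ l = 1"
proof -
  define q :: "'k poly" where "q = (\<Sum>k<l. monom 1 k)"
  have "coeff q (l - 1) = 1"
    using l by (simp add: q_def coeff_sum)
  then have "degree q \<ge> l - 1" by (intro le_degree) auto
  then have "degree q > 0" using l by linarith
  then obtain z where z: "poly q z = 0" using alg_closed_imp_poly_has_root[of q] by auto
  have s: "(\<Sum>k<l. z ^ k) = 0" using z by (simp add: q_def poly_sum poly_monom)
  then have "z \<noteq> 1" using l by auto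
  moreover have "z ^ l = 1" using s power_diff_1_eq[of z l] by simp
  ultimately show ?thesis by blast
qed

lemma funpow_fixed: "(f ^^ m) i = i \<Longrightarrow> (f ^^ (m * a)) i = i"
  by (induction a) (simp_all add: funpow_add)

text \<open>On a nontrivial orbit of \<open>\<sigma>\<close>, conjugation by a diagonal matrix \<open>d\<close> with \<open>d (\<sigma> j) = z * d j\<close> multiplies \<open>A\<close>
  by the root of unity \<open>z\<close>. So the eigenvalues belonging to the orbit are permuted by multiplication with \<open>z\<close>,
  and their lifts cancel.\<close>

lemma proots_orbit:
  fixes A :: "'k::alg_closed_field mat"
  assumes A: "A \<in> carrier_mat n n"
    and \<sigma>: "\<And>i. i < n \<Longrightarrow> \<sigma> i < n" "\<And>i. i < n \<Longrightarrow> (\<sigma> ^^ m) i = i"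
    and A0: "\<And>i j. i < n \<Longrightarrow> j < n \<Longrightarrow> i \<noteq> \<sigma> j \<Longrightarrow> A $$ (i, j) = 0"
    and m: "of_nat m \<noteq> (0::'k)" and i: "i < n" "\<sigma> i \<noteq> i"
    and Orb: "Orb = range (\<lambda>k. (\<sigma> ^^ k) i)"
    and p0: "det (cut_mat n Orb (char_poly_matrix A)) \<noteq> 0"
  shows "\<exists>z::'k. z \<noteq> 1 \<and> z ^ m = 1 \<and>
    image_mset (\<lambda>x. z * x) (proots (det (cut_mat n Orb (char_poly_matrix A)))) =
    proots (det (cut_mat n Orb (char_poly_matrix A)))"
proof -
  have m0: "m > 0" using m by (cases m) auto
  define l where "l = least_power \<sigma> i"
  have l0: "(\<sigma> ^^ l) i = i" "l > 0" using least_powerI[of m \<sigma> i] \<sigma>(2) i m0 by (auto simp: l_def)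
  have ldvd: "l dvd k" if "(\<sigma> ^^ k) i = i" for k using least_power_minimal[OF that] by (simp add: l_def)
  have lm: "l dvd m" using ldvd \<sigma> i by auto
  have "l \<noteq> 1" using l0 i by auto
  then have l1: "l > 1" using l0 by linarith
  have "of_nat l \<noteq> (0::'k)" using lm m by (metis dvdE mult_zero_left of_nat_mult)
  then obtain z :: 'k where z: "z \<noteq> 1" "z ^ l = 1" using exists_root_of_unity l1 by blast
  have z0: "z \<noteq> 0" using z l0 by (metis power_0_left zero_neq_one gr_implies_not0)
  have zm: "z ^ m = 1" using lm z by (metis dvdE power_mult power_one)
  \<comment> \<open>\<open>z ^ k\<close> depends only on the point reached from \<open>i\<close> in
    \<open>k\<close> steps, since the numbers of steps leading to one point agree modulo the orbit
    length \<open>l\<close>.\<close>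
  have zz: "z ^ a = z ^ b" if "(\<sigma> ^^ a) i = (\<sigma> ^^ b) i" "a \<le> b" for a b
  proof -
    \<comment> \<open>A natural number congruent to \<open>- a\<close> modulo \<open>m\<close>:
      after \<open>a\<close> steps, \<open>?t\<close> more lead back to \<open>i\<close>.\<close>
    let ?t = "m * a - a"
    have ta: "?t + a = m * a" using m0 by (simp add: le_add_diff_inverse2)
    have "(\<sigma> ^^ (?t + b)) i = (\<sigma> ^^ (?t + a)) i" using that by (simp add: funpow_add)
    also have "\<dots> = i" unfolding ta using funpow_fixed \<sigma>(2) i by metis
    finally have "l dvd ?t + b" by (rule ldvd)
    moreover have "?t + b = m * a + (b - a)" using ta that by linarith
    ultimately have "l dvd b - a" using lm by (metis dvd_add_right_iff dvd_mult2)
    then obtain c where "b - a = l * c" by (rule dvdE)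
    then have "b = a + l * c" using that by linarith
    then show ?thesis using z by (simp add: power_add power_mult)
  qed
  define e where "e j = (SOME k. (\<sigma> ^^ k) i = j)" for j
  define d where "d j = (if j \<in> Orb then z ^ e j else 1)" for j
  have e: "(\<sigma> ^^ e j) i = j" if "j \<in> Orb" for j
  proof -
    obtain k where "(\<sigma> ^^ k) i = j" using \<open>j \<in> Orb\<close> unfolding Orb by blast
    then show ?thesis unfolding e_def by (rule someI)
  qed
  have d: "d (\<sigma> j) = z * d j" "\<sigma> j \<in> Orb" if "j \<in> Orb" for j
  proof -
    have s: "(\<sigma> ^^ Suc (e j)) i = \<sigma> j" using e[OF that] by simp
    then show "\<sigma> j \<in> Orb" unfolding Orb by (metis rangeI)
    then have "(\<sigma> ^^ e (\<sigma> j)) i = (\<sigma> ^^ Suc (e j)) i" using e s by metis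
    then have "z ^ e (\<sigma> j) = z ^ Suc (e j)" using zz by (metis nat_le_linear)
    then show "d (\<sigma> j) = z * d j" using that \<open>\<sigma> j \<in> Orb\<close> by (simp add: d_def)
  qed
  have d0: "d j \<noteq> 0" for j using z0 by (simp add: d_def)
  have nofix: "\<sigma> j \<noteq> j" if "j \<in> Orb" for j
  proof
    assume *: "\<sigma> j = j"
    then have "d j = z * d j" using d(1)[OF that] by simp
    then show False using d0 z by auto
  qed
  let ?C = "cut_mat n Orb (char_poly_matrix A)"
  \<comment> \<open>On the orbit the left factor is \<open>z / d\<close>, not \<open>1 / d\<close>:
    a diagonal entry \<open>X\<close> has to become \<open>z X\<close>, while a constant entry in
    position (\<open>\<sigma> j\<close>, \<open>j\<close>) gets the factor
    \<open>z * d j / d (\<sigma> j) = 1\<close>.\<close>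
  let ?c = "\<lambda>i. [:if i \<in> Orb then z / d i else 1:]"
  have eq: "map_mat (\<lambda>p. p \<circ>\<^sub>p [:0, z:]) ?C = diag n ?c * ?C * diag n (\<lambda>j. [:d j:])"
    unfolding diag_mult_mult_diag[OF cut_mat_closed]
  proof (rule eq_matI)
    fix a b assume "a < dim_row (mat n n (\<lambda>(i, j). ?c i * ?C $$ (i, j) * [:d j:]))"
      "b < dim_col (mat n n (\<lambda>(i, j). ?c i * ?C $$ (i, j) * [:d j:]))"
    then have ab: "a < n" "b < n" by auto
    consider "a \<notin> Orb \<or> b \<notin> Orb" | "a \<in> Orb" "b = a" | "a \<in> Orb" "b \<in> Orb" "b \<noteq> a" by blast
    then show "map_mat (\<lambda>p. p \<circ>\<^sub>p [:0, z:]) ?C $$ (a, b) = mat n n (\<lambda>(i, j). ?c i * ?C $$ (i, j) * [:d j:]) $$ (a, b)"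
    proof cases
      case 1
      then show ?thesis using ab d0 by (auto simp: cut_mat_def pcompose_1 d_def)
    next
      case 2
      then show ?thesis using ab d0 A0[of a a] nofix[of a] A
        by (auto simp: cut_mat_def char_poly_matrix_def pcompose_pCons)
    next
      case 3
      then show ?thesis using ab d0 A0[of a b] d[of b] A
        by (cases "a = \<sigma> b") (auto simp: cut_mat_def char_poly_matrix_def pcompose_pCons)
    qed
  qed (auto simp: cut_mat_def)
  have "det ?C \<circ>\<^sub>p [:0, z:] = det (map_mat (\<lambda>p. p \<circ>\<^sub>p [:0, z:]) ?C)"
  proof -
    have "comm_ring_hom (\<lambda>p. p \<circ>\<^sub>p [:0, z:])"
      by unfold_locales (simp_all add: pcompose_add pcompose_mult pcompose_1)
    from comm_ring_hom.hom_det[OF this] show ?thesis by simp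
  qed
  also have "\<dots> = (\<Prod>i<n. ?c i) * det ?C * (\<Prod>i<n. [:d i:])"
    unfolding eq det_mult[OF mult_carrier_mat[OF diag_closed cut_mat_closed] diag_closed]
      det_mult[OF diag_closed cut_mat_closed] det_diag ..
  also have "(\<Prod>i<n. ?c i) = [:\<Prod>i<n. if i \<in> Orb then z / d i else 1:]"
    by (induction n) auto
  also have "(\<Prod>i<n. [:d i:]) = [:\<Prod>i<n. d i:]"
    by (induction n) auto
  finally have "det ?C \<circ>\<^sub>p [:0, z:] = Polynomial.smult ((\<Prod>i<n. if i \<in> Orb then z / d i else 1) * (\<Prod>i<n. d i)) (det ?C)"
    by (simp add: mult_ac)
  then have "proots (det ?C \<circ>\<^sub>p [:0, z:]) = proots (det ?C)" using d0 z0 by simp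
  then show ?thesis using proots_pcompose_scale[OF p0 z0] z zm by metis
qed

text \<open>Multiplication by \<open>z\<close> permutes \<open>M\<close>, so the sum equals
  \<open>\<xi> z\<close> times itself, and \<open>\<xi> z\<close> is not 1 by injectivity.\<close>

lemma sum_mset_scale_eq_0:
  fixes M :: "'k::field multiset"
  assumes \<xi>: "root_lift \<xi>" and M: "\<And>x. x \<in># M \<Longrightarrow> x ^ m = 1" and m: "m > 0"
    and z: "z \<noteq> 1" "z ^ m = 1" and inv: "image_mset (\<lambda>x. z * x) M = M"
  shows "(\<Sum>x\<in>#M. \<xi> x) = 0"
proof -
  have "\<xi> z \<noteq> 1" using \<xi> z m unfolding root_lift_def inj_on_def
    by (metis (mono_tags, lifting) mem_Collect_eq power_one)
  have "(\<Sum>x\<in>#M. \<xi> x) = (\<Sum>x\<in>#image_mset (\<lambda>x. z * x) M. \<xi> x)" using inv by simp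
  also have "\<dots> = (\<Sum>x\<in>#M. \<xi> (z * x))" by (simp add: image_mset.compositionality comp_def)
  also have "\<dots> = (\<Sum>x\<in>#M. \<xi> z * \<xi> x)"
    using M root_lift_mult[OF \<xi> z(2) m] m by (metis (no_types, lifting) image_mset_cong)
  also have "\<dots> = \<xi> z * (\<Sum>x\<in>#M. \<xi> x)" by (simp add: sum_mset_distrib_left multiset.map_comp comp_def)
  finally show ?thesis using \<open>\<xi> z \<noteq> 1\<close> by (metis mult_cancel_right1)
qed

lemma eigenvalue_finite_order:
  fixes A :: "'k::field mat"
  assumes A: "A \<in> carrier_mat n n" and m: "A ^\<^sub>m m = 1\<^sub>m n" and e: "eigenvalue A a"
  shows "a ^ m = 1"
proof -
  obtain v where v: "eigenvector A v a" using e by (auto simp: eigenvalue_def)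
  have vc: "v \<in> carrier_vec n" "v \<noteq> 0\<^sub>v n" using v A by (auto simp: eigenvector_def)
  have "1 \<cdot>\<^sub>v v = a ^ m \<cdot>\<^sub>v v" using eigenvector_pow[OF A v, of m] m vc by simp
  moreover obtain i where "i < n" "v $ i \<noteq> 0"
    using vc by (metis carrier_vecD eq_vecI index_zero_vec(1) index_zero_vec(2))
  ultimately show ?thesis using vc by (metis carrier_vecD index_smult_vec(1) mult_cancel_right)
qed

text \<open>The characteristic polynomial factors along \<open>\<sigma>\<close>-invariant index
  sets, so orbits can be split off one at a time: a fixed point contributes the lift of its diagonal
  entry, and a longer orbit contributes 0 by \<open>proots_orbit\<close>. For the identity on the
  complex numbers the result is the trace; a Brauer lift is not additive, so there the factors have
  to be treated separately.\<close>

lemma sum_proots_monomial_mat: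
  fixes A :: "'k::alg_closed_field mat"
  assumes \<xi>: "root_lift \<xi>" and A: "A \<in> carrier_mat n n"
    and \<sigma>: "\<And>i. i < n \<Longrightarrow> \<sigma> i < n" "\<And>i. i < n \<Longrightarrow> (\<sigma> ^^ m) i = i"
    and A0: "\<And>i j. i < n \<Longrightarrow> j < n \<Longrightarrow> i \<noteq> \<sigma> j \<Longrightarrow> A $$ (i, j) = 0"
    and m: "of_nat m \<noteq> (0::'k)" and Am: "A ^\<^sub>m m = 1\<^sub>m n"
  shows "(\<Sum>a\<in>#proots (char_poly A). \<xi> a) = (\<Sum>i<n. if \<sigma> i = i then \<xi> (A $$ (i, i)) else 0)"
proof -
  have m0: "m > 0" using m by (cases m) auto
  let ?p = "\<lambda>I. det (cut_mat n I (char_poly_matrix A))"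
  have mult: "?p (I \<union> J) = ?p I * ?p J"
    if "I \<inter> J = {}" "I \<subseteq> {..<n}" "J \<subseteq> {..<n}" "\<sigma> ` I \<subseteq> I" "\<sigma> ` J \<subseteq> J" for I J
  proof -
    have "cut_mat n (I \<union> J) (char_poly_matrix A) = cut_mat n I (char_poly_matrix A) * cut_mat n J (char_poly_matrix A)"
    proof (rule cut_mat_Un)
      fix i j assume ij: "i < n" "j < n" "i \<in> I \<and> j \<in> J \<or> i \<in> J \<and> j \<in> I"
      then have "i \<noteq> \<sigma> j" "i \<noteq> j" using that by blast+
      then show "char_poly_matrix A $$ (i, j) = 0" using A0 ij A by (auto simp: char_poly_matrix_def)
    qed fact
    then show ?thesis by (simp add: det_mult[of _ n])
  qed
  have all: "?p {..<n} = char_poly A" using A by (simp add: cut_mat_all char_poly_def)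
  have cp0: "char_poly A \<noteq> 0" using degree_monic_char_poly[OF A] by auto
  have "(\<sigma> ^^ k) j \<in> I" if "j \<in> I" "\<sigma> ` I \<subseteq> I" for j I k
    using that by (induction k) auto
  note pw = this
  have dvd: "?p I dvd char_poly A" if "I \<subseteq> {..<n}" "\<sigma> ` I \<subseteq> I" for I
  proof -
    \<comment> \<open>\<open>\<sigma> ^^ (m - 1)\<close> inverts \<open>\<sigma>\<close>, so an
      invariant set that contains \<open>\<sigma> x\<close> also contains \<open>x\<close>; hence
      complements of invariant sets are invariant.\<close>
    have "\<sigma> ` ({..<n} - I) \<subseteq> {..<n} - I"
    proof
      fix y assume "y \<in> \<sigma> ` ({..<n} - I)"
      then obtain x where x: "x < n" "x \<notin> I" "y = \<sigma> x" by auto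
      have "(\<sigma> ^^ (m - 1)) y = (\<sigma> ^^ (m - 1 + 1)) x" unfolding x funpow_add by simp
      then have "(\<sigma> ^^ (m - 1)) y = x" using x \<sigma> m0 by simp
      then have "y \<notin> I" using pw[of y I "m - 1"] that x by auto
      then show "y \<in> {..<n} - I" using x \<sigma> by simp
    qed
    then have "?p (I \<union> ({..<n} - I)) = ?p I * ?p ({..<n} - I)" using that by (intro mult) auto
    then show ?thesis using that all by (metis Un_Diff_cancel Un_absorb1 dvd_triv_left)
  qed
  have roots: "x ^ m = 1" if "x \<in># proots (?p I)" "I \<subseteq> {..<n}" "\<sigma> ` I \<subseteq> I" for x I
  proof -
    have "?p I \<noteq> 0" using dvd[OF that(2,3)] cp0 by auto
    then have "poly (?p I) x = 0" using that by simp
    then have "poly (char_poly A) x = 0" using dvd[OF that(2,3)] by (metis poly_eq_0_iff_dvd dvd_trans)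
    then show ?thesis using eigenvalue_root_char_poly[OF A] eigenvalue_finite_order[OF A Am] by blast
  qed
  have "(\<Sum>a\<in>#proots (?p I). \<xi> a) = (\<Sum>i\<in>I. if \<sigma> i = i then \<xi> (A $$ (i, i)) else 0)"
    if "I \<subseteq> {..<n}" "\<sigma> ` I \<subseteq> I" for I
    using that
  proof (induction "card I" arbitrary: I rule: less_induct)
    case less
    have finI: "finite I" using less.prems finite_subset by blast
    show ?case
    proof (cases "I = {}")
      case True
      then show ?thesis by (simp add: cut_mat_empty)
    next
      case False
      then obtain i where i: "i \<in> I" by auto
      then have "i < n" using less.prems by auto
      define Orb where "Orb = range (\<lambda>k. (\<sigma> ^^ k) i)"
      have OI: "Orb \<subseteq> I" using pw i less.prems by (auto simp: Orb_def)
      have iO: "i \<in> Orb" unfolding Orb_def by (metis funpow_0 rangeI)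
      have "\<sigma> ((\<sigma> ^^ k) i) \<in> Orb" for k unfolding Orb_def by (metis funpow.simps(2) comp_apply rangeI)
      then have sO: "\<sigma> ` Orb \<subseteq> Orb" unfolding Orb_def by auto
      have sI: "\<sigma> ` (I - Orb) \<subseteq> I - Orb"
      proof
        fix y assume "y \<in> \<sigma> ` (I - Orb)"
        then obtain x where x: "x \<in> I" "x \<notin> Orb" "y = \<sigma> x" by auto
        have "(\<sigma> ^^ (m - 1)) y = (\<sigma> ^^ (m - 1 + 1)) x" unfolding x funpow_add by simp
        then have "(\<sigma> ^^ (m - 1)) y = x" using x \<sigma> m0 less.prems by auto
        then have "y \<notin> Orb" using pw[of y Orb "m - 1"] sO x by auto
        then show "y \<in> I - Orb" using x less.prems by auto
      qed
      have "?p (Orb \<union> (I - Orb)) = ?p Orb * ?p (I - Orb)"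
        using OI less.prems sI sO by (intro mult) auto
      then have pI: "?p I = ?p Orb * ?p (I - Orb)" using OI by (simp add: Un_absorb1)
      have p0: "?p Orb \<noteq> 0" "?p (I - Orb) \<noteq> 0" using pI dvd[of I] cp0 less.prems by auto
      have cI: "card (I - Orb) < card I" using i iO finI by (metis DiffD2 Diff_subset psubsetI psubset_card_mono)
      have IH: "(\<Sum>a\<in>#proots (?p (I - Orb)). \<xi> a) = (\<Sum>i\<in>I - Orb. if \<sigma> i = i then \<xi> (A $$ (i, i)) else 0)"
        using less.hyps[OF cI] sI less.prems by auto
      have "(\<Sum>a\<in>#proots (?p Orb). \<xi> a) = (\<Sum>i\<in>Orb. if \<sigma> i = i then \<xi> (A $$ (i, i)) else 0)"
      proof (cases "\<sigma> i = i")
        case True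
        have "(\<sigma> ^^ k) i = i" for k using True by (induction k) auto
        then have Orb: "Orb = {i}" by (auto simp: Orb_def)
        have "?p Orb = [:- A $$ (i, i), 1:]"
          unfolding Orb det_cut_mat_singleton[OF \<open>i < n\<close>] using \<open>i < n\<close> A by (simp add: char_poly_matrix_def)
        then have "proots (?p Orb) = {#A $$ (i, i)#}" by simp
        then show ?thesis using True Orb by simp
      next
        case False
        obtain z :: 'k where z: "z \<noteq> 1" "z ^ m = 1" "image_mset (\<lambda>x. z * x) (proots (?p Orb)) = proots (?p Orb)"
          using proots_orbit[OF A \<sigma> A0 m \<open>i < n\<close> False Orb_def p0(1)] by blast
        have "(\<Sum>a\<in>#proots (?p Orb). \<xi> a) = 0"
          using roots[of _ Orb] OI less.prems sO by (intro sum_mset_scale_eq_0[OF \<xi> _ m0 z]) auto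
        moreover have "\<sigma> j \<noteq> j" if jO: "j \<in> Orb" for j
        proof
          assume j: "\<sigma> j = j"
          obtain k where k: "j = (\<sigma> ^^ k) i" using jO unfolding Orb_def by blast
          have fx: "(\<sigma> ^^ t) j = j" for t using j by (induction t) auto
          \<comment> \<open>\<open>j\<close> is assumed fixed, but \<open>m * k - k\<close> further
            steps lead from \<open>j\<close> back to \<open>i\<close>; hence \<open>j = i\<close>,
            which is not fixed.\<close>
          have "j = (\<sigma> ^^ (m * k - k)) j" using fx by simp
          also have "\<dots> = (\<sigma> ^^ (m * k - k + k)) i" unfolding k funpow_add by simp
          also have "m * k - k + k = m * k" using m0 by (simp add: le_add_diff_inverse2)
          also have "(\<sigma> ^^ (m * k)) i = i" using funpow_fixed \<sigma>(2) \<open>i < n\<close> by metis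
          finally show False using j False by simp
        qed
        ultimately show ?thesis by (simp add: sum.neutral)
      qed
      then show ?thesis unfolding pI proots_mult[OF p0] using IH OI finI
        by (simp add: sum.subset_diff[of Orb I] add.commute)
    qed
  qed
  from this[of "{..<n}"] show ?thesis using all \<sigma> by auto
qed

section \<open>Monomial representations\<close>

lemma GL_group: "group (GL TYPE('k::field) n)"
  by (intro monoid.units_group ring.is_monoid ring_mat)

text \<open>Replaces \<open>GL\<close> by matrix identities: the value at \<open>g\<close> is
  invertible because the value at \<open>inv g\<close> is its inverse.\<close>

lemma representation_iff:
  fixes \<rho> :: "'a \<Rightarrow> 'k::field mat"
  assumes "group G"
  shows "representation G n \<rho> \<longleftrightarrow>
    (\<forall>g\<in>carrier G. \<rho> g \<in> carrier_mat n n) \<and>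
    (\<forall>g\<in>carrier G. \<forall>h\<in>carrier G. \<rho> (g \<otimes>\<^bsub>G\<^esub> h) = \<rho> g * \<rho> h) \<and> \<rho> \<one>\<^bsub>G\<^esub> = 1\<^sub>m n"
    (is "_ \<longleftrightarrow> ?R")
proof
  interpret group G by fact
  interpret U: group "GL TYPE('k) n" by (rule GL_group)
  assume r: "representation G n \<rho>"
  then interpret group_hom G "GL TYPE('k) n" \<rho>
    by unfold_locales (simp add: representation_def)
  have "\<rho> g \<in> carrier_mat n n" if "g \<in> carrier G" for g
    using hom_closed[OF that] by (simp add: units_of_carrier Units_def ring_mat_def)
  moreover have "\<rho> \<one>\<^bsub>G\<^esub> = 1\<^sub>m n" using hom_one by (simp add: units_of_one ring_mat_def)
  ultimately show ?R using hom_mult by (simp add: units_of_mult ring_mat_def)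
next
  interpret group G by fact
  assume R: ?R
  have "\<rho> g \<in> Units (ring_mat TYPE('k) n ())" if g: "g \<in> carrier G" for g
  proof -
    have "\<rho> (inv\<^bsub>G\<^esub> g) * \<rho> g = 1\<^sub>m n" "\<rho> g * \<rho> (inv\<^bsub>G\<^esub> g) = 1\<^sub>m n"
      using R g by (metis inv_closed l_inv, metis inv_closed r_inv)
    moreover have "\<rho> (inv\<^bsub>G\<^esub> g) \<in> carrier_mat n n" using R g by auto
    ultimately show ?thesis using R g unfolding Units_def by (auto simp: ring_mat_def)
  qed
  then show "representation G n \<rho>"
    using R by (auto simp: representation_def hom_def units_of_carrier units_of_mult ring_mat_def)
qed

lemma rep_kernel_iff:
  "g \<in> rep_kernel G n \<rho> \<longleftrightarrow> g \<in> carrier G \<and> \<rho> g = 1\<^sub>m n"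
  by (simp add: rep_kernel_def kernel_def units_of_one ring_mat_def)

lemma representation_pow:
  assumes "group G" "representation G n \<rho>" "g \<in> carrier G"
  shows "\<rho> (g [^]\<^bsub>G\<^esub> (k::nat)) = \<rho> g ^\<^sub>m k"
proof -
  interpret group G by fact
  show ?thesis
    using assms by (induction k) (auto simp: representation_iff)
qed

lemma subspace_module_vec_iff:
  "VectorSpace.subspace class_ring W (module_vec TYPE('k::field) n) \<longleftrightarrow>
    W \<subseteq> carrier_vec n \<and> 0\<^sub>v n \<in> W \<and> (\<forall>v\<in>W. \<forall>w\<in>W. v + w \<in> W) \<and> (\<forall>c. \<forall>v\<in>W. c \<cdot>\<^sub>v v \<in> W)"
proof -
  interpret vec_space "TYPE('k)" n .
  have "module class_ring (module_vec TYPE('k) n)" by (rule module_axioms)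
  then show ?thesis
    using vectorspace_axioms by (auto simp: subspace_def submodule_def module_vec_def)
qed

text \<open>\<open>x\<close> enumerates representatives of the right cosets \<open>T x\<^sub>i\<close>.\<close>

locale monomial_rep = group G for G (structure) +
  fixes T :: "'a set" and \<mu> :: "'a \<Rightarrow> 'k::field" and x :: "nat \<Rightarrow> 'a" and n :: nat
  assumes T: "subgroup T G"
    and \<mu>_mult: "s \<in> T \<Longrightarrow> t \<in> T \<Longrightarrow> \<mu> (s \<otimes> t) = \<mu> s * \<mu> t"
    and \<mu>_one: "\<mu> \<one> = 1"
    and x_closed: "i < n \<Longrightarrow> x i \<in> carrier G"
    and x_trans: "y \<in> carrier G \<Longrightarrow> \<exists>!i. i < n \<and> x i \<otimes> y \<in> T"
begin

text \<open>The index of the coset \<open>T (inv y)\<close>. It is constant on left cosets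
  \<open>y T\<close>, so left multiplication by group elements acts on the indices.\<close>

definition idx :: "'a \<Rightarrow> nat" where
  "idx y = (THE i. i < n \<and> x i \<otimes> y \<in> T)"

text \<open>The representation induced from the linear \<open>\<mu>\<close>, in the basis that
  belongs to the transversal; column \<open>j\<close> has its only nonzero entry in row
  \<open>\<sigma> g j\<close>.\<close>

definition \<rho> :: "'a \<Rightarrow> 'k mat" where
  "\<rho> g = mat n n (\<lambda>(i, j). if x i \<otimes> g \<otimes> inv (x j) \<in> T then \<mu> (x i \<otimes> g \<otimes> inv (x j)) else 0)"

definition \<sigma> :: "'a \<Rightarrow> nat \<Rightarrow> nat" where
  "\<sigma> g j = idx (g \<otimes> inv (x j))"

lemma T_carrier: "t \<in> T \<Longrightarrow> t \<in> carrier G"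
  using subgroup.mem_carrier[OF T] .

lemma \<mu>_inv: "t \<in> T \<Longrightarrow> \<mu> t * \<mu> (inv t) = 1"
  using \<mu>_mult[of t "inv t"] \<mu>_one subgroup.m_inv_closed[OF T] T_carrier by simp

lemma idx: "y \<in> carrier G \<Longrightarrow> idx y < n" "y \<in> carrier G \<Longrightarrow> x (idx y) \<otimes> y \<in> T"
  using theI'[OF x_trans[of y]] by (auto simp: idx_def)

lemma idx_eqI: "y \<in> carrier G \<Longrightarrow> i < n \<Longrightarrow> x i \<otimes> y \<in> T \<Longrightarrow> idx y = i"
  using x_trans[of y] idx[of y] by blast

lemma idx_mult_right: "y \<in> carrier G \<Longrightarrow> t \<in> T \<Longrightarrow> idx (y \<otimes> t) = idx y"
  using idx[of y] subgroup.m_closed[OF T, of "x (idx y) \<otimes> y" t] T_carrier[of t] x_closed[of "idx y"]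
  by (intro idx_eqI) (auto simp: m_assoc)

lemma idx_inv_x: "i < n \<Longrightarrow> idx (inv (x i)) = i"
  by (intro idx_eqI) (auto simp: x_closed subgroup.one_closed[OF T])

lemma \<sigma>_less: "g \<in> carrier G \<Longrightarrow> j < n \<Longrightarrow> \<sigma> g j < n"
  by (simp add: \<sigma>_def idx x_closed)

lemma \<sigma>_iff: "g \<in> carrier G \<Longrightarrow> i < n \<Longrightarrow> j < n \<Longrightarrow> x i \<otimes> g \<otimes> inv (x j) \<in> T \<longleftrightarrow> i = \<sigma> g j"
  using idx_eqI[of "g \<otimes> inv (x j)" i] idx[of "g \<otimes> inv (x j)"] x_closed
  by (auto simp: \<sigma>_def m_assoc)

lemma \<sigma>_one: "j < n \<Longrightarrow> \<sigma> \<one> j = j"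
  by (simp add: \<sigma>_def idx_inv_x x_closed)

lemma \<sigma>_mult:
  assumes "g \<in> carrier G" "h \<in> carrier G" "j < n"
  shows "\<sigma> (g \<otimes> h) j = \<sigma> g (\<sigma> h j)"
proof -
  define k where "k = \<sigma> h j"
  have k: "k < n" using \<sigma>_less assms by (simp add: k_def)
  define t where "t = x k \<otimes> h \<otimes> inv (x j)"
  have t: "t \<in> T" using \<sigma>_iff[of h k j] k assms by (simp add: t_def k_def)
  have "g \<otimes> h \<otimes> inv (x j) = g \<otimes> inv (x k) \<otimes> t"
    using assms x_closed k by (simp add: t_def m_assoc inv_solve_left)
  then show ?thesis
    using idx_mult_right[of "g \<otimes> inv (x k)" t] t assms x_closed[OF k] by (simp add: \<sigma>_def k_def)
qed

lemma \<sigma>_funpow: "g \<in> carrier G \<Longrightarrow> j < n \<Longrightarrow> (\<sigma> g ^^ k) j = \<sigma> (g [^] k) j"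
proof (induction k)
  case (Suc k)
  have "\<sigma> (g [^] Suc k) j = \<sigma> g (\<sigma> (g [^] k) j)"
    unfolding nat_pow_Suc2[OF Suc.prems(1)] using Suc.prems by (simp add: \<sigma>_mult)
  then show ?case using Suc by simp
qed (simp add: \<sigma>_one)

lemma \<rho>_closed [simp]: "\<rho> g \<in> carrier_mat n n"
  by (simp add: \<rho>_def)

lemma \<rho>_index: "i < n \<Longrightarrow> j < n \<Longrightarrow> g \<in> carrier G \<Longrightarrow>
    \<rho> g $$ (i, j) = (if i = \<sigma> g j then \<mu> (x i \<otimes> g \<otimes> inv (x j)) else 0)"
  by (simp add: \<rho>_def \<sigma>_iff)

lemma \<rho>_mult:
  assumes g: "g \<in> carrier G" and h: "h \<in> carrier G"
  shows "\<rho> (g \<otimes> h) = \<rho> g * \<rho> h"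
proof (rule eq_matI)
  fix i k assume "i < dim_row (\<rho> g * \<rho> h)" "k < dim_col (\<rho> g * \<rho> h)"
  then have ik: "i < n" "k < n" by (simp_all add: \<rho>_def)
  define j where "j = \<sigma> h k"
  have j: "j < n" using \<sigma>_less h ik by (simp add: j_def)
  have "(\<rho> g * \<rho> h) $$ (i, k) = (\<Sum>l = 0..<n. \<rho> g $$ (i, l) * \<rho> h $$ (l, k))"
    using ik by (simp add: times_mat_def scalar_prod_def \<rho>_def)
  also have "\<dots> = (\<Sum>l = 0..<n. if l = j then \<rho> g $$ (i, j) * \<rho> h $$ (j, k) else 0)"
    using ik h by (intro sum.cong) (auto simp: \<rho>_index j_def)
  also have "\<dots> = \<rho> g $$ (i, j) * \<rho> h $$ (j, k)" using j by simp
  also have "\<dots> = \<rho> (g \<otimes> h) $$ (i, k)"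
  proof (cases "i = \<sigma> g j")
    case True
    have T1: "x i \<otimes> g \<otimes> inv (x j) \<in> T" "x j \<otimes> h \<otimes> inv (x k) \<in> T"
      using \<sigma>_iff ik j g h True by (auto simp: j_def)
    have "x i \<otimes> (g \<otimes> h) \<otimes> inv (x k) = (x i \<otimes> g \<otimes> inv (x j)) \<otimes> (x j \<otimes> h \<otimes> inv (x k))"
      using x_closed ik j g h by (simp add: m_assoc inv_solve_left)
    then show ?thesis using True ik j g h T1 \<mu>_mult[OF T1] by (simp add: \<rho>_index \<sigma>_mult j_def)
  next
    case False
    then show ?thesis using ik j g h by (simp add: \<rho>_index \<sigma>_mult j_def)
  qed
  finally show "\<rho> (g \<otimes> h) $$ (i, k) = (\<rho> g * \<rho> h) $$ (i, k)" by simp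
qed (simp_all add: \<rho>_def)

lemma \<rho>_one: "\<rho> \<one> = 1\<^sub>m n"
  by (rule eq_matI) (auto simp: \<rho>_index \<sigma>_one x_closed \<mu>_one, simp_all add: \<rho>_def)

lemma representation_\<rho>: "representation G n \<rho>"
  unfolding representation_iff[OF is_group] by (simp add: \<rho>_mult \<rho>_one)

lemma n_pos: "n > 0"
  using idx(1)[of \<one>] by simp

text \<open>The decomposition behind both the index formula \<open>card_carrier\<close> and the
  evaluation of sums over the group coset by coset.\<close>

lemma bij_transversal: "bij_betw (\<lambda>(t, i). t \<otimes> x i) (T \<times> {..<n}) (carrier G)"
  unfolding bij_betw_def
proof
  show "inj_on (\<lambda>(t, i). t \<otimes> x i) (T \<times> {..<n})"
  proof (rule inj_onI, clarsimp)
    fix s i t j assume a: "s \<in> T" "i < n" "t \<in> T" "j < n" "s \<otimes> x i = t \<otimes> x j"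
    have "x i \<otimes> inv (x j) = inv s \<otimes> t"
    proof -
      have "x i = inv s \<otimes> (t \<otimes> x j)"
        using a T_carrier x_closed inv_solve_left[of "x i" s "t \<otimes> x j"] by simp
      then show ?thesis using a T_carrier x_closed by (simp add: m_assoc)
    qed
    then have "x i \<otimes> inv (x j) \<in> T" using a T by (simp add: subgroup.m_closed subgroup.m_inv_closed)
    then have "i = j" using idx_eqI[of "inv (x j)" i] idx_inv_x[of j] a x_closed by simp
    then show "s = t \<and> i = j" using a T_carrier x_closed by simp
  qed
  show "(\<lambda>(t, i). t \<otimes> x i) ` (T \<times> {..<n}) = carrier G"
  proof safe
    fix y assume y: "y \<in> carrier G"
    let ?i = "idx (inv y)"
    have i: "?i < n" "x ?i \<otimes> inv y \<in> T" using idx y by auto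
    then have "inv (x ?i \<otimes> inv y) \<otimes> x ?i = y" using y x_closed
      by (simp add: inv_mult_group m_assoc)
    moreover have "inv (x ?i \<otimes> inv y) \<in> T" using i T by (simp add: subgroup.m_inv_closed)
    ultimately show "y \<in> (\<lambda>(t, i). t \<otimes> x i) ` (T \<times> {..<n})" using i
      by (intro image_eqI[of _ _ "(inv (x ?i \<otimes> inv y), ?i)"]) auto
  qed (use T_carrier x_closed in auto)
qed

lemma card_carrier: "card (carrier G) = card T * n"
  using bij_betw_same_card[OF bij_transversal] by (simp add: card_cartesian_product)

lemma rep_kernelI:
  assumes "K \<lhd> G" "K \<subseteq> T" "\<And>k. k \<in> K \<Longrightarrow> \<mu> k = 1" "k \<in> K"
  shows "k \<in> rep_kernel G n \<rho>"
proof -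
  interpret K: normal K G by fact
  have kG: "k \<in> carrier G" using assms by (simp add: K.mem_carrier)
  have "\<rho> k = 1\<^sub>m n"
  proof (rule eq_matI)
    fix i j assume "i < dim_row (1\<^sub>m n :: 'k mat)" "j < dim_col (1\<^sub>m n :: 'k mat)"
    then have ij: "i < n" "j < n" by auto
    have "x j \<otimes> k \<otimes> inv (x j) \<in> K" using K.inv_op_closed2 x_closed ij assms by simp
    moreover from this have "j = \<sigma> k j" using \<sigma>_iff[of k j j] kG ij assms(2) by auto
    ultimately show "\<rho> k $$ (i, j) = 1\<^sub>m n $$ (i, j)" using ij kG assms(3) by (auto simp: \<rho>_index)
  qed (simp_all add: \<rho>_def)
  then show ?thesis using kG by (simp add: rep_kernel_iff)
qed

text \<open>The matrix of \<open>u\<close> need not show \<open>\<mu> u\<close> at position (0, 0),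
  but that of the conjugate \<open>inv (x 0) \<otimes> u \<otimes> x 0\<close> does, and this
  conjugate belongs to the normal subgroup \<open>L\<close> as well.\<close>

lemma rep_kernelD:
  assumes "L \<lhd> G" "L \<subseteq> rep_kernel G n \<rho>" "u \<in> L" "u \<in> T"
  shows "\<mu> u = 1"
proof -
  interpret L: normal L G by fact
  have u: "u \<in> carrier G" "x 0 \<in> carrier G" using assms n_pos x_closed by (simp_all add: L.mem_carrier)
  define v where "v = inv (x 0) \<otimes> u \<otimes> x 0"
  have "v \<in> L" using L.inv_op_closed1 u assms by (simp add: v_def)
  then have "\<rho> v = 1\<^sub>m n" and vG: "v \<in> carrier G" using assms(2) by (auto simp: rep_kernel_iff)
  moreover have "x 0 \<otimes> v \<otimes> inv (x 0) = u" using u by (simp add: v_def m_assoc[symmetric]) (simp add: m_assoc)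
  ultimately show ?thesis using n_pos assms \<sigma>_iff[of v 0 0] \<rho>_index[of 0 0 v] by auto
qed

end

text \<open>Since \<open>\<mu>\<close> is multiplicative on \<open>T\<close>, every element of
  \<open>T\<close> stabilizes its restriction to \<open>N\<close>; \<open>stab\<close> therefore
  makes \<open>T\<close> the full stabilizer. This is the situation of the Clifford correspondence,
  for a linear character of the stabilizer.\<close>

locale irreducible_monomial_rep = monomial_rep G T \<mu> x n
  for G (structure) and T :: "'a set" and \<mu> :: "'a \<Rightarrow> 'k::field" and x :: "nat \<Rightarrow> 'a" and n :: nat +
  fixes N :: "'a set"
  assumes N: "N \<lhd> G" "N \<subseteq> T"
    and stab: "g \<in> carrier G \<Longrightarrow> (\<And>u. u \<in> N \<Longrightarrow> \<mu> (g \<otimes> u \<otimes> inv g) = \<mu> u) \<Longrightarrow> g \<in> T"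
begin

text \<open>If the conjugates of \<open>\<mu>\<close> by \<open>x i\<close> and \<open>x j\<close>
  agree on \<open>N\<close>, then \<open>x i \<otimes> inv (x j)\<close> stabilizes the restriction
  of \<open>\<mu>\<close> to \<open>N\<close> and so lies in \<open>T\<close>; but
  \<open>x i\<close> and \<open>x j\<close> represent different cosets.\<close>

lemma conjugates_distinct_on_N:
  assumes "i < n" "j < n" "i \<noteq> j"
  shows "\<exists>u\<in>N. \<mu> (x i \<otimes> u \<otimes> inv (x i)) \<noteq> \<mu> (x j \<otimes> u \<otimes> inv (x j))"
proof (rule ccontr)
  interpret N: normal N G by (rule N)
  assume "\<not> ?thesis"
  then have eq: "\<mu> (x i \<otimes> u \<otimes> inv (x i)) = \<mu> (x j \<otimes> u \<otimes> inv (x j))" if "u \<in> N" for u using that by blast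
  have xx: "x i \<in> carrier G" "x j \<in> carrier G" using assms x_closed by auto
  have "x i \<otimes> inv (x j) \<in> T"
  proof (rule stab)
    fix u assume u: "u \<in> N"
    then have uG: "u \<in> carrier G" by (rule N.mem_carrier)
    have v: "inv (x j) \<otimes> u \<otimes> x j \<in> N" using N.inv_op_closed1 xx u by simp
    have "x i \<otimes> inv (x j) \<otimes> u \<otimes> inv (x i \<otimes> inv (x j)) = x i \<otimes> (inv (x j) \<otimes> u \<otimes> x j) \<otimes> inv (x i)"
      using xx uG by (simp add: m_assoc inv_mult_group)
    then show "\<mu> (x i \<otimes> inv (x j) \<otimes> u \<otimes> inv (x i \<otimes> inv (x j))) = \<mu> u"
      using eq[OF v] xx uG by (simp add: m_assoc[symmetric]) (simp add: m_assoc)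
  qed (use xx in simp)
  then have "i = j" using idx_eqI[of "inv (x j)" i] idx_inv_x[of j] assms xx by simp
  then show False using assms by simp
qed

lemma \<rho>_N:
  assumes "u \<in> N" "v \<in> carrier_vec n" "i < n"
  shows "(\<rho> u *\<^sub>v v) $ i = \<mu> (x i \<otimes> u \<otimes> inv (x i)) * v $ i"
proof -
  interpret N: normal N G by (rule N)
  have uG: "u \<in> carrier G" using assms by (simp add: N.mem_carrier)
  have s: "\<sigma> u j = j" if "j < n" for j
    using N.inv_op_closed2[of "x j" u] \<sigma>_iff[of u j j] that x_closed assms N(2) uG by auto
  have "(\<rho> u *\<^sub>v v) $ i = (\<Sum>j = 0..<n. \<rho> u $$ (i, j) * v $ j)"
    using assms by (simp add: scalar_prod_def \<rho>_def)
  also have "\<dots> = (\<Sum>j = 0..<n. if j = i then \<mu> (x i \<otimes> u \<otimes> inv (x i)) * v $ i else 0)"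
    using assms uG s by (intro sum.cong) (auto simp: \<rho>_index)
  finally show ?thesis using assms by simp
qed

lemma irreducible_\<rho>: "irreducible_representation G n \<rho>"
  unfolding irreducible_representation_def
proof (intro conjI allI impI)
  fix W assume "VectorSpace.subspace class_ring W (module_vec TYPE('k) n) \<and> (\<forall>g\<in>carrier G. \<forall>w\<in>W. \<rho> g *\<^sub>v w \<in> W)"
  then have W: "W \<subseteq> carrier_vec n" "0\<^sub>v n \<in> W" "\<And>v w. v \<in> W \<Longrightarrow> w \<in> W \<Longrightarrow> v + w \<in> W"
      "\<And>c v. v \<in> W \<Longrightarrow> c \<cdot>\<^sub>v v \<in> W" "\<And>g w. g \<in> carrier G \<Longrightarrow> w \<in> W \<Longrightarrow> \<rho> g *\<^sub>v w \<in> W"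
    by (auto simp: subspace_module_vec_iff)
  show "W = {0\<^sub>v n} \<or> W = carrier_vec n"
  proof (cases "W = {0\<^sub>v n}")
    case False
    \<comment> \<open>A nonzero vector of minimal support in \<open>W\<close> is a multiple of a unit vector, since elements of \<open>N\<close> act
      diagonally and separate the coordinates.\<close>
    define supp :: "'k vec \<Rightarrow> nat set" where "supp w = {i. i < n \<and> w $ i \<noteq> 0}" for w
    have finsupp: "finite (supp w)" for w by (simp add: supp_def)
    have supp0: "supp w \<noteq> {}" if "w \<in> carrier_vec n" "w \<noteq> 0\<^sub>v n" for w
      using that unfolding supp_def by (metis (mono_tags, lifting) carrier_vecD empty_Collect_eq eq_vecI index_zero_vec)
    define P where "P w \<longleftrightarrow> w \<in> W \<and> w \<noteq> 0\<^sub>v n" for w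
    obtain w0 where "P w0" using False W by (auto simp: P_def)
    then obtain w where Pw: "P w" and min: "\<And>v. P v \<Longrightarrow> card (supp w) \<le> card (supp v)"
      using ex_has_least_nat[of P w0 "\<lambda>v. card (supp v)"] by blast
    have w: "w \<in> W" "w \<noteq> 0\<^sub>v n" "w \<in> carrier_vec n" using Pw W by (auto simp: P_def)
    obtain i where i: "i \<in> supp w" using supp0 w by blast
    have "i < n" using i by (simp add: supp_def)
    have single: "supp w = {i}"
    proof (rule ccontr)
      assume "supp w \<noteq> {i}"
      then obtain j where j: "j \<in> supp w" "j \<noteq> i" using i by blast
      then have "j < n" by (simp add: supp_def)
      obtain u where u: "u \<in> N" "\<mu> (x i \<otimes> u \<otimes> inv (x i)) \<noteq> \<mu> (x j \<otimes> u \<otimes> inv (x j))"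
        using conjugates_distinct_on_N[OF \<open>i < n\<close> \<open>j < n\<close>] j by auto
      have uG: "u \<in> carrier G" using u N by (meson normal_imp_subgroup subgroup.mem_carrier)
      \<comment> \<open>This kills coordinate \<open>i\<close>, where \<open>u\<close> acts by the
        subtracted scalar, and keeps coordinate \<open>j\<close>, where it acts by a different one:
        the support shrinks without becoming empty.\<close>
      define v where "v = \<rho> u *\<^sub>v w + (- \<mu> (x i \<otimes> u \<otimes> inv (x i))) \<cdot>\<^sub>v w"
      have "v \<in> W" unfolding v_def using W w uG by blast
      have vk: "v $ k = (\<mu> (x k \<otimes> u \<otimes> inv (x k)) - \<mu> (x i \<otimes> u \<otimes> inv (x i))) * w $ k" if "k < n" for k
        using that w \<rho>_N[OF u(1) w(3) that] by (simp add: v_def algebra_simps)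
      have "v $ j \<noteq> 0" using vk[OF \<open>j < n\<close>] u j by (simp add: supp_def)
      then have "v \<noteq> 0\<^sub>v n" using \<open>j < n\<close> by auto
      then have "card (supp w) \<le> card (supp v)" using min \<open>v \<in> W\<close> by (simp add: P_def)
      moreover have "supp v \<subseteq> supp w - {i}" using vk by (auto simp: supp_def)
      then have "card (supp v) < card (supp w)"
        using i finsupp by (metis card_Diff1_less card_mono finite_Diff le_less_trans)
      ultimately show False by simp
    qed
    have ei: "unit_vec n i \<in> W"
    proof -
      have "w $ i \<noteq> 0" using i by (simp add: supp_def)
      moreover have "w $ k = 0" if "k < n" "k \<noteq> i" for k
        using single that unfolding supp_def by blast
      ultimately have "inverse (w $ i) \<cdot>\<^sub>v w = unit_vec n i"
        using w(3) \<open>i < n\<close> by (intro eq_vecI) auto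
      then show ?thesis using W w by metis
    qed
    have ej: "unit_vec n j \<in> W" if j: "j < n" for j
    proof -
      \<comment> \<open>For this \<open>g\<close> the entry of \<open>\<rho> g\<close> at
        (\<open>j\<close>, \<open>i\<close>) is \<open>\<mu> \<one> = 1\<close>, so the unit vector
        itself is reached and not only a multiple of it.\<close>
      define g where "g = inv (x j) \<otimes> x i"
      have gG: "g \<in> carrier G" using x_closed \<open>i < n\<close> j by (simp add: g_def)
      have gx: "x j \<otimes> g \<otimes> inv (x i) = \<one>" using x_closed \<open>i < n\<close> j
        by (simp add: g_def m_assoc[symmetric])
      have "x j \<otimes> g \<otimes> inv (x i) \<in> T" unfolding gx by (rule subgroup.one_closed[OF T])
      then have s: "\<sigma> g i = j" using \<sigma>_iff[OF gG j \<open>i < n\<close>] by blast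
      have "\<rho> g *\<^sub>v unit_vec n i = unit_vec n j"
      proof (rule eq_vecI)
        fix k assume "k < dim_vec (unit_vec n j :: 'k vec)"
        then have k: "k < n" by simp
        have "(\<rho> g *\<^sub>v unit_vec n i) $ k = \<rho> g $$ (k, i)" using k \<open>i < n\<close> by (simp add: \<rho>_def)
        then show "(\<rho> g *\<^sub>v unit_vec n i) $ k = unit_vec n j $ k"
          using k \<open>i < n\<close> j s gx gG by (auto simp: \<rho>_index \<mu>_one)
      qed (simp add: \<rho>_def)
      then show ?thesis using W(5)[OF gG ei] by (simp only:)
    qed
    have "v \<in> W" if v: "v \<in> carrier_vec n" for v
    proof -
      have "m \<le> n \<Longrightarrow> vec n (\<lambda>k. if k < m then v $ k else 0) \<in> W" for m
      proof (induction m)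
        case 0
        have "vec n (\<lambda>k. if k < 0 then v $ k else 0) = 0\<^sub>v n" by (rule eq_vecI) auto
        then show ?case using W by simp
      next
        case (Suc m)
        have "vec n (\<lambda>k. if k < Suc m then v $ k else 0)
            = vec n (\<lambda>k. if k < m then v $ k else 0) + v $ m \<cdot>\<^sub>v unit_vec n m"
          using Suc.prems by (intro eq_vecI) (auto simp: less_Suc_eq)
        then show ?case using Suc W(3,4) ej[of m] by simp
      qed
      from this[of n] have "vec n (\<lambda>k. if k < n then v $ k else 0) \<in> W" by simp
      moreover have "vec n (\<lambda>k. if k < n then v $ k else 0) = v" using v by (intro eq_vecI) auto
      ultimately show ?thesis by simp
    qed
    then show ?thesis using W by blast
  qed simp
qed (simp_all add: representation_\<rho> n_pos)

end

text \<open>\<open>x i \<otimes> y\<close> lies in \<open>T\<close> exactly if the coset with number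
  \<open>i\<close> is \<open>T (inv y)\<close>, so uniqueness of the index is injectivity of an
  enumeration of the cosets.\<close>

lemma (in group) exists_transversal:
  assumes T: "subgroup T G" and fin: "finite (carrier G)"
  shows "\<exists>x n. (\<forall>i<n. x i \<in> carrier G) \<and> (\<forall>y\<in>carrier G. \<exists>!i::nat. i < n \<and> x i \<otimes> y \<in> T)"
proof -
  have "finite (rcosets T)" using fin by (simp add: RCOSETS_def)
  then obtain e where e: "bij_betw e {0..<card (rcosets T)} (rcosets T)"
    using ex_bij_betw_nat_finite by blast
  let ?n = "card (rcosets T)"
  define x where "x i = (SOME y. y \<in> carrier G \<and> e i = T #> y)" for i
  have x: "x i \<in> carrier G" "e i = T #> x i" if "i < ?n" for i
  proof -
    have "e i \<in> rcosets T" using e that by (auto simp: bij_betw_def)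
    then have "\<exists>y. y \<in> carrier G \<and> e i = T #> y" by (auto simp: RCOSETS_def)
    then have "x i \<in> carrier G \<and> e i = T #> x i" unfolding x_def by (rule someI_ex)
    then show "x i \<in> carrier G" "e i = T #> x i" by auto
  qed
  have iff: "x i \<otimes> y \<in> T \<longleftrightarrow> e i = T #> inv y" if "i < ?n" "y \<in> carrier G" for i y
  proof -
    have "x i \<otimes> y \<in> T \<longleftrightarrow> x i \<in> T #> inv y"
    proof
      assume "x i \<otimes> y \<in> T"
      then show "x i \<in> T #> inv y" using x that by (auto simp: r_coset_def m_assoc intro!: bexI[of _ "x i \<otimes> y"])
    next
      assume "x i \<in> T #> inv y"
      then obtain t where "t \<in> T" "x i = t \<otimes> inv y" by (auto simp: r_coset_def)
      then show "x i \<otimes> y \<in> T" using that subgroup.mem_carrier[OF T] by (simp add: m_assoc)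
    qed
    also have "\<dots> \<longleftrightarrow> e i = T #> inv y"
      using x[OF that(1)] that repr_independence[OF _ _ T, of "x i" "inv y"] rcos_self[OF _ T, of "x i"] by auto
    finally show ?thesis .
  qed
  have "\<exists>!i. i < ?n \<and> x i \<otimes> y \<in> T" if y: "y \<in> carrier G" for y
  proof -
    have "T #> inv y \<in> rcosets T" using y T by (auto simp: RCOSETS_def)
    then obtain i where i: "i < ?n" "e i = T #> inv y"
      using e by (metis atLeastLessThan_iff imageE bij_betw_imp_surj_on)
    show ?thesis
    proof (rule ex1I[of _ i])
      fix j assume "j < ?n \<and> x j \<otimes> y \<in> T"
      then show "j = i" using i iff[of j y] y e unfolding bij_betw_def inj_on_def by auto
    qed (use i iff y in auto)
  qed
  then have "\<forall>y\<in>carrier G. \<exists>!i. i < ?n \<and> x i \<otimes> y \<in> T" by (rule ballI)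
  moreover have "\<forall>i<?n. x i \<in> carrier G" using x(1) by simp
  ultimately show ?thesis by (intro exI[of _ x] exI[of _ ?n] conjI)
qed

section \<open>Ordinary and Brauer characters\<close>

text \<open>That the order of \<open>g\<close> is nonzero in \<open>'k\<close> means that \<open>g\<close> is regular if \<open>'k\<close> has prime characteristic, and is
  no condition in characteristic 0 if the group is finite.\<close>

definition gen_char :: "('k::field \<Rightarrow> complex) \<Rightarrow> ('a, 'b) monoid_scheme \<Rightarrow> ('a \<Rightarrow> 'k mat) \<Rightarrow> 'a \<Rightarrow> complex" where
  "gen_char \<xi> G \<rho> = (\<lambda>g. if g \<in> carrier G \<and> of_nat (group.ord G g) \<noteq> (0::'k)
     then \<Sum>a\<in>#proots (char_poly (\<rho> g)). \<xi> a else 0)"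

definition gen_Irr :: "('k::field \<Rightarrow> complex) \<Rightarrow> ('a, 'b) monoid_scheme \<Rightarrow> ('a \<Rightarrow> complex) set" where
  "gen_Irr \<xi> G = {gen_char \<xi> G \<rho> | n \<rho>. irreducible_representation G n \<rho>}"

text \<open>The character of \<open>T\<close> afforded by \<open>\<mu>\<close>, extended by 0 so
  that \<open>induced_character\<close> applies. Orders are taken in \<open>G\<close>, where they
  agree with those in the subgroup by \<open>ord_subgroup\<close>.\<close>

definition lin_char :: "('k::field \<Rightarrow> complex) \<Rightarrow> ('a, 'b) monoid_scheme \<Rightarrow> 'a set \<Rightarrow> ('a \<Rightarrow> 'k) \<Rightarrow> 'a \<Rightarrow> complex" where
  "lin_char \<xi> G T \<mu> = (\<lambda>g. if g \<in> T \<and> of_nat (group.ord G g) \<noteq> (0::'k) then \<xi> (\<mu> g) else 0)"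

lemma (in group) pow_conj:
  assumes "g \<in> carrier G" "x \<in> carrier G"
  shows "(x \<otimes> g \<otimes> inv x) [^] (k::nat) = x \<otimes> g [^] k \<otimes> inv x"
proof (induction k)
  case (Suc k)
  have "x \<otimes> g [^] k \<otimes> inv x \<otimes> (x \<otimes> g \<otimes> inv x) = x \<otimes> g [^] k \<otimes> (inv x \<otimes> x) \<otimes> g \<otimes> inv x"
    using assms by (simp only: m_assoc nat_pow_closed inv_closed m_closed)
  then show ?case using Suc assms by (simp add: m_assoc)
qed (use assms in simp)

lemma (in group) ord_conj:
  assumes "g \<in> carrier G" "x \<in> carrier G"
  shows "ord (x \<otimes> g \<otimes> inv x) = ord g"
proof -
  have "(x \<otimes> g \<otimes> inv x) [^] k = \<one> \<longleftrightarrow> g [^] k = \<one>" for k :: nat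
    unfolding pow_conj[OF assms] using assms by (metis inv_equality inv_inv inv_closed l_cancel_one m_assoc nat_pow_closed r_one r_inv m_closed)
  then show ?thesis using assms by (simp add: ord_unique pow_eq_id)
qed

lemma (in group) ord_subgroup:
  assumes "subgroup H G" "h \<in> H"
  shows "group.ord (G\<lparr>carrier := H\<rparr>) h = ord h"
proof -
  interpret H: group "G\<lparr>carrier := H\<rparr>" using assms(1) by (rule subgroup_imp_group)
  show ?thesis using assms subgroup.mem_carrier[OF assms(1)]
    by (simp add: H.ord_unique pow_eq_id nat_pow_consistent[symmetric])
qed

section \<open>Induced characters, and linear characters of subgroups\<close>

context monomial_rep
begin

text \<open>\<open>F\<close> is invariant under conjugation by \<open>T\<close>, so the summand is
  constant on each coset of \<open>T\<close>.\<close>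

lemma sum_conj_eq:
  fixes f :: "'k \<Rightarrow> complex"
  assumes fin: "finite (carrier G)" and g: "g \<in> carrier G"
  defines "F \<equiv> \<lambda>y. if y \<in> T then f (\<mu> y) else 0"
  shows "(\<Sum>y\<in>carrier G. F (y \<otimes> g \<otimes> inv y)) = of_nat (card T) * (\<Sum>i<n. F (x i \<otimes> g \<otimes> inv (x i)))"
proof -
  have F: "F (t \<otimes> y \<otimes> inv t) = F y" if t: "t \<in> T" and y: "y \<in> carrier G" for t y
  proof -
    have tG: "t \<in> carrier G" using T_carrier t .
    have "y \<in> T" if "t \<otimes> y \<otimes> inv t \<in> T"
    proof -
      have "inv t \<otimes> (t \<otimes> y \<otimes> inv t) \<otimes> t \<in> T" using that t T by (simp add: subgroup.m_closed subgroup.m_inv_closed)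
      also have "inv t \<otimes> (t \<otimes> y \<otimes> inv t) \<otimes> t = y"
        using tG y by (simp add: m_assoc[symmetric]) (simp add: m_assoc)
      finally show ?thesis .
    qed
    moreover have "t \<otimes> y \<otimes> inv t \<in> T \<and> \<mu> (t \<otimes> y \<otimes> inv t) = \<mu> y" if "y \<in> T"
      using that t T \<mu>_inv[OF t] by (simp add: subgroup.m_closed subgroup.m_inv_closed \<mu>_mult)
    ultimately show ?thesis by (auto simp: F_def)
  qed
  have "(\<Sum>y\<in>carrier G. F (y \<otimes> g \<otimes> inv y)) = (\<Sum>(t, i)\<in>T \<times> {..<n}. F ((t \<otimes> x i) \<otimes> g \<otimes> inv (t \<otimes> x i)))"
    by (subst sum.reindex_bij_betw[OF bij_transversal, symmetric]) (simp add: case_prod_unfold)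
  also have "\<dots> = (\<Sum>(t, i)\<in>T \<times> {..<n}. F (x i \<otimes> g \<otimes> inv (x i)))"
  proof (rule sum.cong, simp, clarsimp)
    fix t i assume ti: "t \<in> T" "i < n"
    have "t \<otimes> x i \<otimes> g \<otimes> inv (t \<otimes> x i) = t \<otimes> (x i \<otimes> g \<otimes> inv (x i)) \<otimes> inv t"
      using ti x_closed T_carrier g by (simp add: m_assoc inv_mult_group)
    then show "F (t \<otimes> x i \<otimes> g \<otimes> inv (t \<otimes> x i)) = F (x i \<otimes> g \<otimes> inv (x i))"
      using F[OF ti(1)] ti x_closed g by simp
  qed
  also have "\<dots> = (\<Sum>t\<in>T. \<Sum>i<n. F (x i \<otimes> g \<otimes> inv (x i)))"
    by (rule sum.cartesian_product[symmetric])
  also have "\<dots> = of_nat (card T) * (\<Sum>i<n. F (x i \<otimes> g \<otimes> inv (x i)))"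
    by simp
  finally show ?thesis .
qed

end

text \<open>For an element whose order is nonzero in the field,
  \<open>sum_proots_monomial_mat\<close> leaves a sum over the cosets fixed by it, and
  \<open>sum_conj_eq\<close> turns this into the induction formula. At the other elements both sides
  vanish, because conjugation preserves orders.\<close>

lemma gen_char_monomial_rep:
  fixes \<mu> :: "'a \<Rightarrow> 'k::alg_closed_field"
  assumes mr: "monomial_rep G T \<mu> x n" and fin: "finite (carrier G)" and \<xi>: "root_lift \<xi>"
  shows "gen_char \<xi> G (monomial_rep.\<rho> G T \<mu> x n) = induced_character G T (lin_char \<xi> G T \<mu>)"
proof
  fix g
  interpret monomial_rep G T \<mu> x n by fact
  show "gen_char \<xi> G \<rho> g = induced_character G T (lin_char \<xi> G T \<mu>) g"
  proof (cases "g \<in> carrier G \<and> of_nat (ord g) \<noteq> (0::'k)")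
    case True
    then have g: "g \<in> carrier G" by simp
    have "card T > 0" using T fin T_carrier by (metis card_gt_0_iff equals0D finite_subset subgroup.one_closed subsetI)
    have "gen_char \<xi> G \<rho> g = (\<Sum>a\<in>#proots (char_poly (\<rho> g)). \<xi> a)" using True by (simp add: gen_char_def)
    also have "\<dots> = (\<Sum>i<n. if \<sigma> g i = i then \<xi> (\<rho> g $$ (i, i)) else 0)"
    proof (rule sum_proots_monomial_mat[OF \<xi> \<rho>_closed])
      show "of_nat (ord g) \<noteq> (0::'k)" using True by simp
      show "\<rho> g ^\<^sub>m ord g = 1\<^sub>m n"
        using representation_pow[OF is_group representation_\<rho> g, of "ord g"] g \<rho>_one by simp
    qed (use g in \<open>auto simp: \<sigma>_less \<sigma>_funpow \<sigma>_one \<rho>_index\<close>)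
    also have "\<dots> = (\<Sum>i<n. if x i \<otimes>\<^bsub>G\<^esub> g \<otimes>\<^bsub>G\<^esub> inv\<^bsub>G\<^esub> (x i) \<in> T then \<xi> (\<mu> (x i \<otimes>\<^bsub>G\<^esub> g \<otimes>\<^bsub>G\<^esub> inv\<^bsub>G\<^esub> (x i))) else 0)"
    proof (rule sum.cong[OF refl])
      fix i assume "i \<in> {..<n}"
      then have i: "i < n" by simp
      show "(if \<sigma> g i = i then \<xi> (\<rho> g $$ (i, i)) else 0) =
        (if x i \<otimes>\<^bsub>G\<^esub> g \<otimes>\<^bsub>G\<^esub> inv\<^bsub>G\<^esub> (x i) \<in> T then \<xi> (\<mu> (x i \<otimes>\<^bsub>G\<^esub> g \<otimes>\<^bsub>G\<^esub> inv\<^bsub>G\<^esub> (x i))) else 0)"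
        using \<sigma>_iff[OF g i i] \<rho>_index[OF i i g] by (cases "\<sigma> g i = i") auto
    qed
    also have "\<dots> = (\<Sum>y\<in>carrier G. if y \<otimes>\<^bsub>G\<^esub> g \<otimes>\<^bsub>G\<^esub> inv\<^bsub>G\<^esub> y \<in> T then \<xi> (\<mu> (y \<otimes>\<^bsub>G\<^esub> g \<otimes>\<^bsub>G\<^esub> inv\<^bsub>G\<^esub> y)) else 0) / of_nat (card T)"
      using sum_conj_eq[OF fin g, of \<xi>] \<open>card T > 0\<close> by (simp add: field_simps)
    also have "\<dots> = induced_character G T (lin_char \<xi> G T \<mu>) g"
      using True g by (auto simp: induced_character_def lin_char_def ord_conj intro!: sum.cong arg_cong2[of _ _ _ _ "(/)"])
    finally show ?thesis .
  next
    case False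
    then show ?thesis
      by (auto simp: gen_char_def induced_character_def lin_char_def ord_conj intro!: sum.neutral)
  qed
qed

text \<open>A linear character of \<open>T\<close> is the monomial representation of
  \<open>T\<close> induced from \<open>T\<close> itself, of dimension 1. The general lemmas give
  irreducibility and the character, and induction from \<open>T\<close> to \<open>T\<close> changes
  nothing.\<close>

lemma lin_char_in_gen_Irr:
  fixes \<mu> :: "'a \<Rightarrow> 'k::alg_closed_field"
  assumes "group G" and TG: "subgroup T G" and fin: "finite (carrier G)" and \<xi>: "root_lift \<xi>"
    and \<mu>: "\<And>s t. s \<in> T \<Longrightarrow> t \<in> T \<Longrightarrow> \<mu> (s \<otimes>\<^bsub>G\<^esub> t) = \<mu> s * \<mu> t" "\<mu> \<one>\<^bsub>G\<^esub> = 1"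
  shows "lin_char \<xi> G T \<mu> \<in> gen_Irr \<xi> (G\<lparr>carrier := T\<rparr>)"
proof -
  interpret G: group G by fact
  let ?H = "G\<lparr>carrier := T\<rparr>"
  interpret H: group ?H using TG by (rule G.subgroup_imp_group)
  interpret monomial_rep ?H T \<mu> "\<lambda>_. \<one>\<^bsub>G\<^esub>" 1
    using \<mu> TG subgroup.mem_carrier[OF TG] subgroup.one_closed[OF TG] H.subgroup_self
    by unfold_locales (auto intro: subgroup.m_closed[OF TG] subgroup.m_inv_closed[OF TG])
  interpret irreducible_monomial_rep ?H T \<mu> "\<lambda>_. \<one>\<^bsub>G\<^esub>" 1 T
    using H.normal_self
    by (intro irreducible_monomial_rep.intro monomial_rep_axioms irreducible_monomial_rep_axioms.intro) auto
  have T0: "card T > 0" 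
    using finite_subset[OF subgroup.subset[OF TG] fin] subgroup.one_closed[OF TG] by (auto simp: card_gt_0_iff)
  have finH: "finite (carrier ?H)" using T0 by (simp add: card_gt_0_iff)
  have "gen_char \<xi> ?H \<rho> = induced_character ?H T (lin_char \<xi> ?H T \<mu>)"
    by (rule gen_char_monomial_rep[OF monomial_rep_axioms finH \<xi>])
  also have "\<dots> = lin_char \<xi> G T \<mu>"
  proof (rule ext)
    fix g
    have *: "lin_char \<xi> ?H T \<mu> (y \<otimes>\<^bsub>G\<^esub> g \<otimes>\<^bsub>G\<^esub> inv\<^bsub>?H\<^esub> y) = lin_char \<xi> G T \<mu> g" if "g \<in> T" "y \<in> T" for y
    proof -
      have inv: "inv\<^bsub>?H\<^esub> y = inv\<^bsub>G\<^esub> y" using G.m_inv_consistent[OF TG] that by simp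
      have yT: "y \<otimes>\<^bsub>G\<^esub> g \<in> T" "inv\<^bsub>G\<^esub> y \<in> T"
        using that TG by (auto intro: subgroup.m_closed subgroup.m_inv_closed)
      then have yg: "y \<otimes>\<^bsub>G\<^esub> g \<otimes>\<^bsub>G\<^esub> inv\<^bsub>?H\<^esub> y \<in> T"
        unfolding inv using TG by (auto intro: subgroup.m_closed)
      have "\<mu> (y \<otimes>\<^bsub>G\<^esub> g \<otimes>\<^bsub>G\<^esub> inv\<^bsub>?H\<^esub> y) = \<mu> g * (\<mu> y * \<mu> (inv\<^bsub>G\<^esub> y))"
        unfolding inv \<mu>(1)[OF yT] using \<mu>(1)[of y g] that by simp
      also have "\<mu> y * \<mu> (inv\<^bsub>G\<^esub> y) = 1"
        using \<mu>(1)[OF that(2) yT(2)] \<mu>(2) subgroup.mem_carrier[OF TG that(2)] by simp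
      finally have "\<mu> (y \<otimes>\<^bsub>G\<^esub> g \<otimes>\<^bsub>G\<^esub> inv\<^bsub>?H\<^esub> y) = \<mu> g" by simp
      moreover have "H.ord (y \<otimes>\<^bsub>G\<^esub> g \<otimes>\<^bsub>G\<^esub> inv\<^bsub>?H\<^esub> y) = G.ord g"
        using H.ord_conj[of g y] that G.ord_subgroup[OF TG, of g] by simp
      ultimately show ?thesis using yg that by (simp add: lin_char_def)
    qed
    have sum: "(\<Sum>y\<in>T. lin_char \<xi> ?H T \<mu> (y \<otimes>\<^bsub>G\<^esub> g \<otimes>\<^bsub>G\<^esub> inv\<^bsub>?H\<^esub> y)) = of_nat (card T) * lin_char \<xi> G T \<mu> g" if "g \<in> T"
      using *[OF that] by simp
    show "induced_character ?H T (lin_char \<xi> ?H T \<mu>) g = lin_char \<xi> G T \<mu> g"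
    proof (cases "g \<in> T")
      case True
      then show ?thesis
        using T0 sum by (simp add: induced_character_def)
    next
      case False
      then show ?thesis by (simp add: induced_character_def lin_char_def)
    qed
  qed
  finally have "lin_char \<xi> G T \<mu> = gen_char \<xi> ?H \<rho>" by (rule sym)
  then show ?thesis unfolding gen_Irr_def using irreducible_\<rho>
    by (intro CollectI exI[of _ 1] exI[of _ \<rho>] conjI)
qed

section \<open>Degrees and kernels read off from character values\<close>

lemma unit_complex_sum_eq_size:
  fixes f :: "'k \<Rightarrow> complex"
  assumes "\<And>a. a \<in># M \<Longrightarrow> norm (f a) = 1" "(\<Sum>a\<in>#M. f a) = of_nat (size M)"
  shows "a \<in># M \<Longrightarrow> f a = 1"
proof -
  \<comment> \<open>Each real part is at most 1, so a sum equal to the number of terms leaves no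
    slack; norm 1 and real part 1 then determine the value.\<close>
  have le: "Re (\<Sum>a\<in>#M. f a) \<le> size M \<and> (Re (\<Sum>a\<in>#M. f a) = size M \<longrightarrow> (\<forall>a\<in>#M. Re (f a) = 1))"
    if "\<And>a. a \<in># M \<Longrightarrow> norm (f a) = 1" for M
    using that
  proof (induction M)
    case (add b M)
    have "Re (f b) \<le> 1" using add.prems[of b] complex_Re_le_cmod[of "f b"] by simp
    then show ?case using add by fastforce
  qed auto
  assume a: "a \<in># M"
  then have "Re (f a) = 1" using le[of M] assms by auto
  moreover have "norm (f a) = 1" using a assms by simp
  ultimately show "f a = 1"
    by (metis Im_eq_0 abs_one complex_eq_iff one_complex.sel)
qed

lemma root_lift_root:
  assumes \<xi>: "root_lift \<xi>" and a: "a ^ m = 1" "m > 0"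
  shows "\<xi> a ^ m = 1"
proof -
  have "\<xi> (a ^ k) = \<xi> a ^ k" for k
  proof (induction k)
    case 0
    then show ?case using \<xi> by (simp add: root_lift_def)
  next
    case (Suc k)
    have "(a ^ k) ^ m = 1" using a by (metis power_mult mult.commute power_one)
    then show ?case using Suc root_lift_mult[OF \<xi> a] a by simp
  qed
  then show ?thesis using a \<xi> by (metis root_lift_def)
qed

text \<open>The lifts are roots of unity; if they add up to their number, each of them is 1.
  Injectivity of \<open>\<xi>\<close> then leaves 1 as the only eigenvalue, and
  \<open>finite_order_eq_one\<close> applies because \<open>m\<close> is nonzero in the field.
  Without this condition unipotent matrices would be counterexamples.\<close>

lemma sum_proots_eq_size_iff:
  fixes A :: "'k::alg_closed_field mat"
  assumes \<xi>: "root_lift \<xi>" and A: "A \<in> carrier_mat n n" and m: "A ^\<^sub>m m = 1\<^sub>m n" "of_nat m \<noteq> (0::'k)"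
  shows "(\<Sum>a\<in>#proots (char_poly A). \<xi> a) = of_nat n \<longleftrightarrow> A = 1\<^sub>m n"
proof -
  have m0: "m > 0" using m by (cases m) auto
  have cp: "char_poly A \<noteq> 0" "degree (char_poly A) = n" using degree_monic_char_poly[OF A] by auto
  have size: "size (proots (char_poly A)) = n" using proots_alg_closed(2)[OF cp(1)] cp by simp
  have mem: "a \<in># proots (char_poly A) \<longleftrightarrow> eigenvalue A a" for a
    using cp by (simp add: eigenvalue_root_char_poly[OF A])
  have am: "a ^ m = 1" if "eigenvalue A a" for a using eigenvalue_finite_order[OF A m(1) that] .
  show ?thesis
  proof
    assume *: "(\<Sum>a\<in>#proots (char_poly A). \<xi> a) = of_nat n"
    show "A = 1\<^sub>m n"
    proof (rule finite_order_eq_one[OF A m])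
      fix a assume a: "eigenvalue A a"
      have "\<xi> a = 1"
      proof (rule unit_complex_sum_eq_size[of "proots (char_poly A)"])
        fix b assume "b \<in># proots (char_poly A)"
        then have "\<xi> b ^ m = 1" using mem am root_lift_root[OF \<xi> _ m0] by blast
        then show "norm (\<xi> b) = 1" using m0
          by (metis norm_ge_zero norm_one norm_power power_eq_1_iff neq0_conv)
      qed (use * size mem a in auto)
      then have "\<xi> a = \<xi> 1" using \<xi> by (simp add: root_lift_def)
      then show "a = 1" using \<xi> am[OF a] m0 unfolding root_lift_def inj_on_def
        by (metis (mono_tags, lifting) mem_Collect_eq power_one)
    qed
  next
    assume A1: "A = 1\<^sub>m n"
    have "a = 1" if "eigenvalue A a" for a
      using eigenvalue_finite_order[OF A, of 1 a] that A1 by simp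
    then have "(\<Sum>a\<in>#proots (char_poly A). \<xi> a) = (\<Sum>a\<in>#proots (char_poly A). 1)"
      using mem \<xi> by (intro arg_cong[of _ _ sum_mset] image_mset_cong) (auto simp: root_lift_def)
    then show "(\<Sum>a\<in>#proots (char_poly A). \<xi> a) = of_nat n" using size by simp
  qed
qed

lemma gen_char_one:
  fixes \<rho> :: "'a \<Rightarrow> 'k::alg_closed_field mat"
  assumes "group G" "root_lift \<xi>" "representation G n \<rho>"
  shows "gen_char \<xi> G \<rho> \<one>\<^bsub>G\<^esub> = of_nat n"
proof -
  interpret group G by fact
  have "\<rho> \<one>\<^bsub>G\<^esub> = 1\<^sub>m n" using assms by (simp add: representation_iff)
  then show ?thesis using sum_proots_eq_size_iff[OF assms(2), of "\<rho> \<one>\<^bsub>G\<^esub>" n 1] by (simp add: gen_char_def)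
qed

text \<open>In characteristic \<open>p\<close> this describes only the regular elements of the
  kernel; \<open>irreducible_kernel_contains\<close> controls the others.\<close>

lemma regular_kernel_iff:
  fixes \<rho> :: "'a \<Rightarrow> 'k::alg_closed_field mat"
  assumes G: "group G" and "root_lift \<xi>" "representation G n \<rho>"
    and g: "g \<in> carrier G" "of_nat (group.ord G g) \<noteq> (0::'k)"
  shows "g \<in> rep_kernel G n \<rho> \<longleftrightarrow> gen_char \<xi> G \<rho> g = gen_char \<xi> G \<rho> \<one>\<^bsub>G\<^esub>"
proof -
  interpret group G by fact
  have "\<rho> g ^\<^sub>m ord g = \<rho> \<one>\<^bsub>G\<^esub>" using representation_pow[OF G assms(3) g(1), of "ord g"] g by simp
  also have "\<dots> = 1\<^sub>m n" using assms by (simp add: representation_iff)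
  finally have "(\<Sum>a\<in>#proots (char_poly (\<rho> g)). \<xi> a) = of_nat n \<longleftrightarrow> \<rho> g = 1\<^sub>m n"
    using assms g by (intro sum_proots_eq_size_iff) (auto simp: representation_iff)
  then show ?thesis using gen_char_one[OF assms(1-3)] g by (simp add: gen_char_def rep_kernel_iff)
qed

section \<open>Ordinary characters as sums of eigenvalues\<close>

lemma mat_trace_mult_commute:
  assumes "A \<in> carrier_mat n n" "B \<in> carrier_mat n n"
  shows "mat_trace (A * B) = mat_trace (B * A)"
proof -
  have "mat_trace (A * B) = (\<Sum>i<n. \<Sum>j<n. A $$ (i, j) * B $$ (j, i))"
    using assms by (simp add: mat_trace_def times_mat_def scalar_prod_def atLeast0LessThan)
  also have "\<dots> = (\<Sum>j<n. \<Sum>i<n. B $$ (j, i) * A $$ (i, j))"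
    by (subst sum.swap) (simp add: mult.commute)
  also have "\<dots> = mat_trace (B * A)"
    using assms by (simp add: mat_trace_def times_mat_def scalar_prod_def atLeast0LessThan)
  finally show ?thesis .
qed

text \<open>Trace and characteristic polynomial are invariant under similarity, and for the
  triangular matrix of a Schur decomposition both are read off the diagonal.\<close>

lemma mat_trace_eq_sum_proots:
  fixes A :: "complex mat"
  assumes A: "A \<in> carrier_mat n n"
  shows "mat_trace A = (\<Sum>a\<in>#proots (char_poly A). a)"
proof -
  obtain as where "char_poly A = (\<Prod>a\<leftarrow>as. [:- a, 1:])" using char_poly_factorized[OF A] by blast
  then obtain B where B: "B \<in> carrier_mat n n" "upper_triangular B" "similar_mat A B"
    using schur_decomposition_exists[OF A] by blast
  obtain k P Q where PQ: "{A, B, P, Q} \<subseteq> carrier_mat k k" "P * Q = 1\<^sub>m k" "Q * P = 1\<^sub>m k" "A = P * B * Q"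
    using similar_matD[OF B(3)] by blast
  then have c: "P \<in> carrier_mat k k" "B \<in> carrier_mat k k" "Q \<in> carrier_mat k k" by auto
  have "mat_trace A = mat_trace (Q * (P * B))"
    unfolding PQ(4) using c by (intro mat_trace_mult_commute[of _ k]) auto
  also have "Q * (P * B) = B"
    using c PQ(3) by (simp add: assoc_mult_mat[OF c(3) c(1) c(2), symmetric])
  finally have tr: "mat_trace A = mat_trace B" .
  have pl: "proots (\<Prod>a\<leftarrow>xs. [:- a, 1:]) = mset xs" for xs :: "complex list"
  proof (induction xs)
    case (Cons x xs)
    have "(\<Prod>a\<leftarrow>xs. [:- a, 1:]) \<noteq> 0" by (auto simp: prod_list_zero_iff)
    then have "proots ([:-x, 1:] * (\<Prod>a\<leftarrow>xs. [:- a, 1:])) = {#x#} + mset xs"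
      using Cons by (subst proots_mult) auto
    then show ?case by simp
  qed simp
  have "proots (char_poly A) = mset (diag_mat B)"
    using char_poly_upper_triangular[OF B(1,2)] char_poly_similar[OF B(3)] pl by simp
  then have "(\<Sum>a\<in>#proots (char_poly A). a) = sum_list (diag_mat B)"
    by (simp add: sum_mset_sum_list)
  also have "\<dots> = mat_trace B"
    by (simp add: mat_trace_def diag_mat_def interv_sum_list_conv_sum_set_nat atLeast0LessThan)
  finally show ?thesis using tr by simp
qed

lemma root_lift_id: "root_lift (\<lambda>z. z)"
  by (simp add: root_lift_def)

lemma character_eq_gen_char:
  assumes "group G" "finite (carrier G)" "representation G n \<rho>"
  shows "character G \<rho> = gen_char (\<lambda>z. z) G \<rho>"
proof
  fix g
  interpret group G by fact
  show "character G \<rho> g = gen_char (\<lambda>z. z) G \<rho> g"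
    using assms ord_ge_1[OF assms(2), of g] mat_trace_eq_sum_proots[of "\<rho> g" n]
    by (auto simp: character_def gen_char_def representation_iff)
qed

lemma Irr_eq_gen_Irr:
  assumes "group G" "finite (carrier G)"
  shows "Irr G = gen_Irr (\<lambda>z. z) G"
proof -
  have *: "character G \<rho> = gen_char (\<lambda>z. z) G \<rho>" if "irreducible_representation G n \<rho>" for n \<rho>
    using that character_eq_gen_char[OF assms] unfolding irreducible_representation_def by blast
  show ?thesis unfolding Irr_def gen_Irr_def
  proof (intro Set.equalityI subsetI)
    fix \<chi> assume "\<chi> \<in> {character G \<rho> | n \<rho>. irreducible_representation G n \<rho>}"
    then obtain n \<rho> where i: "irreducible_representation G n \<rho>" "\<chi> = character G \<rho>" by blast
    then show "\<chi> \<in> {gen_char (\<lambda>z. z) G \<rho> | n \<rho>. irreducible_representation G n \<rho>}"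
      unfolding *[OF i(1)] by blast
  next
    fix \<chi> assume "\<chi> \<in> {gen_char (\<lambda>z. z) G \<rho> | n \<rho>. irreducible_representation G n \<rho>}"
    then obtain n \<rho> where i: "irreducible_representation G n \<rho>" "\<chi> = gen_char (\<lambda>z. z) G \<rho>" by blast
    then show "\<chi> \<in> {character G \<rho> | n \<rho>. irreducible_representation G n \<rho>}"
      unfolding *[OF i(1), symmetric] by blast
  qed
qed

text \<open>Orders of elements are nonzero in characteristic 0, so by
  \<open>regular_kernel_iff\<close> the values determine the whole kernel, and every admissible
  choice in \<open>char_kernel\<close> is the same set.\<close>

lemma char_kernel_eq:
  assumes "group G" "finite (carrier G)" "representation G n \<rho>"
  shows "char_kernel G (character G \<rho>) = rep_kernel G n \<rho>"
proof -
  interpret group G by fact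
  have "rep_kernel G k \<tau> = rep_kernel G n \<rho>"
    if "representation G k \<tau>" "character G \<tau> = character G \<rho>" for k \<tau>
  proof -
    have eq: "gen_char (\<lambda>z. z) G \<tau> = gen_char (\<lambda>z. z) G \<rho>"
      using that character_eq_gen_char assms by metis
    have "g \<in> rep_kernel G k \<tau> \<longleftrightarrow> g \<in> rep_kernel G n \<rho>" if g: "g \<in> carrier G" for g
    proof -
      have "of_nat (ord g) \<noteq> (0::complex)" using ord_ge_1[OF assms(2) g] by simp
      then show ?thesis
        using regular_kernel_iff[OF assms(1) root_lift_id] that g \<open>representation G k \<tau>\<close> assms(3) eq by metis
    qed
    then show ?thesis by (auto simp: rep_kernel_iff)
  qed
  moreover have "\<exists>K n' \<tau>. representation G n' \<tau> \<and> character G \<tau> = character G \<rho> \<and> K = rep_kernel G n' \<tau>"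
    using assms by blast
  ultimately show ?thesis unfolding char_kernel_def by (intro some_equality) (use assms in blast)+
qed

section \<open>Kernels of irreducible Brauer characters\<close>

lemma (in group) subgroup_pow_closed:
  assumes "subgroup H G" "h \<in> H"
  shows "h [^] (k::nat) \<in> H"
  using assms by (induction k) (auto intro: subgroup.one_closed subgroup.m_closed)

text \<open>By the Frobenius map,
  \<open>(c - 1) ^ (CHAR('k) ^ e) = c ^ (CHAR('k) ^ e) - 1 = 0\<close>.\<close>

lemma root_of_unity_CHAR_power:
  fixes c :: "'k::field"
  assumes "prime CHAR('k)" "c ^ (CHAR('k) ^ e) = 1"
  shows "c = 1"
proof -
  have "((c - 1) + 1) ^ (CHAR('k) ^ e) = (c - 1) ^ (CHAR('k) ^ e) + 1 ^ (CHAR('k) ^ e)"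
    using assms(1) by (rule freshmans_dream') simp
  then have "(c - 1) ^ (CHAR('k) ^ e) = 0" using assms(2) by simp
  then show ?thesis by simp
qed

lemma rep_kernel_normal:
  assumes "group G" "representation G n (\<rho> :: 'a \<Rightarrow> 'k::field mat)"
  shows "rep_kernel G n \<rho> \<lhd> G"
proof -
  have "group_hom G (GL TYPE('k) n) \<rho>"
    using assms GL_group by (simp add: group_hom_def group_hom_axioms_def representation_def)
  then show ?thesis unfolding rep_kernel_def by (rule group_hom.normal_kernel)
qed

text \<open>Such an \<open>H\<close> lies in every term of the derived series of \<open>G\<close>,
  which reaches the trivial group.\<close>

lemma (in group) solvable_derived_eq_self:
  assumes "solvable G" "subgroup H G" "derived G H = H"
  shows "H = {\<one>}"
proof -
  obtain n where n: "(derived G ^^ n) (carrier G) = {\<one>}"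
    using assms(1) solvable_iff_trivial_derived_seq by blast
  have "(derived G ^^ n) H = H" using assms(3) by (induction n) auto
  then have "H \<subseteq> {\<one>}" using mono_exp_of_derived[OF subgroup.subset[OF assms(2)], of n] n by simp
  then show ?thesis using subgroup.one_closed[OF assms(2)] by blast
qed

text \<open>A smallest normal subgroup \<open>A \<subseteq> L\<close> outside the kernel acts by commuting matrices of \<open>p\<close>-power order. In
  characteristic \<open>p\<close> such matrices have a common nonzero fixed vector, and the fixed vectors of \<open>A\<close> form an
  invariant subspace.\<close>

lemma irreducible_kernel_contains:
  fixes \<rho> :: "'a \<Rightarrow> 'k::alg_closed_field mat"
  assumes "group G" and fin: "finite (carrier G)" and solv: "solvable G" and p: "prime CHAR('k)"
    and irr: "irreducible_representation G n \<rho>" and L: "L \<lhd> G"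
    and reg: "\<And>g. g \<in> L \<Longrightarrow> of_nat (group.ord G g) \<noteq> (0::'k) \<Longrightarrow> g \<in> rep_kernel G n \<rho>"
  shows "L \<subseteq> rep_kernel G n \<rho>"
proof (rule ccontr)
  interpret group G by fact
  let ?K = "rep_kernel G n \<rho>"
  assume "\<not> L \<subseteq> ?K"
  define P where "P A \<longleftrightarrow> A \<lhd> G \<and> A \<subseteq> L \<and> \<not> A \<subseteq> ?K" for A
  have "P L" using L \<open>\<not> L \<subseteq> ?K\<close> by (simp add: P_def)
  then obtain A where PA: "P A" and min: "\<And>B. P B \<Longrightarrow> card A \<le> card B"
    using ex_has_least_nat[of P L card] by blast
  have A: "A \<lhd> G" "A \<subseteq> L" "\<not> A \<subseteq> ?K" using PA by (auto simp: P_def)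
  interpret A: normal A G by (rule A)
  have n: "n > 0" and rep: "representation G n \<rho>"
    and sub: "\<And>W. VectorSpace.subspace class_ring W (module_vec TYPE('k) n) \<Longrightarrow>
      (\<And>g w. g \<in> carrier G \<Longrightarrow> w \<in> W \<Longrightarrow> \<rho> g *\<^sub>v w \<in> W) \<Longrightarrow> W = {0\<^sub>v n} \<or> W = carrier_vec n"
    using irr unfolding irreducible_representation_def by blast+
  have r: "\<And>g. g \<in> carrier G \<Longrightarrow> \<rho> g \<in> carrier_mat n n"
    "\<And>g h. g \<in> carrier G \<Longrightarrow> h \<in> carrier G \<Longrightarrow> \<rho> (g \<otimes>\<^bsub>G\<^esub> h) = \<rho> g * \<rho> h" "\<rho> \<one>\<^bsub>G\<^esub> = 1\<^sub>m n"
    using rep representation_iff[OF is_group] by blast+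
  have finA: "finite A" using finite_subset[OF A.subset fin] .
  \<comment> \<open>The derived subgroup of \<open>A\<close> is again normal in \<open>G\<close>. If
    it were not in the kernel, minimality would make it equal to \<open>A\<close>, which solvability
    excludes for nontrivial \<open>A\<close>.\<close>
  have der: "derived G A \<subseteq> ?K"
  proof (rule ccontr)
    assume no: "\<not> derived G A \<subseteq> ?K"
    have "derived G A \<subseteq> A" by (rule derived_incl[OF subset_refl A.subgroup_axioms])
    then have "card A \<le> card (derived G A)"
      using no A derived_is_normal[OF A(1)] by (intro min) (auto simp: P_def)
    then have "derived G A = A" using finA \<open>derived G A \<subseteq> A\<close> by (metis card_seteq)
    then have "A = {\<one>\<^bsub>G\<^esub>}" using solvable_derived_eq_self[OF solv A.subgroup_axioms] by simp
    then show False using A(3) r(3) by (auto simp: rep_kernel_iff)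
  qed
  have comm: "\<rho> a * \<rho> b = \<rho> b * \<rho> a" if "a \<in> A" "b \<in> A" for a b
  proof -
    have ab: "a \<in> carrier G" "b \<in> carrier G" using that A.mem_carrier by auto
    let ?c = "a \<otimes>\<^bsub>G\<^esub> b \<otimes>\<^bsub>G\<^esub> inv\<^bsub>G\<^esub> a \<otimes>\<^bsub>G\<^esub> inv\<^bsub>G\<^esub> b"
    have "?c \<in> derived G A" unfolding derived_def using that by (intro generate.incl) blast
    then have "\<rho> ?c = 1\<^sub>m n" using der by (auto simp: rep_kernel_iff)
    moreover have "?c = a \<otimes>\<^bsub>G\<^esub> b \<otimes>\<^bsub>G\<^esub> inv\<^bsub>G\<^esub> (b \<otimes>\<^bsub>G\<^esub> a)"
      using ab by (simp add: inv_mult_group m_assoc)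
    then have "a \<otimes>\<^bsub>G\<^esub> b = ?c \<otimes>\<^bsub>G\<^esub> (b \<otimes>\<^bsub>G\<^esub> a)"
      using ab m_assoc[of "a \<otimes>\<^bsub>G\<^esub> b" "inv\<^bsub>G\<^esub> (b \<otimes>\<^bsub>G\<^esub> a)" "b \<otimes>\<^bsub>G\<^esub> a"] by simp
    ultimately show ?thesis using ab r(1,2) by (metis inv_closed m_closed left_mult_one_mat)
  qed
  have ppow: "\<exists>e. \<rho> a ^\<^sub>m (CHAR('k) ^ e) = 1\<^sub>m n" if "a \<in> A" for a
  proof -
    have a: "a \<in> carrier G" "a \<in> L" using that A.mem_carrier A by auto
    have o: "ord a > 0" using ord_ge_1[OF fin a(1)] by simp
    \<comment> \<open>Raising \<open>a\<close> to the \<open>CHAR('k)\<close>-part of its order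
      leaves an element of order prime to the characteristic, which \<open>reg\<close> puts into the
      kernel.\<close>
    define e where "e = multiplicity CHAR('k) (ord a)"
    have pe: "CHAR('k) ^ e dvd ord a" "CHAR('k) ^ e \<noteq> 0"
      using p by (auto simp: e_def multiplicity_dvd)
    have "ord (a [^]\<^bsub>G\<^esub> (CHAR('k) ^ e)) = ord a div CHAR('k) ^ e" by (rule ord_pow[OF a(1) pe])
    moreover have "\<not> CHAR('k) dvd ord a div CHAR('k) ^ e"
      using p o unfolding e_def by (intro multiplicity_decompose) auto
    ultimately have "of_nat (ord (a [^]\<^bsub>G\<^esub> (CHAR('k) ^ e))) \<noteq> (0::'k)"
      by (simp add: of_nat_eq_0_iff_char_dvd)
    moreover have "a [^]\<^bsub>G\<^esub> (CHAR('k) ^ e) \<in> L"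
      using subgroup_pow_closed[OF normal_imp_subgroup[OF L] a(2)] .
    ultimately have "a [^]\<^bsub>G\<^esub> (CHAR('k) ^ e) \<in> ?K" by (intro reg)
    then show ?thesis using representation_pow[OF is_group rep a(1)] by (auto simp: rep_kernel_iff)
  qed
  have "\<exists>w\<in>carrier_vec n. w \<noteq> 0\<^sub>v n \<and> (\<forall>a\<in>A. \<exists>c. \<rho> a *\<^sub>v w = c \<cdot>\<^sub>v w)"
  proof (rule common_eigenvector[OF finA])
    show "\<exists>w\<in>carrier_vec n. w \<noteq> (0\<^sub>v n :: 'k vec)"
      using n by (intro bexI[of _ "unit_vec n 0"]) auto
    show "\<exists>m>0. \<rho> a ^\<^sub>m m = 1\<^sub>m n" if "a \<in> A" for a
      using ppow[OF that] p by (metis prime_gt_0_nat zero_less_power)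
    show "\<rho> a \<in> carrier_mat n n" if "a \<in> A" for a using that A.mem_carrier r by blast
    then show "\<rho> a *\<^sub>v u - c \<cdot>\<^sub>v u \<in> carrier_vec n" if "a \<in> A" "u \<in> carrier_vec n" for a u c
      using that by (metis minus_carrier_vec mult_mat_vec_carrier smult_carrier_vec)
  qed (use comm in auto)
  then obtain w where w: "w \<in> carrier_vec n" "w \<noteq> 0\<^sub>v n" "\<And>a. a \<in> A \<Longrightarrow> \<exists>c. \<rho> a *\<^sub>v w = c \<cdot>\<^sub>v w" by blast
  have fixed: "\<rho> a *\<^sub>v w = w" if "a \<in> A" for a
  proof -
    obtain c where c: "\<rho> a *\<^sub>v w = c \<cdot>\<^sub>v w" using w(3) \<open>a \<in> A\<close> by blast
    obtain e where e: "\<rho> a ^\<^sub>m (CHAR('k) ^ e) = 1\<^sub>m n" using ppow \<open>a \<in> A\<close> by blast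
    have am: "\<rho> a \<in> carrier_mat n n" using r A.mem_carrier that by blast
    then have "eigenvalue (\<rho> a) c" using c w unfolding eigenvalue_def eigenvector_def by auto
    then have "c = 1" using eigenvalue_finite_order[OF am e] root_of_unity_CHAR_power[OF p] by blast
    then show ?thesis using c by simp
  qed
  define W where "W = {v \<in> carrier_vec n. \<forall>a\<in>A. \<rho> a *\<^sub>v v = v}"
  have am: "\<rho> a \<in> carrier_mat n n" if "a \<in> A" for a using that A.mem_carrier r by blast
  have "W = {0\<^sub>v n} \<or> W = carrier_vec n"
  proof (rule sub)
    show "VectorSpace.subspace class_ring W (module_vec TYPE('k) n)"
      unfolding subspace_module_vec_iff W_def
      using mult_mat_vec[OF am] mult_add_distrib_mat_vec[OF am] mult_mat_zero_vec[OF am] by auto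
    fix g v assume g: "g \<in> carrier G" and v: "v \<in> W"
    have vc: "v \<in> carrier_vec n" using v by (simp add: W_def)
    have "\<rho> a *\<^sub>v (\<rho> g *\<^sub>v v) = \<rho> g *\<^sub>v v" if a: "a \<in> A" for a
    proof -
      let ?b = "inv\<^bsub>G\<^esub> g \<otimes>\<^bsub>G\<^esub> a \<otimes>\<^bsub>G\<^esub> g"
      have b: "?b \<in> A" using A.inv_op_closed1 g a by simp
      have aG: "a \<in> carrier G" and bG: "?b \<in> carrier G" using a b A.mem_carrier by auto
      have "a \<otimes>\<^bsub>G\<^esub> g = g \<otimes>\<^bsub>G\<^esub> ?b" using g aG by (simp add: m_assoc[symmetric])
      then have "\<rho> a * \<rho> g = \<rho> g * \<rho> ?b" using r(2) g aG bG by metis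
      then have "\<rho> a *\<^sub>v (\<rho> g *\<^sub>v v) = \<rho> g *\<^sub>v (\<rho> ?b *\<^sub>v v)"
        using r(1) g aG bG vc by (metis assoc_mult_mat_vec)
      then show ?thesis using v b by (simp add: W_def)
    qed
    then show "\<rho> g *\<^sub>v v \<in> W" using mult_mat_vec_carrier[OF r(1)[OF g] vc] by (simp add: W_def)
  qed
  moreover have "w \<in> W" using w fixed by (simp add: W_def)
  ultimately have WV: "W = carrier_vec n" using w by blast
  have "A \<subseteq> ?K"
  proof
    fix a assume a: "a \<in> A"
    have "\<rho> a *\<^sub>v v = v" if "v \<in> carrier_vec n" for v
    proof -
      have "v \<in> W" using that WV by simp
      then show ?thesis using a by (simp add: W_def)
    qed
    then show "a \<in> ?K" using mat_eq_one_iff[OF am[OF a]] A.mem_carrier[OF a] by (simp add: rep_kernel_iff)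
  qed
  then show False using A by blast
qed

lemma brauer_character_eq_gen_char:
  fixes \<rho> :: "'a \<Rightarrow> 'k::field mat"
  assumes "prime CHAR('k)"
  shows "brauer_character \<xi> G \<rho> = gen_char \<xi> G \<rho>"
proof -
  have "coprime m CHAR('k) \<longleftrightarrow> of_nat m \<noteq> (0::'k)" for m
    using assms by (metis coprime_absorb_left coprime_commute not_prime_unit of_nat_eq_0_iff_char_dvd prime_imp_coprime)
  then show ?thesis by (simp add: brauer_character_def gen_char_def)
qed

lemma IBr_eq_gen_Irr:
  fixes \<xi> :: "'k::field \<Rightarrow> complex"
  assumes "prime CHAR('k)"
  shows "IBr \<xi> G = gen_Irr \<xi> G"
  by (simp add: IBr_def gen_Irr_def brauer_character_eq_gen_char[OF assms])

text \<open>If two irreducible representations have the same Brauer character, the regular elements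
  of either kernel lie in the other. Applying \<open>irreducible_kernel_contains\<close> with each
  kernel in turn as \<open>L\<close> extends this to the whole kernels.\<close>

lemma brauer_kernel_eq:
  fixes \<rho> :: "'a \<Rightarrow> 'k::alg_closed_field mat"
  assumes G: "group G" "finite (carrier G)" "solvable G" and p: "prime CHAR('k)" and \<xi>: "root_lift \<xi>"
    and irr: "irreducible_representation G n \<rho>"
  shows "brauer_kernel \<xi> G (brauer_character \<xi> G \<rho>) = rep_kernel G n \<rho>"
proof -
  have le: "rep_kernel G k \<tau> \<subseteq> rep_kernel G l \<tau>'"
    if i: "irreducible_representation G k \<tau>" "irreducible_representation G l \<tau>'"
      and eq: "gen_char \<xi> G \<tau> = gen_char \<xi> G \<tau>'" for k \<tau> l \<tau>'
  proof (rule irreducible_kernel_contains[OF G p i(2)])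
    have r: "representation G k \<tau>" "representation G l \<tau>'"
      using i by (auto simp: irreducible_representation_def)
    show "rep_kernel G k \<tau> \<lhd> G" by (rule rep_kernel_normal[OF G(1) r(1)])
    fix g assume g: "g \<in> rep_kernel G k \<tau>" "of_nat (group.ord G g) \<noteq> (0::'k)"
    then have "g \<in> carrier G" by (simp add: rep_kernel_iff)
    then show "g \<in> rep_kernel G l \<tau>'"
      using g regular_kernel_iff[OF G(1) \<xi> r(1)] regular_kernel_iff[OF G(1) \<xi> r(2)] eq by metis
  qed
  show ?thesis unfolding brauer_kernel_def brauer_character_eq_gen_char[OF p]
  proof (rule some_equality)
    show "\<exists>n' \<tau>. irreducible_representation G n' \<tau> \<and> gen_char \<xi> G \<tau> = gen_char \<xi> G \<rho> \<and> rep_kernel G n \<rho> = rep_kernel G n' \<tau>"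
      using irr by blast
    fix K assume "\<exists>n' \<tau>. irreducible_representation G n' \<tau> \<and> gen_char \<xi> G \<tau> = gen_char \<xi> G \<rho> \<and> K = rep_kernel G n' \<tau>"
    then obtain k \<tau> where "irreducible_representation G k \<tau>" "gen_char \<xi> G \<tau> = gen_char \<xi> G \<rho>" "K = rep_kernel G k \<tau>"
      by blast
    then show "K = rep_kernel G n \<rho>" using le irr by (metis subset_antisym)
  qed
qed

text \<open>\<open>\<xi> 1\<close> is idempotent by multiplicativity and nonzero as a root of unity,
  hence 1.\<close>

lemma brauer_lift_imp_root_lift:
  assumes "brauer_lift (\<xi> :: 'k::field \<Rightarrow> complex)"
  shows "root_lift \<xi>"
proof -
  have b: "bij_betw \<xi> {x. \<exists>n>0. x ^ n = 1} {z. \<exists>n>0. coprime n CHAR('k) \<and> z ^ n = 1}"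
    and m: "\<And>x y. (\<exists>n>0. x ^ n = 1) \<Longrightarrow> (\<exists>n>0. y ^ n = 1) \<Longrightarrow> \<xi> (x * y) = \<xi> x * \<xi> y"
    using assms by (auto simp: brauer_lift_def)
  have one: "\<exists>n>0. (1::'k) ^ n = 1" by auto
  have "\<xi> 1 \<in> {z. \<exists>n>0. coprime n CHAR('k) \<and> z ^ n = 1}"
    using bij_betw_apply[OF b] one by blast
  then have "\<xi> 1 \<noteq> 0" by (auto simp: power_0_left)
  moreover have "\<xi> 1 = \<xi> 1 * \<xi> 1" using m[OF one one] by simp
  ultimately have "\<xi> 1 = 1" by simp
  then show ?thesis using b m by (auto simp: root_lift_def bij_betw_def)
qed

section \<open>Sylow subgroups and p-closed groups\<close>

lemma prime_power_natI:
  fixes m :: nat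
  assumes "prime p" "m > 0" "\<And>q. prime q \<Longrightarrow> q dvd m \<Longrightarrow> q = p"
  shows "\<exists>j. m = p ^ j"
proof -
  have p: "\<not> is_unit p" using assms(1) not_prime_unit by blast
  obtain r where r: "m = p ^ multiplicity p m * r" "\<not> p dvd r"
    using multiplicity_decompose'[of m p] assms(2) p by blast
  have "r = 1"
  proof (rule ccontr)
    assume "r \<noteq> 1"
    then obtain q where q: "prime q" "q dvd r" using prime_factor_nat by blast
    then have "q = p" using assms(3) r(1) by (metis dvd_mult)
    then show False using q r by simp
  qed
  then show ?thesis using r by (metis mult.right_neutral)
qed

lemma (in group) pow_coprime_eq_one:
  assumes "x \<in> carrier G" "x [^] (a::nat) = \<one>" "x [^] (b::nat) = \<one>" "coprime a b"
  shows "x = \<one>"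
proof -
  have "ord x dvd a" "ord x dvd b" using assms pow_eq_id by blast+
  then have "ord x = 1" using assms(4) by (metis coprime_common_divisor_nat One_nat_def)
  then show ?thesis using assms(1) ord_eq_1 by simp
qed

lemma (in group) subgroup_pow_card:
  assumes "subgroup H G" "finite H" "h \<in> H"
  shows "h [^] card H = \<one>"
proof -
  interpret H: group "G\<lparr>carrier := H\<rparr>" using assms(1) by (rule subgroup_imp_group)
  have "h [^]\<^bsub>G\<lparr>carrier := H\<rparr>\<^esub> Coset.order (G\<lparr>carrier := H\<rparr>) = \<one>"
    using H.pow_order_eq_1[of h] assms by simp
  then show ?thesis by (simp add: Coset.order_def nat_pow_consistent[symmetric])
qed

lemma (in group) Cauchy:
  assumes "finite (carrier G)" "prime q" "q dvd Coset.order G"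
  shows "\<exists>x\<in>carrier G. x \<noteq> \<one> \<and> x [^] q = \<one>"
proof -
  obtain m where "Coset.order G = q ^ 1 * m" using assms(3) by auto
  then obtain S where S: "subgroup S G" "card S = q"
    using sylow_thm[OF assms(2) is_group _ assms(1), of 1 m] by auto
  have "S \<noteq> {\<one>}" using S assms(2) by auto
  then obtain x where "x \<in> S" "x \<noteq> \<one>" using subgroup.one_closed[OF S(1)] by blast
  moreover have "finite S" using finite_subset[OF subgroup.subset[OF S(1)] assms(1)] .
  ultimately show ?thesis using subgroup_pow_card[OF S(1)] S subgroup.mem_carrier[OF S(1)] by blast
qed

lemma (in group) p_group_order:
  assumes fin: "finite (carrier G)" and p: "prime p"
    and pel: "\<And>x. x \<in> carrier G \<Longrightarrow> \<exists>k. x [^] (p ^ k :: nat) = \<one>"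
  shows "\<exists>j. Coset.order G = p ^ j"
proof (rule prime_power_natI[OF p])
  show "Coset.order G > 0" using fin by (simp add: order_gt_0_iff_finite)
  fix q :: nat assume q: "prime q" "q dvd Coset.order G"
  then obtain x where x: "x \<in> carrier G" "x \<noteq> \<one>" "x [^] q = \<one>" using Cauchy[OF fin] by blast
  obtain k where "x [^] (p ^ k) = \<one>" using pel x by blast
  then have "\<not> coprime q (p ^ k)" using pow_coprime_eq_one x by blast
  then show "q = p" using primes_coprime[OF q(1) p] by (metis coprime_power_right_iff)
qed

text \<open>Orbit lengths divide \<open>p ^ j\<close>; without a fixed point all of them would be
  divisible by \<open>p\<close>, and so would \<open>card E\<close>.\<close>

lemma (in group_action) exists_fixed_point:
  assumes p: "prime p" and card: "Coset.order G = p ^ j" and E: "finite E" "\<not> p dvd card E"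
  shows "\<exists>x\<in>E. \<forall>g\<in>carrier G. \<phi> g x = x"
proof (rule ccontr)
  assume no: "\<not> ?thesis"
  interpret partition E "orbits G E \<phi>" by (rule orbit_partition)
  have "p dvd card (\<Union>(orbits G E \<phi>))"
  proof (rule dvd_partition)
    show "finite (\<Union>(orbits G E \<phi>))" using E partition_coverture by simp
    show "\<forall>c1\<in>orbits G E \<phi>. \<forall>c2\<in>orbits G E \<phi>. c1 \<noteq> c2 \<longrightarrow> c1 \<inter> c2 = {}"
      using disjoint_union by blast
    show "\<forall>c\<in>orbits G E \<phi>. p dvd card c"
    proof
      fix c assume "c \<in> orbits G E \<phi>"
      then obtain x where x: "x \<in> E" "c = orbit G \<phi> x" by (auto simp: orbits_def)
      have "card c dvd p ^ j" using orbit_stabilizer_theorem[OF x(1)] card x(2) by (metis dvd_triv_left)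
      then obtain i where i: "card c = p ^ i" using p by (auto simp: divides_primepow_nat)
      have "i \<noteq> 0"
      proof
        assume "i = 0"
        then obtain y where y: "c = {y}" using i by (auto simp: card_1_singleton_iff)
        have "x \<in> c" using orbit_refl[OF x(1)] x(2) by simp
        then have "\<phi> g x = x" if "g \<in> carrier G" for g
          using that y x(2) unfolding orbit_def by blast
        then show False using no x(1) by blast
      qed
      then show "p dvd card c" using i by simp
    qed
  qed
  then show False using E partition_coverture by simp
qed

text \<open>The \<open>p\<close>-group \<open>Q\<close> acts by right multiplication on the cosets
  of \<open>P\<close>. Their number is prime to \<open>p\<close>, so some coset \<open>P r\<close>
  is fixed, and then \<open>r q\<close> lies in \<open>P r\<close> for all \<open>q\<close> in
  \<open>Q\<close>.\<close>

lemma (in group) sylow_containment: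
  assumes fin: "finite (carrier G)" and p: "prime p" and P: "subgroup P G" and Q: "subgroup Q G"
    and cQ: "card Q = p ^ j" and cP: "\<not> p dvd card (rcosets P)"
  shows "\<exists>r\<in>carrier G. \<forall>q\<in>Q. r \<otimes> q \<otimes> inv r \<in> P"
proof -
  let ?H = "G\<lparr>carrier := Q\<rparr>"
  let ?E = "rcosets P"
  \<comment> \<open>The inverse turns right multiplication into a left action.\<close>
  define \<phi> where "\<phi> q = (\<lambda>A\<in>?E. A #> inv q)" for q
  interpret H: group ?H using Q by (rule subgroup_imp_group)
  have QG: "q \<in> carrier G" if "q \<in> Q" for q using subgroup.mem_carrier[OF Q that] .
  have closed: "A #> g \<in> ?E" if "A \<in> ?E" "g \<in> carrier G" for A g
    using that P subgroup.subset[OF P] by (auto simp: RCOSETS_def coset_mult_assoc)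
  have sub: "A \<subseteq> carrier G" if "A \<in> ?E" for A
    using that subgroup.subset[OF P] r_coset_subset_G by (auto simp: RCOSETS_def)
  have mult: "A #> g #> h = A #> (g \<otimes> h)" if "A \<in> ?E" "g \<in> carrier G" "h \<in> carrier G" for A g h
    using that sub by (simp add: coset_mult_assoc)
  have "\<phi> q \<in> Bij ?E" if q: "q \<in> Q" for q
  proof -
    have "bij_betw (\<phi> q) ?E ?E"
    proof (rule bij_betw_byWitness[where f' = "\<lambda>A. A #> q"])
      show "\<forall>A\<in>?E. \<phi> q A #> q = A" using q QG mult sub by (simp add: \<phi>_def)
      show "\<forall>A\<in>?E. \<phi> q (A #> q) = A" using q QG mult sub closed by (simp add: \<phi>_def)
    qed (use closed q QG in \<open>auto simp: \<phi>_def\<close>)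
    then show ?thesis by (simp add: Bij_def \<phi>_def)
  qed
  moreover have "\<phi> (q \<otimes> r) = compose ?E (\<phi> q) (\<phi> r)" if "q \<in> Q" "r \<in> Q" for q r
    using that QG closed mult by (intro ext) (auto simp: \<phi>_def compose_def inv_mult_group)
  ultimately have "\<phi> \<in> hom ?H (BijGroup ?E)"
    by (auto simp: hom_def BijGroup_def)
  then interpret group_action ?H ?E \<phi>
    by (simp add: group_action_def group_hom_def group_hom_axioms_def group_BijGroup H.is_group)
  have "finite ?E" using fin by (simp add: RCOSETS_def)
  then obtain A where A: "A \<in> ?E" "\<And>q. q \<in> Q \<Longrightarrow> \<phi> q A = A"
    using exists_fixed_point[OF p, of j] cQ cP by (auto simp: Coset.order_def)
  obtain r where r: "r \<in> carrier G" "A = P #> r" using A(1) by (auto simp: RCOSETS_def)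
  have "r \<otimes> q \<otimes> inv r \<in> P" if q: "q \<in> Q" for q
  proof -
    have "inv q \<in> Q" using q Q by (simp add: subgroup.m_inv_closed)
    then have "P #> r #> q = P #> r" using A(2)[of "inv q"] A(1) r QG[OF q] by (simp add: \<phi>_def)
    then have "P #> (r \<otimes> q) = P #> r" using r QG[OF q] subgroup.subset[OF P] by (simp add: coset_mult_assoc)
    then have "r \<otimes> q \<in> P #> r" using rcos_self[of "r \<otimes> q" P] P r QG[OF q] by simp
    then obtain t where t: "t \<in> P" "r \<otimes> q = t \<otimes> r" by (auto simp: r_coset_def)
    then have "r \<otimes> q \<otimes> inv r = t" using r subgroup.mem_carrier[OF P] by (simp add: m_assoc)
    then show ?thesis using t by simp
  qed
  then show ?thesis using r by blast
qed

text \<open>For normal \<open>K\<close>: products of \<open>p\<close>-elements of \<open>G/K\<close> are \<open>p\<close>-elements, that is, \<open>G/K\<close> is \<open>p\<close>-closed.\<close>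

definition p_closed_mod :: "nat \<Rightarrow> 'a set \<Rightarrow> ('a, 'b) monoid_scheme \<Rightarrow> bool" where
  "p_closed_mod p K G \<longleftrightarrow> (\<forall>x\<in>carrier G. \<forall>y\<in>carrier G.
     (\<exists>k::nat. x [^]\<^bsub>G\<^esub> (p ^ k) \<in> K) \<longrightarrow> (\<exists>k::nat. y [^]\<^bsub>G\<^esub> (p ^ k) \<in> K) \<longrightarrow>
     (\<exists>k::nat. (x \<otimes>\<^bsub>G\<^esub> y) [^]\<^bsub>G\<^esub> (p ^ k) \<in> K))"

lemma (in group) p_elements_normal:
  assumes K: "K \<lhd> G" and cl: "p_closed_mod p K G"
  shows "{x \<in> carrier G. \<exists>k::nat. x [^] (p ^ k) \<in> K} \<lhd> G"
proof (rule normal_invI)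
  interpret K: normal K G by (rule K)
  let ?R = "{x \<in> carrier G. \<exists>k::nat. x [^] (p ^ k) \<in> K}"
  show "subgroup ?R G"
  proof (rule subgroupI)
    have "\<one> \<in> ?R" by (simp add: K.one_closed)
    then show "?R \<noteq> {}" by blast
    fix x assume x: "x \<in> ?R"
    then obtain k :: nat where "x \<in> carrier G" "x [^] (p ^ k) \<in> K" by blast
    then have "inv x \<in> carrier G" "inv x [^] (p ^ k) \<in> K" by (simp_all add: nat_pow_inv K.m_inv_closed)
    then show "inv x \<in> ?R" by blast
    fix y assume "y \<in> ?R"
    then show "x \<otimes> y \<in> ?R" using x cl unfolding p_closed_mod_def by blast
  qed auto
  fix x h assume xh: "x \<in> carrier G" "h \<in> ?R"
  then obtain k :: nat where k: "h \<in> carrier G" "h [^] (p ^ k) \<in> K" by blast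
  then have "(x \<otimes> h \<otimes> inv x) [^] (p ^ k) \<in> K" using xh K.inv_op_closed2 by (simp add: pow_conj)
  then show "x \<otimes> h \<otimes> inv x \<in> ?R" using xh k by blast
qed

text \<open>The \<open>p\<close>-elements form a normal subgroup. Its order is a power of
  \<open>p\<close> by Cauchy's theorem, and it is the full power because the subgroup contains a
  Sylow subgroup.\<close>

lemma (in group) p_closed_mod_one_imp_p_closed:
  assumes fin: "finite (carrier G)" and p: "prime p" and cl: "p_closed_mod p {\<one>} G"
  shows "p_closed p G"
proof -
  define P where "P = {x \<in> carrier G. \<exists>k::nat. x [^] (p ^ k) = \<one>}"
  have P: "P \<lhd> G" using p_elements_normal[OF one_is_normal cl] by (simp add: P_def)
  interpret P: normal P G by (rule P)
  have finP: "finite P" using finite_subset[OF P.subset fin] .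
  interpret H: group "G\<lparr>carrier := P\<rparr>" by (rule subgroup_imp_group[OF P.subgroup_axioms])
  have pel: "\<exists>k. x [^]\<^bsub>G\<lparr>carrier := P\<rparr>\<^esub> (p ^ k :: nat) = \<one>" if "x \<in> P" for x
  proof -
    obtain k :: nat where "x [^] (p ^ k) = \<one>" using \<open>x \<in> P\<close> unfolding P_def by blast
    then show ?thesis unfolding nat_pow_consistent[symmetric] by (rule exI)
  qed
  have "\<exists>j. Coset.order (G\<lparr>carrier := P\<rparr>) = p ^ j"
    by (rule H.p_group_order[OF _ p]) (use finP pel in simp_all)
  then obtain j where j: "card P = p ^ j" by (auto simp: Coset.order_def)
  have o: "Coset.order G > 0" using fin by (simp add: order_gt_0_iff_finite)
  obtain m where m: "Coset.order G = p ^ multiplicity p (Coset.order G) * m"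
    using multiplicity_dvd by blast
  obtain S where S: "subgroup S G" "card S = p ^ multiplicity p (Coset.order G)"
    using sylow_thm[OF p is_group m fin] by blast
  have finS: "finite S" using finite_subset[OF subgroup.subset[OF S(1)] fin] .
  have "S \<subseteq> P"
  proof
    fix s assume s: "s \<in> S"
    have "s [^] (p ^ multiplicity p (Coset.order G)) = \<one>"
      using subgroup_pow_card[OF S(1) finS s] unfolding S(2) by blast
    then show "s \<in> P" using subgroup.mem_carrier[OF S(1) s] unfolding P_def by blast
  qed
  then have "card S \<le> card P" by (rule card_mono[OF finP])
  then have "p ^ multiplicity p (Coset.order G) \<le> p ^ j" using S j by simp
  then have "multiplicity p (Coset.order G) \<le> j" using prime_gt_1_nat[OF p] by simp
  moreover have "p ^ j dvd Coset.order G"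
    using lagrange[OF P.subgroup_axioms] unfolding j by (metis dvd_triv_right)
  then have "j \<le> multiplicity p (Coset.order G)" using o p by (intro multiplicity_geI) auto
  ultimately have "j = multiplicity p (Coset.order G)" by (rule antisym[rotated])
  then have "card P = p ^ multiplicity p (Coset.order G)" using j by (simp only:)
  then show ?thesis unfolding p_closed_def using P by blast
qed

text \<open>Modulo the normal Sylow subgroup \<open>P\<close>, the order of a
  \<open>p\<close>-element divides both a power of \<open>p\<close> and the index of
  \<open>P\<close>, which is prime to \<open>p\<close>. So all \<open>p\<close>-elements lie in
  \<open>P\<close>, and conversely \<open>P\<close> consists of \<open>p\<close>-elements.\<close>

lemma (in group) p_closed_imp_p_closed_mod_one:
  assumes fin: "finite (carrier G)" and p: "prime p" and cl: "p_closed p G"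
  shows "p_closed_mod p {\<one>} G"
proof -
  obtain P where P: "P \<lhd> G" "card P = p ^ multiplicity p (Coset.order G)"
    using cl by (auto simp: p_closed_def)
  interpret P: normal P G by (rule P(1))
  have finP: "finite P" using finite_subset[OF P.subset fin] .
  have o: "Coset.order G > 0" using fin by (simp add: order_gt_0_iff_finite)
  let ?m = "card (rcosets P)"
  have om: "?m * p ^ multiplicity p (Coset.order G) = Coset.order G" using lagrange[OF P.subgroup_axioms] P(2) by simp
  have npm: "\<not> p dvd ?m"
  proof
    assume "p dvd ?m"
    then have "p ^ Suc (multiplicity p (Coset.order G)) dvd Coset.order G" using om by (metis mult_dvd_mono dvd_refl power_Suc)
    then have "Suc (multiplicity p (Coset.order G)) \<le> multiplicity p (Coset.order G)"
      using o p by (intro multiplicity_geI) auto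
    then show False by simp
  qed
  have mem: "x \<in> P" if x: "x \<in> carrier G" "x [^] (p ^ k :: nat) = \<one>" for x k
  proof -
    interpret F: group "G Mod P" by (rule P.factorgroup_is_group)
    have h: "(\<lambda>a. P #> a) \<in> hom G (G Mod P)" by (rule P.r_coset_hom_Mod)
    interpret h: group_hom G "G Mod P" "\<lambda>a. P #> a" by unfold_locales (rule h)
    have "P #> x \<in> carrier (G Mod P)" using x by (simp add: carrier_FactGroup)
    moreover have "Coset.order (G Mod P) = ?m" by (simp add: Coset.order_def FactGroup_def)
    ultimately have "(P #> x) [^]\<^bsub>G Mod P\<^esub> ?m = \<one>\<^bsub>G Mod P\<^esub>" using F.pow_order_eq_1 by metis
    moreover have "(P #> x) [^]\<^bsub>G Mod P\<^esub> (p ^ k) = \<one>\<^bsub>G Mod P\<^esub>"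
      using h.hom_nat_pow[of x "p ^ k"] x P.subset by simp
    moreover have "coprime ?m (p ^ k)" using p npm by (simp add: prime_imp_coprime coprime_commute)
    ultimately have "P #> x = P" using F.pow_coprime_eq_one[of "P #> x"] x by (simp add: carrier_FactGroup)
    then show ?thesis using coset_join1[OF _ x(1) P.subgroup_axioms] by simp
  qed
  show ?thesis unfolding p_closed_mod_def
  proof (intro ballI impI)
    fix x y assume xy: "x \<in> carrier G" "y \<in> carrier G" "\<exists>k::nat. x [^] (p ^ k) \<in> {\<one>}" "\<exists>k::nat. y [^] (p ^ k) \<in> {\<one>}"
    then have "x \<otimes> y \<in> P" using mem by blast
    then have "(x \<otimes> y) [^] (p ^ multiplicity p (Coset.order G)) = \<one>"
      using subgroup_pow_card[OF P.subgroup_axioms finP] P(2) by simp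
    then show "\<exists>k::nat. (x \<otimes> y) [^] (p ^ k) \<in> {\<one>}" by blast
  qed
qed

section \<open>Minimal solvable groups that are not p-closed\<close>

text \<open>The character is read off from a common eigenvector in the regular representation, chosen in the
  eigenspace of \<open>x\<close> for an eigenvalue other than 1.\<close>

lemma (in group) exists_nontrivial_linear:
  assumes fin: "finite (carrier G)" and comm: "\<And>a b. a \<in> carrier G \<Longrightarrow> b \<in> carrier G \<Longrightarrow> a \<otimes> b = b \<otimes> a"
    and char: "of_nat (Coset.order G) \<noteq> (0::'k::alg_closed_field)"
    and x: "x \<in> carrier G" "x \<noteq> \<one>"
  shows "\<exists>\<mu>::'a \<Rightarrow> 'k. (\<forall>a\<in>carrier G. \<forall>b\<in>carrier G. \<mu> (a \<otimes> b) = \<mu> a * \<mu> b) \<and> \<mu> \<one> = 1 \<and> \<mu> x \<noteq> 1"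
proof -
  obtain y n where y: "\<forall>i<n. y i \<in> carrier G" "\<forall>g\<in>carrier G. \<exists>!i::nat. i < n \<and> y i \<otimes> g \<in> {\<one>}"
    using exists_transversal[OF triv_subgroup fin] by blast
  \<comment> \<open>Induction of the trivial character from the trivial subgroup is the regular
    representation; \<open>x\<close> does not act as the identity because it moves a point.\<close>
  interpret M: monomial_rep G "{\<one>}" "\<lambda>_. 1::'k" y n
  proof unfold_locales
    show "\<exists>!i. i < n \<and> y i \<otimes> g \<in> {\<one>}" if "g \<in> carrier G" for g using y(2) that by (rule bspec)
    show "y i \<in> carrier G" if "i < n" for i using y(1) that by blast
  qed (simp_all add: triv_subgroup)
  have r: "M.\<rho> (a \<otimes> b) = M.\<rho> a * M.\<rho> b" if "a \<in> carrier G" "b \<in> carrier G" for a b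
    using M.\<rho>_mult that .
  have xo: "M.\<rho> x ^\<^sub>m ord x = 1\<^sub>m n"
    using representation_pow[OF is_group M.representation_\<rho> x(1), of "ord x"] x(1) M.\<rho>_one by simp
  have ox: "of_nat (ord x) \<noteq> (0::'k)"
    using ord_dvd_group_order[OF x(1)] char by (metis dvdE mult_zero_left of_nat_mult)
  have "M.\<rho> x \<noteq> 1\<^sub>m n"
  proof
    assume "M.\<rho> x = 1\<^sub>m n"
    then have "M.\<rho> x $$ (0, 0) \<noteq> 0" using M.n_pos by simp
    then have "0 = M.\<sigma> x 0" using M.\<rho>_index[of 0 0 x] M.n_pos x by (simp split: if_splits)
    then have e: "y 0 \<otimes> x \<otimes> inv (y 0) = \<one>" using M.\<sigma>_iff[OF x(1), of 0 0] M.n_pos by simp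
    have y0: "y 0 \<in> carrier G" using y M.n_pos by blast
    have "y 0 \<otimes> x = y 0" using e y0 x inv_solve_right[of \<one> "y 0 \<otimes> x" "y 0"] by simp
    then show False using y0 x by (metis l_cancel_one' r_cancel_one)
  qed
  \<comment> \<open>The order of \<open>x\<close> is nonzero in the field, so if 1 were the only
    eigenvalue the matrix would be the identity.\<close>
  then obtain a where a: "eigenvalue (M.\<rho> x) a" "a \<noteq> 1"
    using finite_order_eq_one[OF M.\<rho>_closed xo ox] by blast
  define W where "W = {v \<in> carrier_vec n. M.\<rho> x *\<^sub>v v = a \<cdot>\<^sub>v v}"
  have "\<exists>w\<in>W. w \<noteq> 0\<^sub>v n \<and> (\<forall>g\<in>carrier G. \<exists>c. M.\<rho> g *\<^sub>v w = c \<cdot>\<^sub>v w)"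
  proof (rule common_eigenvector[OF fin])
    show "W \<subseteq> carrier_vec n" by (auto simp: W_def)
    show "\<exists>w\<in>W. w \<noteq> 0\<^sub>v n" using a by (auto simp: W_def eigenvalue_def eigenvector_def M.\<rho>_def)
    show "M.\<rho> g \<in> carrier_mat n n" for g by (rule M.\<rho>_closed)
    show "M.\<rho> g * M.\<rho> h = M.\<rho> h * M.\<rho> g" if "g \<in> carrier G" "h \<in> carrier G" for g h
      using comm r that by metis
    show "\<exists>m>0. M.\<rho> g ^\<^sub>m m = 1\<^sub>m n" if "g \<in> carrier G" for g
      using representation_pow[OF is_group M.representation_\<rho> that, of "ord g"] that M.\<rho>_one ord_ge_1[OF fin that]
      by (intro exI[of _ "ord g"]) simp
    show "M.\<rho> g *\<^sub>v u - c \<cdot>\<^sub>v u \<in> W" if g: "g \<in> carrier G" and u: "u \<in> W" for g u c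
    proof -
      have uc: "u \<in> carrier_vec n" "M.\<rho> x *\<^sub>v u = a \<cdot>\<^sub>v u" using u by (auto simp: W_def)
      have gu: "M.\<rho> g *\<^sub>v u \<in> carrier_vec n" by (rule mult_mat_vec_carrier[OF M.\<rho>_closed uc(1)])
      have "M.\<rho> x *\<^sub>v (M.\<rho> g *\<^sub>v u) = M.\<rho> (x \<otimes> g) *\<^sub>v u"
        unfolding r[OF x(1) g] by (rule assoc_mult_mat_vec[OF M.\<rho>_closed M.\<rho>_closed uc(1), symmetric])
      also have "\<dots> = M.\<rho> g *\<^sub>v (M.\<rho> x *\<^sub>v u)"
        unfolding comm[OF x(1) g] r[OF g x(1)] by (rule assoc_mult_mat_vec[OF M.\<rho>_closed M.\<rho>_closed uc(1)])
      also have "\<dots> = a \<cdot>\<^sub>v (M.\<rho> g *\<^sub>v u)" unfolding uc(2) by (rule mult_mat_vec[OF M.\<rho>_closed uc(1)])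
      finally have 1: "M.\<rho> x *\<^sub>v (M.\<rho> g *\<^sub>v u) = a \<cdot>\<^sub>v (M.\<rho> g *\<^sub>v u)" .
      have cu: "c \<cdot>\<^sub>v u \<in> carrier_vec n" using uc by simp
      have "M.\<rho> x *\<^sub>v (M.\<rho> g *\<^sub>v u - c \<cdot>\<^sub>v u) = M.\<rho> x *\<^sub>v (M.\<rho> g *\<^sub>v u) - M.\<rho> x *\<^sub>v (c \<cdot>\<^sub>v u)"
        by (rule mult_minus_distrib_mat_vec[OF M.\<rho>_closed gu cu])
      also have "M.\<rho> x *\<^sub>v (c \<cdot>\<^sub>v u) = c \<cdot>\<^sub>v (a \<cdot>\<^sub>v u)"
        unfolding mult_mat_vec[OF M.\<rho>_closed uc(1)] uc(2) ..
      also have "M.\<rho> x *\<^sub>v (M.\<rho> g *\<^sub>v u) - c \<cdot>\<^sub>v (a \<cdot>\<^sub>v u) = a \<cdot>\<^sub>v (M.\<rho> g *\<^sub>v u - c \<cdot>\<^sub>v u)"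
        unfolding 1 using gu uc(1) by (intro eq_vecI) (auto simp: algebra_simps carrier_matD(1)[OF M.\<rho>_closed])
      finally show ?thesis using gu cu by (simp add: W_def)
    qed
  qed
  then obtain w where w: "w \<in> carrier_vec n" "w \<noteq> 0\<^sub>v n" "M.\<rho> x *\<^sub>v w = a \<cdot>\<^sub>v w"
    "\<And>g. g \<in> carrier G \<Longrightarrow> \<exists>c. M.\<rho> g *\<^sub>v w = c \<cdot>\<^sub>v w"
    unfolding W_def by blast
  obtain i where i: "i < n" "w $ i \<noteq> 0"
    using w(1,2) by (metis carrier_vecD eq_vecI index_zero_vec(1) index_zero_vec(2))
  have inj: "c = d" if "c \<cdot>\<^sub>v w = d \<cdot>\<^sub>v w" for c d
    using that i w(1) by (metis carrier_vecD index_smult_vec(1) mult_cancel_right)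
  define \<mu> where "\<mu> g = (SOME c. M.\<rho> g *\<^sub>v w = c \<cdot>\<^sub>v w)" for g
  have \<mu>: "M.\<rho> g *\<^sub>v w = \<mu> g \<cdot>\<^sub>v w" if "g \<in> carrier G" for g
    unfolding \<mu>_def using w(4)[OF that] by (rule someI_ex)
  have "\<mu> (g \<otimes> h) = \<mu> g * \<mu> h" if g: "g \<in> carrier G" and h: "h \<in> carrier G" for g h
  proof (rule inj)
    have "\<mu> (g \<otimes> h) \<cdot>\<^sub>v w = M.\<rho> g *\<^sub>v (M.\<rho> h *\<^sub>v w)"
      using \<mu>[of "g \<otimes> h"] g h r[OF g h] assoc_mult_mat_vec[OF M.\<rho>_closed M.\<rho>_closed w(1)] by simp
    also have "\<dots> = \<mu> h \<cdot>\<^sub>v (\<mu> g \<cdot>\<^sub>v w)"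
      unfolding \<mu>[OF h] mult_mat_vec[OF M.\<rho>_closed w(1)] \<mu>[OF g] ..
    finally show "\<mu> (g \<otimes> h) \<cdot>\<^sub>v w = (\<mu> g * \<mu> h) \<cdot>\<^sub>v w" by (simp add: smult_smult_assoc mult.commute)
  qed
  moreover have "\<mu> \<one> = 1" using \<mu>[of \<one>] M.\<rho>_one w(1) by (intro inj) simp
  moreover have "\<mu> x = a" using \<mu>[OF x(1)] w(3) by (intro inj) simp
  ultimately show ?thesis using a by blast
qed

text \<open>\<open>G\<close> stands for the quotient \<open>B\<close>. Its own quotients are
  expressed through \<open>p_closed_mod\<close>, elementwise in one group, which avoids cosets of
  cosets.\<close>

locale minimal_non_p_closed = group +
  fixes p :: nat
  assumes fin: "finite (carrier G)" and solv: "solvable G" and p: "prime p"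
    and not_closed: "\<not> p_closed_mod p {\<one>} G"
    and quot_closed: "\<And>M. M \<lhd> G \<Longrightarrow> M \<noteq> {\<one>} \<Longrightarrow> p_closed_mod p M G"
begin

text \<open>In an abelian group a product of \<open>p\<close>-elements is a
  \<open>p\<close>-element; adding the two exponents gives a common one.\<close>

lemma not_comm: "\<exists>x\<in>carrier G. \<exists>y\<in>carrier G. x \<otimes> y \<noteq> y \<otimes> x"
proof (rule ccontr)
  assume "\<not> ?thesis"
  then have comm: "x \<otimes> y = y \<otimes> x" if "x \<in> carrier G" "y \<in> carrier G" for x y using that by blast
  have "p_closed_mod p {\<one>} G" unfolding p_closed_mod_def
  proof (intro ballI impI)
    fix x y assume xy: "x \<in> carrier G" "y \<in> carrier G"
    assume "\<exists>k::nat. x [^] (p ^ k) \<in> {\<one>}" "\<exists>k::nat. y [^] (p ^ k) \<in> {\<one>}"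
    then obtain k l :: nat where kl: "x [^] (p ^ k) = \<one>" "y [^] (p ^ l) = \<one>" by blast
    have "x [^] (p ^ (k + l)) = (x [^] (p ^ k)) [^] (p ^ l)" "y [^] (p ^ (k + l)) = (y [^] (p ^ l)) [^] (p ^ k)"
      using xy by (simp_all add: nat_pow_pow power_add mult.commute)
    then have "(x \<otimes> y) [^] (p ^ (k + l)) = \<one>"
      using pow_mult_distrib[OF comm[OF xy] xy] kl by simp
    then show "\<exists>k::nat. (x \<otimes> y) [^] (p ^ k) \<in> {\<one>}" by blast
  qed
  then show False using not_closed by simp
qed

lemma exists_minimal_normal: "\<exists>N. minimal_normal N G"
proof -
  define P where "P M \<longleftrightarrow> M \<lhd> G \<and> M \<noteq> {\<one>}" for M
  have "carrier G \<noteq> {\<one>}"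
  proof
    assume "carrier G = {\<one>}"
    then show False using not_comm by auto
  qed
  then have "P (carrier G)" using normal_self by (simp add: P_def)
  then obtain N where N: "P N" "\<And>M. P M \<Longrightarrow> card N \<le> card M"
    using ex_has_least_nat[of P "carrier G" card] by blast
  have "N \<lhd> G" using N by (simp add: P_def)
  then have finN: "finite N" using finite_subset[OF subgroup.subset[OF normal_imp_subgroup] fin] by blast
  have "M = {\<one>} \<or> M = N" if "M \<lhd> G" "M \<subseteq> N" for M
    using N(2)[of M] that finN by (metis P_def card_seteq)
  moreover have "N \<noteq> {\<one>}" using N by (simp add: P_def)
  ultimately show ?thesis unfolding minimal_normal_def using \<open>N \<lhd> G\<close> by blast
qed

end

locale minimal_normal_non_p_closed = minimal_non_p_closed +
  fixes N assumes N: "minimal_normal N G"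
begin

lemma N_normal: "N \<lhd> G" and N_nontriv: "N \<noteq> {\<one>}"
  and N_min: "M \<lhd> G \<Longrightarrow> M \<subseteq> N \<Longrightarrow> M = {\<one>} \<or> M = N"
  using N unfolding minimal_normal_def by blast+

lemma N_subgroup: "subgroup N G"
  using N_normal by (rule normal_imp_subgroup)

lemma N_carrier: "u \<in> N \<Longrightarrow> u \<in> carrier G"
  using subgroup.mem_carrier[OF N_subgroup] .

lemma N_conj: "g \<in> carrier G \<Longrightarrow> u \<in> N \<Longrightarrow> g \<otimes> u \<otimes> inv g \<in> N"
  using normal.inv_op_closed2[OF N_normal] .

lemma N_finite: "finite N"
  using finite_subset[OF subgroup.subset[OF N_subgroup] fin] .

text \<open>If \<open>N\<close> is not contained in \<open>M\<close>, then
  \<open>M \<inter> N\<close> is trivial and \<open>G\<close> embeds into the product of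
  \<open>G/M\<close> and \<open>G/N\<close>. A product of \<open>p\<close>-elements is a
  \<open>p\<close>-element modulo \<open>M\<close> and modulo \<open>N\<close>, hence in
  \<open>G\<close>.\<close>

lemma N_least: "M \<lhd> G \<Longrightarrow> M \<noteq> {\<one>} \<Longrightarrow> N \<subseteq> M"
proof (rule ccontr)
  assume M: "M \<lhd> G" "M \<noteq> {\<one>}" and no: "\<not> N \<subseteq> M"
  have i: "M \<inter> N \<lhd> G" by (rule normal_subgroup_intersect[OF M(1) N_normal])
  then have triv: "M \<inter> N = {\<one>}" using N_min[OF i] no by blast
  have "p_closed_mod p {\<one>} G" unfolding p_closed_mod_def
  proof (intro ballI impI)
    fix x y assume xy: "x \<in> carrier G" "y \<in> carrier G"
      and *: "\<exists>k::nat. x [^] (p ^ k) \<in> {\<one>}" "\<exists>k::nat. y [^] (p ^ k) \<in> {\<one>}"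
    have one: "\<one> \<in> M" "\<one> \<in> N" using triv by blast+
    have "\<exists>k::nat. x [^] (p ^ k) \<in> M" "\<exists>k::nat. y [^] (p ^ k) \<in> M"
      "\<exists>k::nat. x [^] (p ^ k) \<in> N" "\<exists>k::nat. y [^] (p ^ k) \<in> N" using * one by (metis singletonD)+
    then obtain a b :: nat where ab: "(x \<otimes> y) [^] (p ^ a) \<in> M" "(x \<otimes> y) [^] (p ^ b) \<in> N"
      using quot_closed[OF M] quot_closed[OF N_normal N_nontriv] xy unfolding p_closed_mod_def by blast
    have e: "(x \<otimes> y) [^] (p ^ (a + b)) = ((x \<otimes> y) [^] (p ^ a)) [^] (p ^ b)"
      "(x \<otimes> y) [^] (p ^ (a + b)) = ((x \<otimes> y) [^] (p ^ b)) [^] (p ^ a)"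
      using xy by (simp_all add: nat_pow_pow power_add mult.commute)
    have "(x \<otimes> y) [^] (p ^ (a + b)) \<in> M"
      unfolding e(1) by (rule subgroup_pow_closed[OF normal_imp_subgroup[OF M(1)] ab(1)])
    moreover have "(x \<otimes> y) [^] (p ^ (a + b)) \<in> N"
      unfolding e(2) by (rule subgroup_pow_closed[OF N_subgroup ab(2)])
    ultimately have "(x \<otimes> y) [^] (p ^ (a + b)) \<in> M \<inter> N" by (rule IntI)
    then show "\<exists>k::nat. (x \<otimes> y) [^] (p ^ k) \<in> {\<one>}" unfolding triv by blast
  qed
  then show False using not_closed by simp
qed

text \<open>The derived subgroup of \<open>N\<close> is normal in \<open>G\<close> and, by
  solvability, not all of \<open>N\<close>; minimality makes it trivial.\<close>

lemma N_comm: "a \<in> N \<Longrightarrow> b \<in> N \<Longrightarrow> a \<otimes> b = b \<otimes> a"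
proof -
  assume ab: "a \<in> N" "b \<in> N"
  have "derived G N \<subseteq> N" by (rule derived_incl[OF subset_refl N_subgroup])
  then have "derived G N = {\<one>} \<or> derived G N = N"
    by (rule N_min[OF derived_is_normal[OF N_normal]])
  then have d: "derived G N = {\<one>}" using solvable_derived_eq_self[OF solv N_subgroup] N_nontriv by blast
  have abG: "a \<in> carrier G" "b \<in> carrier G" using ab N_carrier by auto
  have "a \<otimes> b \<otimes> inv a \<otimes> inv b \<in> derived G N"
    unfolding derived_def using ab by (intro generate.incl) blast
  then have "a \<otimes> b \<otimes> inv a \<otimes> inv b = \<one>" using d by simp
  moreover have "a \<otimes> b \<otimes> inv a \<otimes> inv b = (a \<otimes> b) \<otimes> inv (b \<otimes> a)"
    using abG by (simp add: inv_mult_group m_assoc)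
  ultimately have "inv (b \<otimes> a) = inv (a \<otimes> b)" using abG by (metis inv_equality inv_comm m_closed inv_closed)
  then show "a \<otimes> b = b \<otimes> a" using abG by (metis inv_inv m_closed)
qed

text \<open>As \<open>N\<close> is abelian, its elements with \<open>u [^] p = \<one>\<close> form a
  normal subgroup of \<open>G\<close>; if nontrivial, it is all of \<open>N\<close>. Then every
  \<open>p\<close>-element modulo \<open>N\<close> is a \<open>p\<close>-element of
  \<open>G\<close>, so \<open>p\<close>-closure of \<open>G/N\<close> lifts to
  \<open>G\<close>.\<close>

lemma N_no_p_torsion:
  assumes "u \<in> N" "u [^] p = \<one>"
  shows "u = \<one>"
proof (rule ccontr)
  assume "u \<noteq> \<one>"
  let ?O = "{u \<in> N. u [^] p = \<one>}"
  have "?O \<lhd> G"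
  proof (rule normal_invI)
    show "subgroup ?O G"
    proof (rule subgroupI)
      show "?O \<subseteq> carrier G" using N_carrier by blast
      show "?O \<noteq> {}" using assms by blast
      fix a assume a: "a \<in> ?O"
      then show "inv a \<in> ?O" using N_carrier[of a] N_subgroup by (simp add: nat_pow_inv subgroup.m_inv_closed)
      fix b assume b: "b \<in> ?O"
      then have "(a \<otimes> b) [^] p = a [^] p \<otimes> b [^] p"
        using a N_comm N_carrier by (intro pow_mult_distrib) auto
      then show "a \<otimes> b \<in> ?O" using a b N_subgroup by (simp add: subgroup.m_closed)
    qed
    fix g h assume "g \<in> carrier G" "h \<in> ?O"
    then show "g \<otimes> h \<otimes> inv g \<in> ?O" using N_conj N_carrier[of h] by (simp add: pow_conj)
  qed
  moreover have "?O \<noteq> {\<one>}" using assms \<open>u \<noteq> \<one>\<close> by blast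
  ultimately have O: "?O = N" using N_min[of ?O] by blast
  have "p_closed_mod p {\<one>} G" unfolding p_closed_mod_def
  proof (intro ballI impI)
    fix x y assume xy: "x \<in> carrier G" "y \<in> carrier G"
      and *: "\<exists>k::nat. x [^] (p ^ k) \<in> {\<one>}" "\<exists>k::nat. y [^] (p ^ k) \<in> {\<one>}"
    have "\<one> \<in> N" using N_subgroup by (rule subgroup.one_closed)
    then have "\<exists>k::nat. x [^] (p ^ k) \<in> N" "\<exists>k::nat. y [^] (p ^ k) \<in> N" using * by (metis singletonD)+
    then obtain k :: nat where "(x \<otimes> y) [^] (p ^ k) \<in> N"
      using quot_closed[OF N_normal N_nontriv] xy unfolding p_closed_mod_def by blast
    then have "((x \<otimes> y) [^] (p ^ k)) [^] p = \<one>" using O by blast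
    then have "(x \<otimes> y) [^] (p ^ Suc k) = \<one>" using xy by (simp add: nat_pow_pow mult.commute)
    then show "\<exists>k::nat. (x \<otimes> y) [^] (p ^ k) \<in> {\<one>}" by blast
  qed
  then show False using not_closed by simp
qed

lemma p_not_dvd_card_N: "\<not> p dvd card N"
proof
  assume d: "p dvd card N"
  interpret S: group "G\<lparr>carrier := N\<rparr>" using N_subgroup by (rule subgroup_imp_group)
  obtain x where x: "x \<in> N" "x \<noteq> \<one>" "x [^]\<^bsub>G\<lparr>carrier := N\<rparr>\<^esub> p = \<one>"
    using S.Cauchy[of p] d N_finite p by (auto simp: Coset.order_def)
  then have "x [^] p = \<one>" unfolding nat_pow_consistent[symmetric] by blast
  then show False using N_no_p_torsion x by blast
qed

lemma card_N_gt_1: "card N > 1"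
proof -
  have "\<one> \<in> N" using N_subgroup by (rule subgroup.one_closed)
  then obtain u where u: "u \<in> N" "u \<noteq> \<one>" using N_nontriv by blast
  then have "card {u, \<one>} \<le> card N" using \<open>\<one> \<in> N\<close> N_finite by (intro card_mono) auto
  then show ?thesis using u by simp
qed

end

section \<open>Conjugates and normalizers of finite subgroups\<close>

lemma (in group) subgroup_card_dvd:
  assumes "subgroup A G" "subgroup B G" "A \<subseteq> B"
  shows "card A dvd card B"
proof -
  interpret B: group "G\<lparr>carrier := B\<rparr>" using assms(2) by (rule subgroup_imp_group)
  have "card (rcosets\<^bsub>G\<lparr>carrier := B\<rparr>\<^esub> A) * card A = card B"
    using B.lagrange[OF subgroup_incl[OF assms]] by (simp add: Coset.order_def)
  then show ?thesis by (metis dvd_triv_right)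
qed

lemma (in group) subgroup_conj_image:
  assumes P: "subgroup P G" and g: "g \<in> carrier G"
  shows "subgroup ((\<lambda>x. g \<otimes> x \<otimes> inv g) ` P) G" "card ((\<lambda>x. g \<otimes> x \<otimes> inv g) ` P) = card P"
proof -
  have PG: "x \<in> carrier G" if "x \<in> P" for x using subgroup.mem_carrier[OF P that] .
  have inj: "inj_on (\<lambda>x. g \<otimes> x \<otimes> inv g) P"
    using PG g by (intro inj_onI) (simp add: m_assoc)
  then show "card ((\<lambda>x. g \<otimes> x \<otimes> inv g) ` P) = card P" by (rule card_image)
  show "subgroup ((\<lambda>x. g \<otimes> x \<otimes> inv g) ` P) G"
  proof (rule subgroupI)
    show "(\<lambda>x. g \<otimes> x \<otimes> inv g) ` P \<subseteq> carrier G" using PG g by auto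
    show "(\<lambda>x. g \<otimes> x \<otimes> inv g) ` P \<noteq> {}" using subgroup.one_closed[OF P] by blast
    fix a assume "a \<in> (\<lambda>x. g \<otimes> x \<otimes> inv g) ` P"
    then obtain x where x: "x \<in> P" "a = g \<otimes> x \<otimes> inv g" by blast
    have "inv a = g \<otimes> inv x \<otimes> inv g" using x PG g by (simp add: inv_mult_group m_assoc)
    then show "inv a \<in> (\<lambda>x. g \<otimes> x \<otimes> inv g) ` P" using x subgroup.m_inv_closed[OF P] by blast
    fix b assume "b \<in> (\<lambda>x. g \<otimes> x \<otimes> inv g) ` P"
    then obtain y where y: "y \<in> P" "b = g \<otimes> y \<otimes> inv g" by blast
    have "a \<otimes> b = g \<otimes> x \<otimes> (inv g \<otimes> g) \<otimes> y \<otimes> inv g"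
      using x y PG g by (simp only: m_assoc m_closed inv_closed)
    then have "a \<otimes> b = g \<otimes> (x \<otimes> y) \<otimes> inv g" using x y PG g by (simp add: m_assoc)
    then show "a \<otimes> b \<in> (\<lambda>x. g \<otimes> x \<otimes> inv g) ` P" using x y subgroup.m_closed[OF P] by blast
  qed
qed

text \<open>Conjugation is injective, so on a finite \<open>P\<close> the inclusion of the conjugate
  in \<open>P\<close> is an equality. Hence a one-sided condition suffices to define the
  normalizer.\<close>

lemma (in group) conj_into_imp_inv_conj_into:
  assumes P: "subgroup P G" "finite P" and g: "g \<in> carrier G"
    and into: "\<And>x. x \<in> P \<Longrightarrow> g \<otimes> x \<otimes> inv g \<in> P" and x: "x \<in> P"
  shows "inv g \<otimes> x \<otimes> g \<in> P"
proof -
  have "(\<lambda>x. g \<otimes> x \<otimes> inv g) ` P \<subseteq> P" using into by blast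
  then have "(\<lambda>x. g \<otimes> x \<otimes> inv g) ` P = P"
    using subgroup_conj_image(2)[OF P(1) g] P(2) by (metis card_subset_eq)
  then obtain y where y: "y \<in> P" "x = g \<otimes> y \<otimes> inv g" using x by blast
  have "inv g \<otimes> x \<otimes> g = y"
    using y g subgroup.mem_carrier[OF P(1)] by (simp add: m_assoc[symmetric]) (simp add: m_assoc)
  then show ?thesis using y by simp
qed

lemma (in group) conj_mult:
  assumes "g \<in> carrier G" "h \<in> carrier G" "x \<in> carrier G"
  shows "(g \<otimes> h) \<otimes> x \<otimes> inv (g \<otimes> h) = g \<otimes> (h \<otimes> x \<otimes> inv h) \<otimes> inv g"
  using assms by (simp add: inv_mult_group m_assoc)

lemma (in group) normalizer_subgroup:
  assumes P: "subgroup P G" "finite P"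
  shows "subgroup {g \<in> carrier G. \<forall>x\<in>P. g \<otimes> x \<otimes> inv g \<in> P} G" (is "subgroup ?H G")
proof (rule subgroupI)
  have PG: "x \<in> carrier G" if "x \<in> P" for x using subgroup.mem_carrier[OF P(1) that] .
  have "\<one> \<in> ?H" using PG by simp
  then show "?H \<noteq> {}" by blast
  fix g assume g: "g \<in> ?H"
  then show "inv g \<in> ?H" using conj_into_imp_inv_conj_into[OF P, of g] by simp
  fix h assume "h \<in> ?H"
  then show "g \<otimes> h \<in> ?H" using g PG by (simp add: conj_mult)
qed auto

section \<open>The Frattini argument\<close>

context minimal_normal_non_p_closed
begin

text \<open>\<open>R\<close> is the preimage of the group of \<open>p\<close>-elements of
  \<open>G/N\<close>. So \<open>R/N\<close> is a \<open>p\<close>-group whose order divides that of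
  \<open>G\<close>, and \<open>card R\<close> is at most \<open>card N * card P\<close>. Conversely
  \<open>N <#> P\<close> lies in \<open>R\<close>, and its order is divisible by the coprime numbers
  \<open>card N\<close> and \<open>card P\<close>.\<close>

lemma sylow_product:
  assumes P: "subgroup P G" "card P = p ^ multiplicity p (Coset.order G)"
  defines "R \<equiv> {x \<in> carrier G. \<exists>k::nat. x [^] (p ^ k) \<in> N}"
  shows "R = N <#> P" "card R = card N * card P"
proof -
  define v where "v = multiplicity p (Coset.order G)"
  have R: "R \<lhd> G" unfolding R_def by (rule p_elements_normal[OF N_normal quot_closed[OF N_normal N_nontriv]])
  interpret R: normal R G by (rule R)
  have finR: "finite R" using finite_subset[OF R.subset fin] .
  have finP: "finite P" using finite_subset[OF subgroup.subset[OF P(1)] fin] .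
  have "P \<subseteq> R"
  proof
    fix x assume x: "x \<in> P"
    have "x [^] (p ^ v) \<in> N"
      using subgroup_pow_card[OF P(1) finP x] P(2) subgroup.one_closed[OF N_subgroup] unfolding v_def by metis
    then show "x \<in> R" unfolding R_def using subgroup.mem_carrier[OF P(1) x] by blast
  qed
  have "N \<subseteq> R"
  proof
    fix x assume x: "x \<in> N"
    then have "x [^] (p ^ 0 :: nat) \<in> N" using N_carrier by simp
    then show "x \<in> R" unfolding R_def using N_carrier[OF x] by blast
  qed
  have NP: "subgroup (N <#> P) G" by (rule mult_norm_subgroup[OF N_normal P(1)])
  have NPR: "N <#> P \<subseteq> R" using \<open>N \<subseteq> R\<close> \<open>P \<subseteq> R\<close> R.m_closed by (auto simp: set_mult_def)
  let ?R = "G\<lparr>carrier := R\<rparr>"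
  interpret GR: group ?R by (rule subgroup_imp_group[OF R.subgroup_axioms])
  interpret NR: normal N ?R by (rule normal_restrict_supergroup[OF R.subgroup_axioms N_normal \<open>N \<subseteq> R\<close>])
  interpret F: group "?R Mod N" by (rule NR.factorgroup_is_group)
  interpret h: group_hom ?R "?R Mod N" "\<lambda>a. N #>\<^bsub>?R\<^esub> a" by unfold_locales (rule NR.r_coset_hom_Mod)
  have "\<exists>j. Coset.order (?R Mod N) = p ^ j"
  proof (rule F.p_group_order[OF _ p])
    show "finite (carrier (?R Mod N))" using finR by (simp add: carrier_FactGroup)
    fix X assume "X \<in> carrier (?R Mod N)"
    then obtain x where x: "x \<in> R" "X = N #>\<^bsub>?R\<^esub> x" by (auto simp: carrier_FactGroup)
    then obtain k :: nat where k: "x [^] (p ^ k) \<in> N" unfolding R_def by blast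
    then have k': "x [^]\<^bsub>?R\<^esub> (p ^ k) \<in> N" unfolding nat_pow_consistent[symmetric] .
    have "X [^]\<^bsub>?R Mod N\<^esub> (p ^ k) = N #>\<^bsub>?R\<^esub> (x [^]\<^bsub>?R\<^esub> (p ^ k))"
      using h.hom_nat_pow[of x "p ^ k"] x by simp
    also have "\<dots> = N" using k' NR.subset by (intro GR.coset_join2[OF _ NR.subgroup_axioms]) auto
    finally show "\<exists>k. X [^]\<^bsub>?R Mod N\<^esub> (p ^ k) = \<one>\<^bsub>?R Mod N\<^esub>" by (intro exI[of _ k]) simp
  qed
  then obtain j where j: "Coset.order (?R Mod N) = p ^ j" by blast
  have cR: "card R = p ^ j * card N"
    using GR.lagrange[OF NR.subgroup_axioms] j by (simp add: Coset.order_def FactGroup_def)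
  have o: "Coset.order G > 0" using fin by (simp add: order_gt_0_iff_finite)
  have "card R dvd Coset.order G"
    using subgroup_card_dvd[OF R.subgroup_axioms subgroup_self R.subset] by (simp add: Coset.order_def)
  then have "p ^ j dvd Coset.order G" unfolding cR by (metis dvd_mult_left)
  then have "j \<le> v" unfolding v_def using o p by (intro multiplicity_geI) auto
  have "coprime (card N) (card P)"
    using p_not_dvd_card_N p unfolding P(2) by (simp add: coprime_commute prime_imp_coprime)
  moreover have "N \<subseteq> N <#> P" "P \<subseteq> N <#> P"
    using subgroup.one_closed[OF P(1)] subgroup.one_closed[OF N_subgroup] N_carrier subgroup.mem_carrier[OF P(1)]
    by (force simp: set_mult_def)+
  then have "card N dvd card (N <#> P)" "card P dvd card (N <#> P)"
    using subgroup_card_dvd NP P(1) N_subgroup by blast+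
  ultimately have "card N * card P dvd card (N <#> P)" by (simp add: divides_mult)
  moreover have finNP: "finite (N <#> P)" using finite_subset[OF NPR finR] .
  moreover have "card (N <#> P) > 0" using finNP subgroup.one_closed[OF NP] by (auto simp: card_gt_0_iff)
  ultimately have le: "card N * card P \<le> card (N <#> P)" by (simp add: dvd_imp_le)
  have "p ^ j \<le> p ^ v" using \<open>j \<le> v\<close> prime_ge_1_nat[OF p] by (rule power_increasing)
  then have le2: "card R \<le> card N * card P" unfolding cR P(2) v_def by (simp add: mult.commute)
  show "R = N <#> P" using le le2 NPR finR by (metis card_seteq order_trans)
  then show "card R = card N * card P" using le le2 by simp
qed

text \<open>Once \<open>G = N H\<close> is known, \<open>N \<inter> H\<close> is normal:
  \<open>H\<close> normalizes it and the abelian \<open>N\<close> centralizes it. By minimality it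
  is trivial or \<open>N\<close>; in the second case \<open>H\<close> is the whole group, so the
  Sylow subgroup \<open>P\<close> is normal and \<open>G\<close> is \<open>p\<close>-closed.\<close>

lemma exists_complement:
  "\<exists>H. subgroup H G \<and> N \<inter> H = {\<one>} \<and> (\<forall>g\<in>carrier G. \<exists>u\<in>N. \<exists>h\<in>H. g = u \<otimes> h)"
proof -
  obtain m where m: "Coset.order G = p ^ multiplicity p (Coset.order G) * m"
    using multiplicity_dvd by blast
  obtain P where P: "subgroup P G" "card P = p ^ multiplicity p (Coset.order G)"
    using sylow_thm[OF p is_group m fin] by blast
  have PG: "x \<in> carrier G" if "x \<in> P" for x using subgroup.mem_carrier[OF P(1) that] .
  have finP: "finite P" using finite_subset[OF subgroup.subset[OF P(1)] fin] .
  define R where "R = {x \<in> carrier G. \<exists>k::nat. x [^] (p ^ k) \<in> N}"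
  have R: "R \<lhd> G" unfolding R_def by (rule p_elements_normal[OF N_normal quot_closed[OF N_normal N_nontriv]])
  interpret R: normal R G by (rule R)
  have finR: "finite R" using finite_subset[OF R.subset fin] .
  note RNP = sylow_product[OF P, folded R_def]
  have PR: "P \<subseteq> R" unfolding RNP(1)
    using subgroup.one_closed[OF N_subgroup] PG by (force simp: set_mult_def)
  let ?R = "G\<lparr>carrier := R\<rparr>"
  interpret GR: group ?R by (rule subgroup_imp_group[OF R.subgroup_axioms])
  have PsR: "subgroup P ?R" by (rule subgroup_incl[OF P(1) R.subgroup_axioms PR])
  have "card (rcosets\<^bsub>?R\<^esub> P) * card P = card R" using GR.lagrange[OF PsR] by (simp add: Coset.order_def)
  then have "card (rcosets\<^bsub>?R\<^esub> P) = card N" unfolding RNP(2) using P(2) p by (simp add: prime_gt_0_nat)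
  then have np: "\<not> p dvd card (rcosets\<^bsub>?R\<^esub> P)" using p_not_dvd_card_N by simp
  define H where "H = {g \<in> carrier G. \<forall>x\<in>P. g \<otimes> x \<otimes> inv g \<in> P}"
  have H: "subgroup H G" unfolding H_def by (rule normalizer_subgroup[OF P(1) finP])
  have HG: "h \<in> carrier G" if "h \<in> H" for h using subgroup.mem_carrier[OF H that] .
  have PH: "P \<subseteq> H"
    using PG subgroup.m_closed[OF P(1)] subgroup.m_inv_closed[OF P(1)] by (auto simp: H_def)
  have NH: "\<exists>u\<in>N. \<exists>h\<in>H. g = u \<otimes> h" if g: "g \<in> carrier G" for g
  proof -
    let ?Q = "(\<lambda>x. g \<otimes> x \<otimes> inv g) ` P"
    have "?Q \<subseteq> R" using R.inv_op_closed2[OF g] PR by blast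
    then have Q: "subgroup ?Q ?R" "card ?Q = p ^ multiplicity p (Coset.order G)"
      using subgroup_conj_image[OF P(1) g] P(2) by (auto intro: subgroup_incl[OF _ R.subgroup_axioms])
    \<comment> \<open>\<open>P\<close> and its conjugate both lie in \<open>R\<close>, and the index
      of \<open>P\<close> in \<open>R\<close> is prime to \<open>p\<close>, so an element of
      \<open>R\<close> moves the conjugate back into \<open>P\<close>.\<close>
    obtain r where r: "r \<in> R" "\<And>q. q \<in> ?Q \<Longrightarrow> r \<otimes>\<^bsub>?R\<^esub> q \<otimes>\<^bsub>?R\<^esub> inv\<^bsub>?R\<^esub> r \<in> P"
      using GR.sylow_containment[OF _ p PsR Q np] finR by auto
    have rG: "r \<in> carrier G" using r(1) R.mem_carrier by blast
    have rr: "r \<otimes> q \<otimes> inv r \<in> P" if "q \<in> ?Q" for q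
      using r(2)[OF that] m_inv_consistent[OF R.subgroup_axioms r(1)] by simp
    have "r \<otimes> g \<in> H"
      using rr rG g PG by (auto simp: H_def conj_mult)
    obtain u x where ux: "u \<in> N" "x \<in> P" "r = u \<otimes> x" using r(1) unfolding RNP(1) by (auto simp: set_mult_def)
    have uxG: "u \<in> carrier G" "x \<in> carrier G" using ux N_carrier PG by auto
    \<comment> \<open>From \<open>r = u \<otimes> x\<close> one gets
      \<open>g = inv x \<otimes> inv u \<otimes> (r \<otimes> g)\<close>; conjugating
      \<open>inv u\<close> by \<open>inv x\<close> separates a factor in \<open>N\<close> from a
      factor in \<open>H\<close>.\<close>
    let ?u = "inv x \<otimes> inv u \<otimes> x" and ?h = "inv x \<otimes> (r \<otimes> g)"
    have "?u \<in> N"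
      using N_conj[of "inv x" "inv u"] ux uxG subgroup.m_inv_closed[OF N_subgroup] by simp
    moreover have "?h \<in> H"
      using \<open>r \<otimes> g \<in> H\<close> PH ux subgroup.m_inv_closed[OF P(1)] subgroup.m_closed[OF H] by blast
    moreover have "g = ?u \<otimes> ?h"
    proof -
      have c: "x \<otimes> (inv x \<otimes> y) = y" "inv x \<otimes> (x \<otimes> y) = y" if "x \<in> carrier G" "y \<in> carrier G" for x y
        using that by (simp_all add: m_assoc[symmetric])
      show ?thesis unfolding ux(3) using uxG g by (simp add: m_assoc c)
    qed
    ultimately show ?thesis by blast
  qed
  have "N \<inter> H \<lhd> G"
  proof (rule normal_invI)
    show "subgroup (N \<inter> H) G" by (rule subgroups_Inter_pair[OF N_subgroup H])
    fix g u assume g: "g \<in> carrier G" and u: "u \<in> N \<inter> H"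
    obtain w h where wh: "w \<in> N" "h \<in> H" "g = w \<otimes> h" using NH[OF g] by blast
    have G: "w \<in> carrier G" "h \<in> carrier G" "u \<in> carrier G" using wh u N_carrier HG by auto
    let ?c = "h \<otimes> u \<otimes> inv h"
    have c: "?c \<in> N" "?c \<in> H"
      using N_conj G u wh subgroup.m_closed[OF H] subgroup.m_inv_closed[OF H] by auto
    have "g \<otimes> u \<otimes> inv g = w \<otimes> ?c \<otimes> inv w" unfolding wh(3) by (rule conj_mult[OF G])
    also have "\<dots> = ?c \<otimes> w \<otimes> inv w" using N_comm[OF wh(1) c(1)] by simp
    also have "\<dots> = ?c" using G by (simp add: m_assoc)
    finally show "g \<otimes> u \<otimes> inv g \<in> N \<inter> H" using c by simp
  qed
  then have "N \<inter> H = {\<one>} \<or> N \<inter> H = N" using N_min by blast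
  moreover have "N \<inter> H \<noteq> N"
  proof
    assume "N \<inter> H = N"
    then have "N \<subseteq> H" by blast
    have "H = carrier G"
    proof
      show "carrier G \<subseteq> H" using NH \<open>N \<subseteq> H\<close> subgroup.m_closed[OF H] by blast
    qed (use HG in blast)
    then have "P \<lhd> G" using P(1) by (intro normal_invI) (auto simp: H_def)
    then have "p_closed p G" unfolding p_closed_def using P(2) by blast
    then show False using p_closed_imp_p_closed_mod_one[OF fin p] not_closed by blast
  qed
  ultimately show ?thesis using H NH by blast
qed

end

section \<open>A linear character that extends to its stabilizer\<close>

context minimal_normal_non_p_closed
begin

text \<open>In a product \<open>u h w k\<close> with \<open>u\<close>, \<open>w\<close> in
  \<open>N\<close> and \<open>h\<close>, \<open>k\<close> in \<open>H\<close>, moving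
  \<open>w\<close> past \<open>h\<close> replaces it by its conjugate under \<open>h\<close>. For
  factors in the stabilizer, \<open>h\<close> stabilizes \<open>\<nu>\<close> too, so the value of
  \<open>\<nu>\<close> is unchanged and the extension is multiplicative.\<close>

lemma exists_extendible_linear:
  assumes char: "CHAR('k::alg_closed_field) = 0 \<or> CHAR('k) = p"
  shows "\<exists>T (\<mu> :: 'a \<Rightarrow> 'k). subgroup T G \<and> N \<subseteq> T \<and> T \<noteq> carrier G \<and>
    (\<forall>s\<in>T. \<forall>t\<in>T. \<mu> (s \<otimes> t) = \<mu> s * \<mu> t) \<and> \<mu> \<one> = 1 \<and> (\<exists>u\<in>N. \<mu> u \<noteq> 1) \<and>
    (\<forall>g\<in>carrier G. (\<forall>u\<in>N. \<mu> (g \<otimes> u \<otimes> inv g) = \<mu> u) \<longrightarrow> g \<in> T)"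
proof -
  obtain u0 where u0: "u0 \<in> N" "u0 \<noteq> \<one>"
    using N_nontriv subgroup.one_closed[OF N_subgroup] by blast
  let ?N = "G\<lparr>carrier := N\<rparr>"
  interpret S: group ?N using N_subgroup by (rule subgroup_imp_group)
  have "of_nat (Coset.order ?N) \<noteq> (0::'k)"
    using char p_not_dvd_card_N card_N_gt_1 by (auto simp: of_nat_eq_0_iff_char_dvd Coset.order_def)
  then have "\<exists>\<nu> :: 'a \<Rightarrow> 'k. (\<forall>a\<in>N. \<forall>b\<in>N. \<nu> (a \<otimes> b) = \<nu> a * \<nu> b) \<and> \<nu> \<one> = 1 \<and> \<nu> u0 \<noteq> 1"
    using S.exists_nontrivial_linear[where 'k = 'k and x = u0] N_finite N_comm u0 by simp
  then obtain \<nu> :: "'a \<Rightarrow> 'k" where \<nu>: "\<And>a b. a \<in> N \<Longrightarrow> b \<in> N \<Longrightarrow> \<nu> (a \<otimes> b) = \<nu> a * \<nu> b" "\<nu> \<one> = 1" "\<nu> u0 \<noteq> 1"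
    by blast
  obtain H where H: "subgroup H G" "N \<inter> H = {\<one>}" "\<And>g. g \<in> carrier G \<Longrightarrow> \<exists>u\<in>N. \<exists>h\<in>H. g = u \<otimes> h"
    using exists_complement by blast
  have HG: "h \<in> carrier G" if "h \<in> H" for h using subgroup.mem_carrier[OF H(1) that] .
  have uniq: "u = w" if "u \<in> N" "h \<in> H" "w \<in> N" "k \<in> H" "u \<otimes> h = w \<otimes> k" for u h w k
  proof -
    have G: "u \<in> carrier G" "w \<in> carrier G" "h \<in> carrier G" "k \<in> carrier G" using that N_carrier HG by auto
    have "inv w \<otimes> u = inv w \<otimes> (u \<otimes> h) \<otimes> inv h" using G by (simp add: m_assoc)
    also have "\<dots> = k \<otimes> inv h" unfolding that(5) using G by (simp add: m_assoc[symmetric])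
    finally have e: "inv w \<otimes> u = k \<otimes> inv h" .
    have "inv w \<otimes> u \<in> N" using that N_subgroup by (simp add: subgroup.m_closed subgroup.m_inv_closed)
    moreover have "inv w \<otimes> u \<in> H" unfolding e using that H(1) by (simp add: subgroup.m_closed subgroup.m_inv_closed)
    ultimately have "inv w \<otimes> u = \<one>" using H(2) by blast
    then show "u = w" using G inv_solve_left[of \<one> w u] by simp
  qed
  \<comment> \<open>The projection onto \<open>N\<close> along \<open>H\<close>, defined on all of
    \<open>G\<close>. It is not a homomorphism in general; only its composition with
    \<open>\<nu>\<close>, restricted to \<open>T\<close>, has to be one.\<close>
  define \<pi> where "\<pi> g = (THE u. u \<in> N \<and> (\<exists>h\<in>H. g = u \<otimes> h))" for g
  have \<pi>: "\<pi> (u \<otimes> h) = u" if "u \<in> N" "h \<in> H" for u h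
    unfolding \<pi>_def using that uniq by (intro the_equality) blast+
  define T where "T = {g \<in> carrier G. \<forall>u\<in>N. \<nu> (g \<otimes> u \<otimes> inv g) = \<nu> u}"
  have T: "subgroup T G"
  proof (rule subgroupI)
    have "\<one> \<in> T" using N_carrier by (simp add: T_def)
    then show "T \<noteq> {}" by blast
    fix g assume g: "g \<in> T"
    then have gG: "g \<in> carrier G" by (simp add: T_def)
    have "\<nu> (inv g \<otimes> u \<otimes> inv (inv g)) = \<nu> u" if u: "u \<in> N" for u
    proof -
      have "inv g \<otimes> u \<otimes> inv (inv g) \<in> N" using N_conj[of "inv g" u] gG u by simp
      then have "\<nu> (g \<otimes> (inv g \<otimes> u \<otimes> inv (inv g)) \<otimes> inv g) = \<nu> (inv g \<otimes> u \<otimes> inv (inv g))"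
        using g by (simp add: T_def)
      moreover have "g \<otimes> (inv g \<otimes> u \<otimes> inv (inv g)) \<otimes> inv g = u"
        using conj_mult[of g "inv g" u] gG N_carrier[OF u] by simp
      ultimately show ?thesis by simp
    qed
    then show "inv g \<in> T" using gG by (simp add: T_def)
    fix h assume "h \<in> T"
    then show "g \<otimes> h \<in> T" using g N_conj N_carrier by (simp add: T_def conj_mult)
  qed (simp add: T_def Collect_restrict)
  have NT: "N \<subseteq> T"
  proof
    fix w assume w: "w \<in> N"
    have "w \<otimes> u \<otimes> inv w = u" if "u \<in> N" for u
      using N_comm[OF w that] N_carrier[OF w] N_carrier[OF that] by (simp add: m_assoc)
    then show "w \<in> T" using N_carrier[OF w] by (simp add: T_def)
  qed
  define \<mu> where "\<mu> g = \<nu> (\<pi> g)" for g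
  have \<mu>N: "\<mu> u = \<nu> u" if "u \<in> N" for u
    using \<pi>[OF that subgroup.one_closed[OF H(1)]] N_carrier[OF that] by (simp add: \<mu>_def)
  have \<mu>_mult: "\<mu> (s \<otimes> t) = \<mu> s * \<mu> t" if s: "s \<in> T" and t: "t \<in> T" for s t
  proof -
    have stG: "s \<in> carrier G" "t \<in> carrier G" using s t by (simp_all add: T_def)
    obtain u h where uh: "u \<in> N" "h \<in> H" "s = u \<otimes> h" using H(3) stG by blast
    obtain w k where wk: "w \<in> N" "k \<in> H" "t = w \<otimes> k" using H(3) stG by blast
    have G: "u \<in> carrier G" "h \<in> carrier G" "w \<in> carrier G" "k \<in> carrier G"
      using uh wk N_carrier HG by auto
    have c: "h \<otimes> w \<otimes> inv h \<in> N" using N_conj G wk by simp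
    have "h = inv u \<otimes> s" using uh(3) G stG inv_solve_left[of h u s] by simp
    moreover have "inv u \<otimes> s \<in> T"
      using subgroup.m_closed[OF T subgroup.m_inv_closed[OF T]] NT uh(1) s by blast
    ultimately have "h \<in> T" by metis
    then have \<nu>c: "\<nu> (h \<otimes> w \<otimes> inv h) = \<nu> w" using wk by (simp add: T_def)
    have "s \<otimes> t = (u \<otimes> (h \<otimes> w \<otimes> inv h)) \<otimes> (h \<otimes> k)"
    proof -
      have "(u \<otimes> (h \<otimes> w \<otimes> inv h)) \<otimes> (h \<otimes> k) = u \<otimes> h \<otimes> w \<otimes> (inv h \<otimes> h) \<otimes> k"
        using G by (simp only: m_assoc m_closed inv_closed)
      then show ?thesis unfolding uh(3) wk(3) using G by (simp add: m_assoc)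
    qed
    then have "\<pi> (s \<otimes> t) = u \<otimes> (h \<otimes> w \<otimes> inv h)"
      using \<pi> uh wk c H(1) N_subgroup by (simp add: subgroup.m_closed)
    then have "\<mu> (s \<otimes> t) = \<nu> u * \<nu> w" using \<nu>(1)[OF uh(1) c] \<nu>c by (simp add: \<mu>_def)
    then show ?thesis using \<pi>[OF uh(1,2)] \<pi>[OF wk(1,2)] uh(3) wk(3) by (simp add: \<mu>_def)
  qed
  have \<mu>_one: "\<mu> \<one> = 1" using \<mu>N subgroup.one_closed[OF N_subgroup] \<nu>(2) by simp
  \<comment> \<open>Otherwise \<open>\<mu>\<close> is a linear character of \<open>G\<close> whose
    kernel does not contain \<open>N\<close>. By \<open>N_least\<close> it is faithful, so
    \<open>G\<close> would be abelian.\<close>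
  have "T \<noteq> carrier G"
  proof
    assume TG: "T = carrier G"
    let ?K = "{g \<in> carrier G. \<mu> g = 1}"
    have inv1: "\<mu> g * \<mu> (inv g) = 1" if "g \<in> carrier G" for g
      using \<mu>_mult[of g "inv g"] that \<mu>_one TG by simp
    have "?K \<lhd> G"
    proof (rule normal_invI)
      show "subgroup ?K G"
      proof (rule subgroupI)
        show "?K \<noteq> {}" using \<mu>_one by blast
        fix a assume a: "a \<in> ?K"
        then show "inv a \<in> ?K" using inv1[of a] by simp
        fix b assume "b \<in> ?K"
        then show "a \<otimes> b \<in> ?K" using a \<mu>_mult TG by simp
      qed auto
      fix g k assume "g \<in> carrier G" "k \<in> ?K"
      then show "g \<otimes> k \<otimes> inv g \<in> ?K" using \<mu>_mult[unfolded TG] inv1[of g] by simp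
    qed
    moreover have "\<not> N \<subseteq> ?K" using u0 \<nu>(3) \<mu>N by auto
    ultimately have K: "?K = {\<one>}" using N_least by blast
    obtain x y where xy: "x \<in> carrier G" "y \<in> carrier G" "x \<otimes> y \<noteq> y \<otimes> x" using not_comm by blast
    have "\<mu> ((x \<otimes> y) \<otimes> inv (y \<otimes> x)) = \<mu> (x \<otimes> y) * \<mu> (inv (y \<otimes> x))"
      using xy \<mu>_mult[unfolded TG] by simp
    also have "\<mu> (x \<otimes> y) = \<mu> (y \<otimes> x)" using xy \<mu>_mult[unfolded TG] by simp
    also have "\<mu> (y \<otimes> x) * \<mu> (inv (y \<otimes> x)) = 1" using xy inv1 by simp
    finally have "(x \<otimes> y) \<otimes> inv (y \<otimes> x) \<in> ?K" using xy by simp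
    then have "(x \<otimes> y) \<otimes> inv (y \<otimes> x) = \<one>" unfolding K by simp
    then have "x \<otimes> y = y \<otimes> x" using xy inv_solve_right[of \<one> "x \<otimes> y" "y \<otimes> x"] by simp
    then show False using xy by simp
  qed
  moreover have "g \<in> T" if "g \<in> carrier G" "\<forall>u\<in>N. \<mu> (g \<otimes> u \<otimes> inv g) = \<mu> u" for g
    using that \<mu>N N_conj by (simp add: T_def)
  moreover have "\<mu> u0 \<noteq> 1" using \<mu>N u0 \<nu>(3) by simp
  ultimately show ?thesis using T NT \<mu>_mult \<mu>_one u0 by (intro exI[of _ T] exI[of _ \<mu>]) blast
qed

end

section \<open>The theorem on codegrees\<close>

lemma (in group_hom) subgroup_preimage:
  assumes "subgroup M H"
  shows "subgroup {g \<in> carrier G. h g \<in> M} G"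
proof (rule G.subgroupI)
  have "\<one> \<in> {g \<in> carrier G. h g \<in> M}" using subgroup.one_closed[OF assms] by simp
  then show "{g \<in> carrier G. h g \<in> M} \<noteq> {}" by blast
qed (use assms in \<open>auto simp: subgroup.m_closed subgroup.m_inv_closed\<close>)

lemma (in group_hom) normal_preimage:
  assumes "M \<lhd> H"
  shows "{g \<in> carrier G. h g \<in> M} \<lhd> G"
proof (rule G.normal_invI)
  show "subgroup {g \<in> carrier G. h g \<in> M} G"
    by (rule subgroup_preimage[OF normal_imp_subgroup[OF assms]])
  fix x g assume "x \<in> carrier G" "g \<in> {g \<in> carrier G. h g \<in> M}"
  then show "x \<otimes> g \<otimes> inv x \<in> {g \<in> carrier G. h g \<in> M}"
    using normal.inv_op_closed2[OF assms, of "h x" "h g"] by simp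
qed

text \<open>Powers and products of cosets are the cosets of powers and products, so both sides are
  one condition on representatives.\<close>

lemma (in normal) p_closed_mod_FactGroup:
  assumes M: "M \<lhd> G Mod H"
  shows "p_closed_mod p M (G Mod H) \<longleftrightarrow> p_closed_mod p {g \<in> carrier G. H #> g \<in> M} G"
proof -
  interpret F: group "G Mod H" by (rule factorgroup_is_group)
  interpret h: group_hom G "G Mod H" "\<lambda>g. H #> g" by unfold_locales (rule r_coset_hom_Mod)
  have pow: "(H #> g) [^]\<^bsub>G Mod H\<^esub> k = H #> (g [^] k)" if "g \<in> carrier G" for g and k :: nat
    using h.hom_nat_pow[OF that] by simp
  have mult: "(H #> x) \<otimes>\<^bsub>G Mod H\<^esub> (H #> y) = H #> (x \<otimes> y)" if "x \<in> carrier G" "y \<in> carrier G" for x y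
    using h.hom_mult[OF that] by simp
  have ex: "(\<exists>k::nat. (H #> g) [^]\<^bsub>G Mod H\<^esub> (p ^ k) \<in> M) \<longleftrightarrow> (\<exists>k::nat. g [^] (p ^ k) \<in> {g \<in> carrier G. H #> g \<in> M})"
    if "g \<in> carrier G" for g
    using that by (simp add: pow)
  have image: "(\<forall>X\<in>f ` A. P X) \<longleftrightarrow> (\<forall>x\<in>A. P (f x))" for f :: "'a \<Rightarrow> 'a set" and A P by simp
  show ?thesis
    unfolding p_closed_mod_def carrier_FactGroup image
  proof (intro ball_cong refl)
    fix x y assume xy: "x \<in> carrier G" "y \<in> carrier G"
    show "((\<exists>k::nat. (H #> x) [^]\<^bsub>G Mod H\<^esub> (p ^ k) \<in> M) \<longrightarrow> (\<exists>k::nat. (H #> y) [^]\<^bsub>G Mod H\<^esub> (p ^ k) \<in> M) \<longrightarrow>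
        (\<exists>k::nat. ((H #> x) \<otimes>\<^bsub>G Mod H\<^esub> (H #> y)) [^]\<^bsub>G Mod H\<^esub> (p ^ k) \<in> M)) \<longleftrightarrow>
      ((\<exists>k::nat. x [^] (p ^ k) \<in> {g \<in> carrier G. H #> g \<in> M}) \<longrightarrow>
        (\<exists>k::nat. y [^] (p ^ k) \<in> {g \<in> carrier G. H #> g \<in> M}) \<longrightarrow>
        (\<exists>k::nat. (x \<otimes> y) [^] (p ^ k) \<in> {g \<in> carrier G. H #> g \<in> M}))"
      unfolding mult[OF xy] ex[OF xy(1)] ex[OF xy(2)] ex[OF m_closed[OF xy]] ..
  qed
qed

text \<open>\<open>K\<close> is taken of largest order; \<open>G/K\<close> is then the quotient
  \<open>B\<close>, whose proper quotients correspond to the normal subgroups \<open>L\<close>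
  larger than \<open>K\<close>.\<close>

lemma exists_maximal_non_p_closed_mod:
  assumes "group G" "finite (carrier G)" "\<not> p_closed_mod p {\<one>\<^bsub>G\<^esub>} G"
  obtains K where "K \<lhd> G" "\<not> p_closed_mod p K G"
    "\<And>L. L \<lhd> G \<Longrightarrow> K \<subseteq> L \<Longrightarrow> L \<noteq> K \<Longrightarrow> p_closed_mod p L G"
proof -
  interpret group G by fact
  define P where "P K \<longleftrightarrow> K \<lhd> G \<and> \<not> p_closed_mod p K G" for K
  have "P {\<one>\<^bsub>G\<^esub>}" using assms one_is_normal by (simp add: P_def)
  moreover have "card K \<le> card (carrier G)" if "P K" for K
    using that assms(2) by (intro card_mono) (auto simp: P_def dest: normal_imp_subgroup subgroup.subset)
  ultimately obtain K where K: "P K" "\<And>L. P L \<Longrightarrow> card L \<le> card K"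
    using ex_has_greatest_nat[of P "{\<one>\<^bsub>G\<^esub>}" card "Suc (card (carrier G))"]
    unfolding less_Suc_eq_le by blast
  show thesis
  proof (rule that)
    show "K \<lhd> G" "\<not> p_closed_mod p K G" using K by (auto simp: P_def)
    fix L assume L: "L \<lhd> G" "K \<subseteq> L" "L \<noteq> K"
    have "finite L" using finite_subset[OF subgroup.subset[OF normal_imp_subgroup[OF L(1)]] assms(2)] .
    then have "card K < card L" using L by (intro psubset_card_mono) auto
    then show "p_closed_mod p L G" using K(2)[of L] L by (auto simp: P_def)
  qed
qed

text \<open>\<open>X\<close> and \<open>Ker\<close> stand for \<open>Irr\<close> and
  \<open>char_kernel\<close>, or for \<open>IBr \<xi>\<close> and
  \<open>brauer_kernel \<xi>\<close>. The subgroup and the linear character found in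
  \<open>G Mod K\<close> are pulled back to \<open>G\<close>, because the assumption on codegrees
  speaks about characters of \<open>G\<close>.\<close>

theorem p_closed_of_prime_power_codegrees:
  fixes G :: "('a, 'b) monoid_scheme" and \<xi> :: "'k::alg_closed_field \<Rightarrow> complex"
  assumes G: "group G" and fin: "finite (carrier G)" and solv: "solvable G" and p: "prime p"
    and char: "CHAR('k) = 0 \<or> CHAR('k) = p" and \<xi>: "root_lift \<xi>"
    and X: "\<And>H. subgroup H G \<Longrightarrow> X (G\<lparr>carrier := H\<rparr>) = gen_Irr \<xi> (G\<lparr>carrier := H\<rparr>)"
    and Ker: "\<And>n \<rho>. irreducible_representation G n \<rho> \<Longrightarrow> Ker G (gen_char \<xi> G \<rho>) = rep_kernel G n \<rho>"
    and cod: "\<And>\<chi>. \<chi> \<in> nonlinear_monomial_monolithic X Ker G \<Longrightarrow> \<exists>m. codegree Ker G \<chi> = of_nat p ^ m"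
  shows "p_closed p G"
proof (rule ccontr)
  interpret group G by fact
  assume "\<not> p_closed p G"
  then have "\<not> p_closed_mod p {\<one>\<^bsub>G\<^esub>} G" using p_closed_mod_one_imp_p_closed[OF fin p] by blast
  then obtain K where K: "K \<lhd> G" "\<not> p_closed_mod p K G"
    and Kmax: "\<And>L. L \<lhd> G \<Longrightarrow> K \<subseteq> L \<Longrightarrow> L \<noteq> K \<Longrightarrow> p_closed_mod p L G"
    using exists_maximal_non_p_closed_mod[OF G fin] by blast
  interpret K: normal K G by (rule K(1))
  let ?B = "G Mod K"
  interpret B: group ?B by (rule K.factorgroup_is_group)
  define \<pi> where "\<pi> = (\<lambda>g. K #>\<^bsub>G\<^esub> g)"
  interpret \<pi>: group_hom G ?B \<pi>
    unfolding \<pi>_def by unfold_locales (rule K.r_coset_hom_Mod)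
  have surj: "\<pi> ` carrier G = carrier ?B" by (simp add: carrier_FactGroup \<pi>_def)
  have \<pi>K: "\<pi> g = K \<longleftrightarrow> g \<in> K" if "g \<in> carrier G" for g
    using coset_join1[OF _ that K.subgroup_axioms] coset_join2[OF that K.subgroup_axioms] unfolding \<pi>_def by blast
  have KK: "{g \<in> carrier G. \<pi> g \<in> {K}} = K" using \<pi>K K.subset by auto
  have \<pi>_eqD: "g \<in> L" if "\<pi> g = \<pi> l" "l \<in> L" "g \<in> carrier G" "L \<lhd> G" "K \<subseteq> L" for g l L
  proof -
    have L: "subgroup L G" using that(4) by (rule normal_imp_subgroup)
    have "g \<in> K #>\<^bsub>G\<^esub> l" using rcos_self[OF that(3) K.subgroup_axioms] that(1) by (simp add: \<pi>_def)
    then obtain k where "k \<in> K" "g = k \<otimes>\<^bsub>G\<^esub> l" by (auto simp: r_coset_def)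
    then show ?thesis using that(2,5) subgroup.m_closed[OF L] by blast
  qed
  interpret B: minimal_non_p_closed ?B p
  proof unfold_locales
    show "finite (carrier ?B)" using fin surj by (metis finite_imageI)
    show "solvable ?B" using \<pi>.solvable_imp_solvable_img[of "carrier G"] solv surj by (simp add: solvable_def)
    show "prime p" by (rule p)
    show "\<not> p_closed_mod p {\<one>\<^bsub>?B\<^esub>} ?B"
      using K.p_closed_mod_FactGroup[OF B.one_is_normal] K(2) KK by (simp add: \<pi>_def)
    fix M assume M: "M \<lhd> ?B" "M \<noteq> {\<one>\<^bsub>?B\<^esub>}"
    have one: "K \<in> M" using subgroup.one_closed[OF normal_imp_subgroup[OF M(1)]] by simp
    then obtain Y where Y: "Y \<in> M" "Y \<noteq> K" using M(2) by auto
    then obtain y where y: "y \<in> carrier G" "Y = \<pi> y"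
      using subgroup.mem_carrier[OF normal_imp_subgroup[OF M(1)] Y(1)] surj by blast
    \<comment> \<open>The preimage of a nontrivial \<open>M\<close> properly contains
      \<open>K\<close>, so \<open>Kmax\<close> applies to it.\<close>
    let ?L = "{g \<in> carrier G. \<pi> g \<in> M}"
    have "?L \<lhd> G" by (rule \<pi>.normal_preimage[OF M(1)])
    moreover have "K \<subseteq> ?L" using \<pi>K one K.subset by auto
    moreover have "?L \<noteq> K" using y Y \<pi>K by blast
    ultimately have "p_closed_mod p ?L G" by (rule Kmax)
    then show "p_closed_mod p M ?B" using K.p_closed_mod_FactGroup[OF M(1)] by (simp add: \<pi>_def)
  qed
  obtain N' where N': "minimal_normal N' ?B" using B.exists_minimal_normal by blast
  interpret N': minimal_normal_non_p_closed ?B p N' by unfold_locales (rule N')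
  obtain T' and \<mu>' :: "'a set \<Rightarrow> 'k" where T': "subgroup T' ?B" "N' \<subseteq> T'" "T' \<noteq> carrier ?B"
    and \<mu>': "\<And>s t. s \<in> T' \<Longrightarrow> t \<in> T' \<Longrightarrow> \<mu>' (s \<otimes>\<^bsub>?B\<^esub> t) = \<mu>' s * \<mu>' t" "\<mu>' \<one>\<^bsub>?B\<^esub> = 1" "\<exists>u\<in>N'. \<mu>' u \<noteq> 1"
    and stab': "\<And>g. g \<in> carrier ?B \<Longrightarrow> (\<And>u. u \<in> N' \<Longrightarrow> \<mu>' (g \<otimes>\<^bsub>?B\<^esub> u \<otimes>\<^bsub>?B\<^esub> inv\<^bsub>?B\<^esub> g) = \<mu>' u) \<Longrightarrow> g \<in> T'"
    using N'.exists_extendible_linear[OF char] by blast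
  define T where "T = {g \<in> carrier G. \<pi> g \<in> T'}"
  define N where "N = {g \<in> carrier G. \<pi> g \<in> N'}"
  define \<mu> where "\<mu> g = \<mu>' (\<pi> g)" for g
  have T: "subgroup T G" unfolding T_def by (rule \<pi>.subgroup_preimage[OF T'(1)])
  have N: "N \<lhd> G" unfolding N_def by (rule \<pi>.normal_preimage[OF N'.N_normal])
  have NT: "N \<subseteq> T" using T'(2) by (auto simp: N_def T_def)
  have N'_img: "\<exists>g\<in>N. u = \<pi> g" if "u \<in> N'" for u
  proof -
    have "u \<in> \<pi> ` carrier G" unfolding surj by (rule N'.N_carrier[OF that])
    then obtain g where "g \<in> carrier G" "u = \<pi> g" by blast
    then show ?thesis using that by (intro bexI[of _ g]) (simp_all add: N_def)
  qed
  have KN: "K \<subseteq> N" using \<pi>K K.subset subgroup.one_closed[OF N'.N_subgroup] by (auto simp: N_def)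
  obtain x n where x: "\<forall>i<n. x i \<in> carrier G" "\<forall>y\<in>carrier G. \<exists>!i::nat. i < n \<and> x i \<otimes>\<^bsub>G\<^esub> y \<in> T"
    using exists_transversal[OF T fin] by blast
  have \<mu>_mult: "\<mu> (s \<otimes>\<^bsub>G\<^esub> t) = \<mu> s * \<mu> t" if "s \<in> T" "t \<in> T" for s t
  proof -
    have st: "s \<in> carrier G" "t \<in> carrier G" "\<pi> s \<in> T'" "\<pi> t \<in> T'" using that by (auto simp: T_def)
    show ?thesis unfolding \<mu>_def \<pi>.hom_mult[OF st(1,2)] by (rule \<mu>'(1)[OF st(3,4)])
  qed
  have \<mu>_one: "\<mu> \<one>\<^bsub>G\<^esub> = 1" unfolding \<mu>_def \<pi>.hom_one by (rule \<mu>'(2))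
  have M: "monomial_rep G T \<mu> x n"
    unfolding monomial_rep_def monomial_rep_axioms_def
    using G T \<mu>_mult \<mu>_one x by (intro conjI allI impI) (assumption | blast)+
  interpret M: monomial_rep G T \<mu> x n by (rule M)
  interpret M: irreducible_monomial_rep G T \<mu> x n N
  proof (intro irreducible_monomial_rep.intro irreducible_monomial_rep_axioms.intro)
    show "monomial_rep G T \<mu> x n" by (rule M)
    show "N \<lhd> G" by (rule N)
    show "N \<subseteq> T" by (rule NT)
    fix g assume g: "g \<in> carrier G" and *: "\<And>u. u \<in> N \<Longrightarrow> \<mu> (g \<otimes>\<^bsub>G\<^esub> u \<otimes>\<^bsub>G\<^esub> inv\<^bsub>G\<^esub> g) = \<mu> u"
    have "\<pi> g \<in> T'"
    proof (rule stab')
      show "\<pi> g \<in> carrier ?B" using g by (rule \<pi>.hom_closed)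
      fix u' assume "u' \<in> N'"
      then obtain u where u: "u \<in> N" "u' = \<pi> u" using N'_img by blast
      have uG: "u \<in> carrier G" using u(1) by (simp add: N_def)
      have "\<pi> (g \<otimes>\<^bsub>G\<^esub> u \<otimes>\<^bsub>G\<^esub> inv\<^bsub>G\<^esub> g) = \<pi> g \<otimes>\<^bsub>?B\<^esub> u' \<otimes>\<^bsub>?B\<^esub> inv\<^bsub>?B\<^esub> (\<pi> g)"
        unfolding u(2) \<pi>.hom_mult[OF m_closed[OF g uG] inv_closed[OF g]] \<pi>.hom_mult[OF g uG] \<pi>.hom_inv[OF g] ..
      then show "\<mu>' (\<pi> g \<otimes>\<^bsub>?B\<^esub> u' \<otimes>\<^bsub>?B\<^esub> inv\<^bsub>?B\<^esub> (\<pi> g)) = \<mu>' u'"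
        using *[OF u(1)] u(2) unfolding \<mu>_def by metis
    qed
    then show "g \<in> T" using g by (simp add: T_def)
  qed
  let ?\<rho> = "M.\<rho>"
  define \<chi> where "\<chi> = gen_char \<xi> G ?\<rho>"
  \<comment> \<open>\<open>\<mu>\<close> is trivial on \<open>K\<close>. A kernel larger than
    \<open>K\<close> would have a nontrivial image in the quotient, which contains
    \<open>N'\<close>; then \<open>N\<close> would lie in the kernel and \<open>\<mu>\<close> would
    be trivial on it.\<close>
  have ker: "rep_kernel G n ?\<rho> = K"
  proof
    show "K \<subseteq> rep_kernel G n ?\<rho>"
    proof
      fix k assume k: "k \<in> K"
      show "k \<in> rep_kernel G n ?\<rho>"
      proof (rule M.rep_kernelI[OF K(1) _ _ k])
        show "K \<subseteq> T" using KN NT by blast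
        show "\<mu> l = 1" if "l \<in> K" for l
          using \<pi>K[of l] that K.subset \<mu>'(2) by (auto simp: \<mu>_def)
      qed
    qed
    then have KL: "K \<subseteq> rep_kernel G n ?\<rho>" .
    show "rep_kernel G n ?\<rho> \<subseteq> K"
    proof (rule ccontr)
      assume no: "\<not> rep_kernel G n ?\<rho> \<subseteq> K"
      have L: "rep_kernel G n ?\<rho> \<lhd> G" by (rule rep_kernel_normal[OF G M.representation_\<rho>])
      have "\<pi> ` rep_kernel G n ?\<rho> \<lhd> ?B"
        by (rule normal.surj_hom_normal_subgroup[OF L \<pi>.group_hom_axioms surj])
      moreover have "\<pi> ` rep_kernel G n ?\<rho> \<noteq> {\<one>\<^bsub>?B\<^esub>}"
      proof -
        obtain l where l: "l \<in> rep_kernel G n ?\<rho>" "l \<notin> K" using no by blast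
        then have "\<pi> l \<noteq> K" using \<pi>K by (simp add: rep_kernel_iff)
        then show ?thesis using l by auto
      qed
      ultimately have "N' \<subseteq> \<pi> ` rep_kernel G n ?\<rho>" by (rule N'.N_least)
      then have sub: "N' \<subseteq> \<pi> ` rep_kernel G n ?\<rho>" .
      have "N \<subseteq> rep_kernel G n ?\<rho>"
      proof
        fix g assume "g \<in> N"
        then have g: "g \<in> carrier G" "\<pi> g \<in> N'" by (simp_all add: N_def)
        then obtain l where "l \<in> rep_kernel G n ?\<rho>" "\<pi> g = \<pi> l" using sub by blast
        then show "g \<in> rep_kernel G n ?\<rho>" using \<pi>_eqD[OF _ _ g(1) L KL] by blast
      qed
      then have "\<mu> u = 1" if "u \<in> N" for u
        using M.rep_kernelD[OF L subset_refl] that NT by blast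
      then show False using \<mu>'(3) N'_img unfolding \<mu>_def by metis
    qed
  qed
  have irr: "irreducible_representation G n ?\<rho>" by (rule M.irreducible_\<rho>)
  have Ker\<chi>: "Ker G \<chi> = K" unfolding \<chi>_def Ker[OF irr] by (rule ker)
  have \<chi>1: "\<chi> \<one>\<^bsub>G\<^esub> = of_nat n" unfolding \<chi>_def by (rule gen_char_one[OF G \<xi> M.representation_\<rho>])
  have "n \<noteq> 1"
  proof
    assume "n = 1"
    then have "card T = card (carrier G)" using M.card_carrier by simp
    then have "T = carrier G" using fin subgroup.subset[OF T] by (metis card_subset_eq)
    then have "carrier ?B \<subseteq> T'" unfolding surj[symmetric] T_def by blast
    then show False using T'(1,3) subgroup.subset[OF T'(1)] by blast
  qed
  then have "n > 1" using M.n_pos by linarith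
  have XG: "X G = gen_Irr \<xi> G" using X[OF subgroup_self] by simp
  have "\<chi> \<in> nonlinear_monomial_monolithic X Ker G"
    unfolding nonlinear_monomial_monolithic_def mem_Collect_eq
  proof (intro conjI)
    show "\<chi> \<in> X G" unfolding XG gen_Irr_def \<chi>_def using irr by blast
    show "Re (\<chi> \<one>\<^bsub>G\<^esub>) > 1" unfolding \<chi>1 using \<open>n > 1\<close> by simp
    show "monomial_char X G \<chi>" unfolding monomial_char_def
    proof (intro exI conjI)
      show "subgroup T G" by (rule T)
      show "lin_char \<xi> G T \<mu> \<in> X (G\<lparr>carrier := T\<rparr>)"
        unfolding X[OF T] by (rule lin_char_in_gen_Irr[OF G T fin \<xi> \<mu>_mult \<mu>_one])
      show "lin_char \<xi> G T \<mu> \<one>\<^bsub>G\<^esub> = 1"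
        using \<mu>_one \<xi> subgroup.one_closed[OF T] by (simp add: lin_char_def root_lift_def)
      show "\<chi> = induced_character G T (lin_char \<xi> G T \<mu>)"
        unfolding \<chi>_def by (rule gen_char_monomial_rep[OF M fin \<xi>])
    qed
    show "monolithic_char Ker G \<chi>" unfolding monolithic_char_def Ker\<chi>
    proof (rule ex1I[of _ N'])
      show "minimal_normal N' ?B" by (rule N')
      fix M assume m: "minimal_normal M ?B"
      then have "N' \<subseteq> M" by (intro N'.N_least) (auto simp: minimal_normal_def)
      then show "M = N'" using m N'.N_normal N'.N_nontriv unfolding minimal_normal_def by blast
    qed
  qed
  then obtain m where m: "codegree Ker G \<chi> = of_nat p ^ m" using cod by blast
  have "of_nat (card (rcosets\<^bsub>G\<^esub> K)) = (of_nat p ^ m * of_nat n :: complex)"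
    using m \<open>n > 1\<close> unfolding codegree_def Ker\<chi> \<chi>1 by (simp add: field_simps)
  then have "of_nat (card (rcosets\<^bsub>G\<^esub> K)) = (of_nat (p ^ m * n) :: complex)" by simp
  then have idx: "card (rcosets\<^bsub>G\<^esub> K) = p ^ m * n" by (simp only: of_nat_eq_iff)
  \<comment> \<open>The degree \<open>n\<close> is the index of \<open>T\<close>, so a codegree
    \<open>p ^ m\<close> means \<open>card T = p ^ m * card K\<close>. As
    \<open>card N = card N' * card K\<close> divides \<open>card T\<close>, the order of
    \<open>N'\<close> divides \<open>p ^ m\<close>.\<close>
  have "p ^ m * n * card K = card T * n"
    using lagrange[OF K.subgroup_axioms] M.card_carrier unfolding idx Coset.order_def by simp
  then have cT: "card T = p ^ m * card K" using \<open>n > 1\<close> by simp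
  have cN: "card N' * card K = card N"
  proof -
    have Nsub: "subgroup N G" by (rule normal_imp_subgroup[OF N])
    interpret GN: group "G\<lparr>carrier := N\<rparr>" by (rule subgroup_imp_group[OF Nsub])
    have "rcosets\<^bsub>G\<lparr>carrier := N\<rparr>\<^esub> K = \<pi> ` N" by (auto simp: RCOSETS_def \<pi>_def)
    also have "\<pi> ` N = N'" using N'_img unfolding N_def by blast
    finally show ?thesis
      using GN.lagrange[OF subgroup_incl[OF K.subgroup_axioms Nsub KN]] by (simp add: Coset.order_def)
  qed
  have "card K > 0" 
    unfolding card_gt_0_iff using finite_subset[OF K.subset fin] K.one_closed by blast
  have "card N dvd card T" by (rule subgroup_card_dvd[OF normal_imp_subgroup[OF N] T NT])
  then have "card N' dvd p ^ m" using \<open>card K > 0\<close> unfolding cN[symmetric] cT by simp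
  then obtain i where i: "card N' = p ^ i" using divides_primepow_nat[OF p] by blast
  have "i \<noteq> 0" using i N'.card_N_gt_1 by (cases i) auto
  then have "p dvd card N'" unfolding i by simp
  then show False using N'.p_not_dvd_card_N by blast
qed

theorem theorem1:
  fixes G :: "('a, 'b) monoid_scheme"
    and p :: nat
    and \<xi> :: "'k::alg_closed_field \<Rightarrow> complex"
  assumes "group G"
    and "finite (carrier G)"
    and "solvable G"
    and "carrier G \<noteq> {\<one>\<^bsub>G\<^esub>}"
    and "prime p"
    and "p dvd Coset.order G"
  shows "((\<forall>\<chi> \<in> nonlinear_monomial_monolithic Irr char_kernel G.
             \<exists>m::nat. codegree char_kernel G \<chi> = of_nat p ^ m)
           \<longrightarrow> p_closed p G) \<and>
         (CHAR('k) = p \<longrightarrow> brauer_lift \<xi> \<longrightarrow>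
           (\<forall>\<phi> \<in> nonlinear_monomial_monolithic (IBr \<xi>) (brauer_kernel \<xi>) G.
             \<exists>m::nat. codegree (brauer_kernel \<xi>) G \<phi> = of_nat p ^ m)
           \<longrightarrow> p_closed p G)"
proof (intro conjI impI)
  assume cod: "\<forall>\<chi> \<in> nonlinear_monomial_monolithic Irr char_kernel G.
    \<exists>m::nat. codegree char_kernel G \<chi> = of_nat p ^ m"
  show "p_closed p G"
  proof (rule p_closed_of_prime_power_codegrees[OF assms(1-3,5) _ root_lift_id])
    show "CHAR(complex) = 0 \<or> CHAR(complex) = p" by simp
    show "Irr (G\<lparr>carrier := H\<rparr>) = gen_Irr (\<lambda>z. z) (G\<lparr>carrier := H\<rparr>)" if "subgroup H G" for H
      using group.subgroup_imp_group[OF assms(1) that] finite_subset[OF subgroup.subset[OF that] assms(2)]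
      by (intro Irr_eq_gen_Irr) simp_all
    show "char_kernel G (gen_char (\<lambda>z. z) G \<rho>) = rep_kernel G n \<rho>"
      if "irreducible_representation G n \<rho>" for n \<rho>
    proof -
      have r: "representation G n \<rho>" using that unfolding irreducible_representation_def by blast
      show ?thesis
        using char_kernel_eq[OF assms(1,2) r] unfolding character_eq_gen_char[OF assms(1,2) r] .
    qed
    show "\<exists>m. codegree char_kernel G \<chi> = of_nat p ^ m"
      if "\<chi> \<in> nonlinear_monomial_monolithic Irr char_kernel G" for \<chi> using cod that by blast
  qed
next
  assume char: "CHAR('k) = p" and lift: "brauer_lift \<xi>"
    and cod: "\<forall>\<phi> \<in> nonlinear_monomial_monolithic (IBr \<xi>) (brauer_kernel \<xi>) G.
      \<exists>m::nat. codegree (brauer_kernel \<xi>) G \<phi> = of_nat p ^ m"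
  have pr: "prime CHAR('k)" using assms(5) char by simp
  have \<xi>: "root_lift \<xi>" by (rule brauer_lift_imp_root_lift[OF lift])
  show "p_closed p G"
  proof (rule p_closed_of_prime_power_codegrees[OF assms(1-3,5) _ \<xi>])
    show "CHAR('k) = 0 \<or> CHAR('k) = p" using char by simp
    show "IBr \<xi> (G\<lparr>carrier := H\<rparr>) = gen_Irr \<xi> (G\<lparr>carrier := H\<rparr>)" if "subgroup H G" for H
      by (rule IBr_eq_gen_Irr[OF pr])
    show "brauer_kernel \<xi> G (gen_char \<xi> G \<rho>) = rep_kernel G n \<rho>"
      if "irreducible_representation G n \<rho>" for n \<rho>
      using brauer_kernel_eq[OF assms(1-3) pr \<xi> that] unfolding brauer_character_eq_gen_char[OF pr] .
    show "\<exists>m. codegree (brauer_kernel \<xi>) G \<phi> = of_nat p ^ m"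
      if "\<phi> \<in> nonlinear_monomial_monolithic (IBr \<xi>) (brauer_kernel \<xi>) G" for \<phi> using cod that by blast
  qed
qed

end
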